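(* Let $M=(M_k)$ be a weakly log-convex weight sequence with moderate growth, and let $\ell,m,n$ be positive integers. Then the mapping $f\mapsto f^\vee$, $f^\vee(x)(y)=f(x,y)$, gives bornological isomorphisms \begin{align*} \mathcal D(\mathbb R^\ell\times\mathbb R^m,\mathbb R^n)&\cong\mathcal D(\mathbb R^\ell,\mathcal D(\mathbb R^m,\mathbb R^n)),\\ \mathcal D^{[M]}(\mathbb R^\ell\times\mathbb R^m,\mathbb R^n)&\cong\mathcal D^{[M]}(\mathbb R^\ell,\mathcal D^{[M]}(\mathbb R^m,\mathbb R^n)), \end{align*} where $[M]$ stands either for $(M)$ throughout or for $\{M\}$ throughout; the statement holds in both cases.
   Context: A bornological isomorphism is a linear bijection which, together with its inverse, maps bounded sets to bounded sets. A weight sequence is a sequence $M=(M_k)_{k\in\mathbb N}$, $\mathbb N=\{0,1,\dots\}$, of positive reals with $M_0=1\le M_1$. It is weakly log-convex if $(k!M_k)_k$ is log-convex, and has moderate growth if $\sup_{j,k\ge1}\big(\tfrac{M_{j+k}}{M_jM_k}\big)^{1/(j+k)}<\infty$. For a locally convex space $F$ and compact $K\subseteq\mathbb R^\ell$ let $C^\infty_K(\mathbb R^\ell,F):=\{f\in C^\infty(\mathbb R^\ell,F): f(x)=0\ \forall x\notin K\}$ with the topology of uniform convergence of each derivative separately, and $\mathcal D(\mathbb R^\ell,F):=\varinjlim_K C^\infty_K(\mathbb R^\ell,F)$ (locally convex inductive limit over all compact $K\subseteq \mathbb R^\ell$). For open $U\subseteq\mathbb R^\ell$ and $\rho>0$,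 $\mathcal B^M_\rho(U,\mathbb R)$ is the Banach space of $f\in C^\infty(U,\mathbb R)$ with norm $\sup_{k\in\mathbb N,x\in U}\frac{\|f^{(k)}(x)\|}{\rho^kk!M_k}<\infty$ (operator norm of the $k$-th Fréchet derivative); $\mathcal B^{(M)}(U,\mathbb R):=\varprojlim_n\mathcal B^M_{1/n}(U,\mathbb R)$, $\mathcal B^{\{M\}}(U,\mathbb R):=\varinjlim_n\mathcal B^M_n(U,\mathbb R)$. For a convenient (i.e. Mackey complete locally convex) space $F$, $\mathcal B^{[M]}(\mathbb R^\ell,F)$ is the space of $f\in C^\infty(\mathbb R^\ell,F)$ with $\lambda\circ f\in\mathcal B^{[M]}(\mathbb R^\ell,\mathbb R)$ for all continuous linear functionals $\lambda$ on $F$, with the initial locally convex topology with respect to the mappings $f\mapsto\lambda\circ f\in\mathcal B^{[M]}(\mathbb R^\ell,\mathbb R)$. $C^{(M)}(\mathbb R^\ell,\mathbb R)$ (resp. $C^{\{M\}}(\mathbb R^\ell,\mathbb R)$) is the set of $f\in C^\infty(\mathbb R^\ell,\mathbb R)$ such that for every compact $K\subseteq\mathbb R^\ell$ and all (resp. some) $\rho>0$ one has $\sup_{k\in\mathbb N,x\in K}\frac{\|f^{(k)}(x)\|}{\rho^kk!M_k}<\infty$; $C^{[M]}(\mathbb R^\ell,F)$ is the set of $f\in C^\infty(\mathbb R^\ell,F)$ with $\lambda\circ f\in C^{[M]}(\mathbb R^\ell,\mathbb R)$ for all continuous linear functionals $\lambda$ on $F$. Set $C^{[M]}_K(\mathbb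 R^\ell,F):=\{f\in C^{[M]}(\mathbb R^\ell,F): f(x)=0\ \forall x\notin K\}$ with the subspace topology induced from $\mathcal B^{[M]}(\mathbb R^\ell,F)$, and $\mathcal D^{[M]}(\mathbb R^\ell,F):=\varinjlim_KC^{[M]}_K(\mathbb R^\ell,F)$ (locally convex inductive limit over all compact $K\subseteq\mathbb R^\ell$). *)

theory Defs
  imports "HOL-Analysis.Analysis" "HOL-Library.Function_Algebras"
begin

text \<open>Function types carry the pointwise vector space structure, so that spaces of functions
  (possibly with values in spaces of functions) are linear subspaces of a type.\<close>

instantiation "fun" :: (type, real_vector) real_vector
begin

definition scaleR_fun :: "real \<Rightarrow> ('a \<Rightarrow> 'b) \<Rightarrow> 'a \<Rightarrow> 'b" where
  "scaleR_fun r f = (\<lambda>x. r *\<^sub>R f x)"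

instance
  by standard (auto simp: scaleR_fun_def fun_eq_iff scaleR_add_right scaleR_add_left)

end

section \<open>Locally convex spaces\<close>

text \<open>A locally convex space is represented by its topology: the underlying vector space is the
  linear subspace \<^term>\<open>topspace T\<close> of the ambient type, with the operations of that type.\<close>

definition linear_on_set :: "'v::real_vector set \<Rightarrow> ('v \<Rightarrow> 'w::real_vector) \<Rightarrow> bool" where
  "linear_on_set V g \<longleftrightarrow>
     (\<forall>x\<in>V. \<forall>y\<in>V. g (x + y) = g x + g y) \<and> (\<forall>c. \<forall>x\<in>V. g (c *\<^sub>R x) = c *\<^sub>R g x)"

definition seminorm_on :: "'v::real_vector set \<Rightarrow> ('v \<Rightarrow> real) \<Rightarrow> bool" where
  "seminorm_on V p \<longleftrightarrow>
     (\<forall>x\<in>V. 0 \<le> p x) \<and>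
     (\<forall>x\<in>V. \<forall>y\<in>V. p (x + y) \<le> p x + p y) \<and>
     (\<forall>c. \<forall>x\<in>V. p (c *\<^sub>R x) = \<bar>c\<bar> * p x)"

text \<open>The locally convex topology on \<open>V\<close> generated by a set \<open>P\<close> of seminorms. (Adding \<open>V\<close> itself
  only matters for empty \<open>P\<close>.)\<close>

definition seminorm_topology :: "'v::real_vector set \<Rightarrow> ('v \<Rightarrow> real) set \<Rightarrow> 'v topology" where
  "seminorm_topology V P =
     topology_generated_by (insert V {{y \<in> V. p (y - x) < e} | p x e. p \<in> P \<and> x \<in> V \<and> e > 0})"

definition cont_seminorms :: "'v::real_vector topology \<Rightarrow> ('v \<Rightarrow> real) set" where
  "cont_seminorms T = {p. seminorm_on (topspace T) p \<and> continuous_map T euclideanreal p}"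

definition locally_convex :: "'v::real_vector topology \<Rightarrow> bool" where
  "locally_convex T \<longleftrightarrow>
     subspace (topspace T) \<and> T = seminorm_topology (topspace T) (cont_seminorms T)"

definition dual_space :: "'v::real_vector topology \<Rightarrow> ('v \<Rightarrow> real) set" where
  "dual_space T = {l. linear_on_set (topspace T) l \<and> continuous_map T euclideanreal l}"

text \<open>Initial topology on \<open>V\<close> with respect to maps \<open>g i\<close>, \<open>i \<in> I\<close>, into spaces \<open>T i\<close>. For linear maps
  into locally convex spaces it is locally convex, hence is the initial locally convex topology.\<close>

definition initial_topology ::
    "'v set \<Rightarrow> 'i set \<Rightarrow> ('i \<Rightarrow> 'v \<Rightarrow> 'w) \<Rightarrow> ('i \<Rightarrow> 'w topology) \<Rightarrow> 'v topology" where
  "initial_topology V I g T =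
     topology_generated_by (insert V {{x \<in> V. g i x \<in> U} | i U. i \<in> I \<and> openin (T i) U})"

text \<open>Projective limit of a system of locally convex spaces whose connecting maps are inclusions.\<close>

definition lc_proj_limit :: "'v topology set \<Rightarrow> 'v topology" where
  "lc_proj_limit TT = initial_topology (\<Inter>T\<in>TT. topspace T) TT (\<lambda>_ x. x) (\<lambda>T. T)"

text \<open>Locally convex inductive limit of a directed system whose connecting maps are inclusions: the
  union with the finest locally convex topology that makes all inclusions continuous. This topology
  is generated by all seminorms with continuous restrictions to the steps, see
  \<open>lc_ind_limit_inclusion\<close> and \<open>lc_ind_limit_finest\<close>.\<close>

definition lc_ind_limit :: "'v::real_vector topology set \<Rightarrow> 'v topology" where
  "lc_ind_limit TT =
     seminorm_topology (\<Union>T\<in>TT. topspace T)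
       {p. seminorm_on (\<Union>T\<in>TT. topspace T) p \<and> (\<forall>T\<in>TT. continuous_map T euclideanreal p)}"

text \<open>Bounded means absorbed by every neighbourhood of zero.\<close>

definition bounded_in :: "'v::real_vector topology \<Rightarrow> 'v set \<Rightarrow> bool" where
  "bounded_in T B \<longleftrightarrow>
     B \<subseteq> topspace T \<and> (\<forall>U. openin T U \<and> 0 \<in> U \<longrightarrow> (\<exists>r>0. B \<subseteq> (\<lambda>x. r *\<^sub>R x) ` U))"

definition bornological_iso ::
    "'v::real_vector topology \<Rightarrow> 'w::real_vector topology \<Rightarrow> ('v \<Rightarrow> 'w) \<Rightarrow> bool" where
  "bornological_iso S T \<Phi> \<longleftrightarrow>
     linear_on_set (topspace S) \<Phi> \<and> bij_betw \<Phi> (topspace S) (topspace T) \<and>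
     (\<forall>B. bounded_in S B \<longrightarrow> bounded_in T (\<Phi> ` B)) \<and>
     (\<forall>B. bounded_in T B \<longrightarrow> bounded_in S (inv_into (topspace S) \<Phi> ` B))"

lemma topspace_seminorm_topology [simp]: "topspace (seminorm_topology V P) = V"
  by (auto simp: seminorm_topology_def topology_generated_by_topspace)

lemma topspace_initial_topology [simp]: "topspace (initial_topology V I g T) = V"
  by (auto simp: initial_topology_def topology_generated_by_topspace)

lemma topspace_lc_proj_limit [simp]: "topspace (lc_proj_limit TT) = (\<Inter>T\<in>TT. topspace T)"
  by (simp add: lc_proj_limit_def)

lemma topspace_lc_ind_limit [simp]: "topspace (lc_ind_limit TT) = (\<Union>T\<in>TT. topspace T)"
  by (simp add: lc_ind_limit_def)

lemma openin_seminorm_ball: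
  "p \<in> P \<Longrightarrow> x \<in> V \<Longrightarrow> e > 0 \<Longrightarrow> openin (seminorm_topology V P) {y \<in> V. p (y - x) < e}"
  unfolding seminorm_topology_def by (rule topology_generated_by_Basis) blast

lemma openin_seminorm_ball_shifted:
  assumes V: "subspace V" and W: "subspace W" "V \<subseteq> W" and p: "p \<in> P" "seminorm_on W p"
    and x: "x \<in> W"
  shows "openin (seminorm_topology V P) {y \<in> V. p (y - x) < e}"
proof (subst openin_subopen, intro ballI)
  fix z assume "z \<in> {y \<in> V. p (y - x) < e}"
  then have z: "z \<in> V" "p (z - x) < e" by auto
  define d where "d = e - p (z - x)"
  have "d > 0" using z by (simp add: d_def)
  have p0: "p 0 = 0"
  proof -
    have "p (0 *\<^sub>R x) = \<bar>0\<bar> * p x" using p x unfolding seminorm_on_def by blast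
    then show ?thesis by simp
  qed
  have "p (y - x) < e" if "y \<in> V" "p (y - z) < d" for y
  proof -
    have m: "y - z \<in> W" "z - x \<in> W" using that z W x by (auto intro!: subspace_diff)
    have "p ((y - z) + (z - x)) \<le> p (y - z) + p (z - x)"
      using p m unfolding seminorm_on_def by blast
    then show ?thesis using that by (simp add: d_def)
  qed
  then show "\<exists>U. openin (seminorm_topology V P) U \<and> z \<in> U \<and> U \<subseteq> {y \<in> V. p (y - x) < e}"
    using openin_seminorm_ball[OF p(1) z(1) \<open>d > 0\<close>] z \<open>d > 0\<close> p0
    by (intro exI[of _ "{y \<in> V. p (y - z) < d}"]) auto
qed

lemma continuous_map_seminorm:
  assumes V: "subspace V" and p: "p \<in> P" "seminorm_on V p"
  shows "continuous_map (seminorm_topology V P) euclideanreal p"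
proof -
  have tri: "\<bar>p y - p x\<bar> \<le> p (y - x)" if "x \<in> V" "y \<in> V" for x y
  proof -
    have m: "y - x \<in> V" using that V by (auto intro: subspace_diff)
    have "p (x + (y - x)) \<le> p x + p (y - x)" "p (y + (-1) *\<^sub>R (y - x)) \<le> p y + p ((-1) *\<^sub>R (y - x))"
      "p ((-1) *\<^sub>R (y - x)) = \<bar>-1\<bar> * p (y - x)"
      using p that m subspace_scale[OF V m] unfolding seminorm_on_def by blast+
    then show ?thesis by simp
  qed
  have p0: "p 0 = 0"
  proof -
    have "p (0 *\<^sub>R 0) = \<bar>0\<bar> * p 0" using p subspace_0[OF V] unfolding seminorm_on_def by blast
    then show ?thesis by simp
  qed
  show ?thesis
    unfolding continuous_map_def
  proof (intro conjI allI impI)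
    fix U :: "real set" assume "openin euclideanreal U"
    then have "open U" by simp
    show "openin (seminorm_topology V P) {x \<in> topspace (seminorm_topology V P). p x \<in> U}"
    proof (subst openin_subopen, intro ballI)
      fix x assume "x \<in> {x \<in> topspace (seminorm_topology V P). p x \<in> U}"
      then have x: "x \<in> V" "p x \<in> U" by auto
      then obtain e where e: "e > 0" "\<And>r. \<bar>r - p x\<bar> < e \<Longrightarrow> r \<in> U"
        using \<open>open U\<close> unfolding open_dist dist_real_def by metis
      have "p y \<in> U" if "y \<in> V" "p (y - x) < e" for y
        using tri[OF x(1) that(1)] that e(2) by simp
      then show "\<exists>W. openin (seminorm_topology V P) W \<and> x \<in> W \<and>
          W \<subseteq> {x \<in> topspace (seminorm_topology V P). p x \<in> U}"
        using openin_seminorm_ball[OF p(1) x(1) e(1)] x e(1) p0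
        by (intro exI[of _ "{y \<in> V. p (y - x) < e}"]) auto
    qed
  qed auto
qed

lemma continuous_map_into_seminorm_topology:
  assumes "f \<in> topspace X \<rightarrow> V"
    and "\<And>p x e. p \<in> P \<Longrightarrow> x \<in> V \<Longrightarrow> e > 0 \<Longrightarrow> openin X {y \<in> topspace X. p (f y - x) < e}"
  shows "continuous_map X (seminorm_topology V P) f"
  unfolding seminorm_topology_def
proof (rule continuous_on_generated_topo)
  fix U assume "U \<in> insert V {{y \<in> V. p (y - x) < e} | p x e. p \<in> P \<and> x \<in> V \<and> e > 0}"
  then consider "U = V" | p x e where "U = {y \<in> V. p (y - x) < e}" "p \<in> P" "x \<in> V" "e > 0" by blast
  then show "openin X (f -` U \<inter> topspace X)"
  proof cases
    case 1
    then have "f -` U \<inter> topspace X = topspace X" using assms(1) by auto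
    then show ?thesis by simp
  next
    case 2
    then have "f -` U \<inter> topspace X = {y \<in> topspace X. p (f y - x) < e}" using assms(1) by auto
    then show ?thesis using assms(2)[OF 2(2-4)] by simp
  qed
qed (use assms(1) in auto)

lemma locally_convex_seminorm_topology:
  assumes V: "subspace V" and P: "\<And>p. p \<in> P \<Longrightarrow> seminorm_on V p"
  shows "locally_convex (seminorm_topology V P)"
proof -
  let ?T = "seminorm_topology V P" and ?C = "cont_seminorms (seminorm_topology V P)"
  have sub: "P \<subseteq> ?C" using P V by (auto simp: cont_seminorms_def continuous_map_seminorm)
  have 1: "continuous_map (seminorm_topology V ?C) ?T (\<lambda>x. x)"
  proof (rule continuous_map_into_seminorm_topology)
    fix p x and e :: real assume "p \<in> P" "x \<in> V" "e > 0"
    then have "openin (seminorm_topology V ?C) {y \<in> V. p (y - x) < e}"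
      using sub by (intro openin_seminorm_ball) auto
    then show "openin (seminorm_topology V ?C) {y \<in> topspace (seminorm_topology V ?C). p (y - x) < e}"
      by simp
  qed auto
  have 2: "continuous_map ?T (seminorm_topology V ?C) (\<lambda>x. x)"
  proof (rule continuous_map_into_seminorm_topology)
    fix p x and e :: real assume p: "p \<in> ?C" "x \<in> V" "e > 0"
    then have c: "continuous_map ?T euclideanreal p" and s: "seminorm_on V p"
      by (auto simp: cont_seminorms_def)
    have "continuous_map ?T ?T (\<lambda>y. y - x)"
    proof (rule continuous_map_into_seminorm_topology)
      fix q z and d :: real assume q: "q \<in> P" "z \<in> V" "d > 0"
      have "openin ?T {y \<in> V. q (y - (x + z)) < d}"
        using openin_seminorm_ball[of q P "x + z" V d] q p subspace_add[OF V] by blast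
      then show "openin ?T {y \<in> topspace ?T. q (y - x - z) < d}" by (simp add: diff_diff_eq)
    qed (use V p in \<open>auto intro: subspace_diff\<close>)
    then have "continuous_map ?T euclideanreal (p \<circ> (\<lambda>y. y - x))"
      using c by (rule continuous_map_compose)
    then have "openin ?T {y \<in> topspace ?T. (p \<circ> (\<lambda>y. y - x)) y \<in> {..<e}}"
      by (rule openin_continuous_map_preimage) auto
    then show "openin ?T {y \<in> topspace ?T. p (y - x) < e}" by simp
  qed auto
  have "?T = seminorm_topology V ?C"
  proof (rule topology_eq[THEN iffD2], intro allI iffI)
    fix U assume U: "openin ?T U"
    then have "U \<subseteq> V" using openin_subset by fastforce
    then show "openin (seminorm_topology V ?C) U"
      using openin_continuous_map_preimage[OF 1 U] by (simp add: Int_absorb1 Collect_conj_eq)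
  next
    fix U assume U: "openin (seminorm_topology V ?C) U"
    then have "U \<subseteq> V" using openin_subset by fastforce
    then show "openin ?T U"
      using openin_continuous_map_preimage[OF 2 U] by (simp add: Int_absorb1 Collect_conj_eq)
  qed
  then show ?thesis using V by (simp add: locally_convex_def)
qed

lemma locally_convex_lc_ind_limit:
  assumes "subspace (\<Union>T\<in>TT. topspace T)"
  shows "locally_convex (lc_ind_limit TT)"
  unfolding lc_ind_limit_def by (rule locally_convex_seminorm_topology[OF assms]) auto

lemma lc_ind_limit_inclusion:
  assumes sub: "subspace (\<Union>T\<in>TT. topspace T)" and T: "T \<in> TT" "locally_convex T"
  shows "continuous_map T (lc_ind_limit TT) (\<lambda>x. x)"
  unfolding lc_ind_limit_def
proof (rule continuous_map_into_seminorm_topology)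
  let ?V = "\<Union>T\<in>TT. topspace T"
  fix p x and e :: real
  assume p: "p \<in> {p. seminorm_on ?V p \<and> (\<forall>T\<in>TT. continuous_map T euclideanreal p)}"
    and x: "x \<in> ?V"
  have "seminorm_on (topspace T) p"
    using p T unfolding seminorm_on_def by blast
  then have "p \<in> cont_seminorms T" using p T by (auto simp: cont_seminorms_def)
  moreover have "subspace (topspace T)" using T by (simp add: locally_convex_def)
  ultimately have "openin (seminorm_topology (topspace T) (cont_seminorms T))
      {y \<in> topspace T. p (y - x) < e}"
    using openin_seminorm_ball_shifted[of "topspace T" ?V p "cont_seminorms T" x e] sub p x T by auto
  then show "openin T {y \<in> topspace T. p (y - x) < e}"
    using T by (simp add: locally_convex_def)
qed (use T in auto)

lemma lc_ind_limit_finest: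
  assumes S: "locally_convex S" "topspace S = (\<Union>T\<in>TT. topspace T)"
    and c: "\<And>T. T \<in> TT \<Longrightarrow> continuous_map T S (\<lambda>x. x)"
  shows "continuous_map (lc_ind_limit TT) S (\<lambda>x. x)"
proof -
  have "continuous_map (lc_ind_limit TT) (seminorm_topology (topspace S) (cont_seminorms S)) (\<lambda>x. x)"
  proof (rule continuous_map_into_seminorm_topology)
    fix p x and e :: real assume p: "p \<in> cont_seminorms S" "x \<in> topspace S" "e > 0"
    have "continuous_map T euclideanreal p" if "T \<in> TT" for T
      using continuous_map_compose[OF c[OF that], of euclideanreal p] p
      by (simp add: cont_seminorms_def o_def)
    then have "openin (lc_ind_limit TT) {y \<in> \<Union> (topspace ` TT). p (y - x) < e}"
      using p S(2) unfolding lc_ind_limit_def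
      by (intro openin_seminorm_ball) (auto simp: cont_seminorms_def)
    then show "openin (lc_ind_limit TT) {y \<in> topspace (lc_ind_limit TT). p (y - x) < e}"
      by simp
  qed (use S in auto)
  then show ?thesis using S by (simp add: locally_convex_def)
qed

section \<open>Smooth maps\<close>

text \<open>Directional derivative of a map into a locally convex space (in Hausdorff spaces, such as all
  those considered here, the limit is unique) and the iterated derivatives
  \<open>f\<^sup>(\<^sup>k\<^sup>)(x)(v\<^sub>1, \<dots>, v\<^sub>k)\<close>, where \<open>vs = [v\<^sub>1, \<dots>, v\<^sub>k]\<close>.\<close>

definition dir_deriv ::
    "'v::real_vector topology \<Rightarrow> 'a::euclidean_space \<Rightarrow> ('a \<Rightarrow> 'v) \<Rightarrow> 'a \<Rightarrow> 'v" where
  "dir_deriv T v f x = (THE d. limitin T (\<lambda>t. (f (x + t *\<^sub>R v) - f x) /\<^sub>R t) d (at (0::real)))"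

primrec iter_deriv ::
    "'v::real_vector topology \<Rightarrow> ('a::euclidean_space \<Rightarrow> 'v) \<Rightarrow> 'a list \<Rightarrow> 'a \<Rightarrow> 'v" where
  "iter_deriv T f [] = f"
| "iter_deriv T f (v # vs) = dir_deriv T v (iter_deriv T f vs)"

text \<open>Smooth: all iterated directional derivatives exist and are continuous.\<close>

definition smooth_into :: "'v::real_vector topology \<Rightarrow> ('a::euclidean_space \<Rightarrow> 'v) \<Rightarrow> bool" where
  "smooth_into T f \<longleftrightarrow>
     (\<forall>vs. continuous_map euclidean T (iter_deriv T f vs) \<and>
       (\<forall>v x. \<exists>d. limitin T (\<lambda>t. (iter_deriv T f vs (x + t *\<^sub>R v) - iter_deriv T f vs x) /\<^sub>R t)
                   d (at (0::real))))"

text \<open>\<open>C\<^sup>\<infinity>\<^sub>K(\<real>\<^sup>\<ell>, F)\<close> with uniform convergence of each derivative, and \<open>\<D>(\<real>\<^sup>\<ell>, F)\<close>.\<close>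

definition CinfK_carrier ::
    "'a::euclidean_space set \<Rightarrow> 'v::real_vector topology \<Rightarrow> ('a \<Rightarrow> 'v) set" where
  "CinfK_carrier K T = {f. smooth_into T f \<and> (\<forall>x. x \<notin> K \<longrightarrow> f x = 0)}"

definition CinfK :: "'a::euclidean_space set \<Rightarrow> 'v::real_vector topology \<Rightarrow> ('a \<Rightarrow> 'v) topology" where
  "CinfK K T = seminorm_topology (CinfK_carrier K T)
     {\<lambda>f. SUP x. p (iter_deriv T f vs x) | p vs. p \<in> cont_seminorms T}"

definition Dspace :: "'v::real_vector topology \<Rightarrow> ('a::euclidean_space \<Rightarrow> 'v) topology" where
  "Dspace T = lc_ind_limit {CinfK K T | K. compact K}"

section \<open>Weight sequences\<close>

definition weight_sequence :: "(nat \<Rightarrow> real) \<Rightarrow> bool" where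
  "weight_sequence M \<longleftrightarrow> (\<forall>k. M k > 0) \<and> M 0 = 1 \<and> 1 \<le> M 1"

definition log_convex_seq :: "(nat \<Rightarrow> real) \<Rightarrow> bool" where
  "log_convex_seq a \<longleftrightarrow> (\<forall>k. (a (Suc k))\<^sup>2 \<le> a k * a (Suc (Suc k)))"

definition weakly_log_convex :: "(nat \<Rightarrow> real) \<Rightarrow> bool" where
  "weakly_log_convex M \<longleftrightarrow> log_convex_seq (\<lambda>k. fact k * M k)"

definition moderate_growth :: "(nat \<Rightarrow> real) \<Rightarrow> bool" where
  "moderate_growth M \<longleftrightarrow>
     bdd_above {(M (j + k) / (M j * M k)) powr (1 / real (j + k)) | j k. 1 \<le> j \<and> 1 \<le> k}"

section \<open>Spaces of ultradifferentiable functions\<close>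

text \<open>\<open>frechet_iter f [v\<^sub>1, \<dots>, v\<^sub>k] x\<close> is the value \<open>f\<^sup>(\<^sup>k\<^sup>)(x)(v\<^sub>1, \<dots>, v\<^sub>k)\<close> of the \<open>k\<close>-th Frechet
  derivative: \<open>f\<^sup>(\<^sup>k\<^sup>+\<^sup>1\<^sup>)(x)(v)\<close> is the multilinear map whose value at \<open>v\<^sub>1, \<dots>, v\<^sub>k\<close> is the Frechet
  derivative of \<open>y \<mapsto> f\<^sup>(\<^sup>k\<^sup>)(y)(v\<^sub>1, \<dots>, v\<^sub>k)\<close> at \<open>x\<close>, applied to \<open>v\<close>.\<close>

primrec frechet_iter :: "('a::euclidean_space \<Rightarrow> real) \<Rightarrow> 'a list \<Rightarrow> 'a \<Rightarrow> real" where
  "frechet_iter f [] = f"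
| "frechet_iter f (v # vs) = (\<lambda>x. frechet_derivative (frechet_iter f vs) (at x) v)"

text \<open>Operator norm of the \<open>k\<close>-linear map \<open>f\<^sup>(\<^sup>k\<^sup>)(x)\<close>; the supremum is finite for smooth \<open>f\<close>.\<close>

definition deriv_norm :: "('a::euclidean_space \<Rightarrow> real) \<Rightarrow> nat \<Rightarrow> 'a \<Rightarrow> real" where
  "deriv_norm f k x = Sup {\<bar>frechet_iter f vs x\<bar> | vs. length vs = k \<and> (\<forall>v\<in>set vs. norm v \<le> 1)}"

definition weighted_derivs ::
    "(nat \<Rightarrow> real) \<Rightarrow> real \<Rightarrow> 'a::euclidean_space set \<Rightarrow> ('a \<Rightarrow> real) \<Rightarrow> real set" where
  "weighted_derivs M \<rho> X f = {deriv_norm f k x / (\<rho> ^ k * fact k * M k) | k x. x \<in> X}"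

text \<open>The Banach space \<open>\<B>\<^sup>M\<^sub>\<rho>(\<real>\<^sup>\<ell>, \<real>)\<close>.\<close>

definition BM_rho :: "(nat \<Rightarrow> real) \<Rightarrow> real \<Rightarrow> ('a::euclidean_space \<Rightarrow> real) topology" where
  "BM_rho M \<rho> =
     seminorm_topology
       {f. smooth_into euclideanreal f \<and> bdd_above (weighted_derivs M \<rho> UNIV f)}
       {\<lambda>f. Sup (weighted_derivs M \<rho> UNIV f)}"

text \<open>\<open>Beurling\<close> is the case \<open>(M)\<close>, \<open>Roumieu\<close> the case \<open>{M}\<close>.\<close>

datatype ultra_case = Beurling | Roumieu

fun BM_real :: "ultra_case \<Rightarrow> (nat \<Rightarrow> real) \<Rightarrow> ('a::euclidean_space \<Rightarrow> real) topology" where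
  "BM_real Beurling M = lc_proj_limit {BM_rho M (1 / real n) | n. 1 \<le> n}"
| "BM_real Roumieu M = lc_ind_limit {BM_rho M (real n) | n. 1 \<le> n}"

definition BM :: "ultra_case \<Rightarrow> (nat \<Rightarrow> real) \<Rightarrow> 'v::real_vector topology \<Rightarrow>
    ('a::euclidean_space \<Rightarrow> 'v) topology" where
  "BM s M T =
     initial_topology
       {f. smooth_into T f \<and> (\<forall>l\<in>dual_space T. l \<circ> f \<in> topspace (BM_real s M))}
       (dual_space T) (\<lambda>l f. l \<circ> f) (\<lambda>l. BM_real s M)"

fun CM_real :: "ultra_case \<Rightarrow> (nat \<Rightarrow> real) \<Rightarrow> ('a::euclidean_space \<Rightarrow> real) set" where
  "CM_real Beurling M =
     {f. smooth_into euclideanreal f \<and>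
         (\<forall>K. compact K \<longrightarrow> (\<forall>\<rho>>0. bdd_above (weighted_derivs M \<rho> K f)))}"
| "CM_real Roumieu M =
     {f. smooth_into euclideanreal f \<and>
         (\<forall>K. compact K \<longrightarrow> (\<exists>\<rho>>0. bdd_above (weighted_derivs M \<rho> K f)))}"

definition CM :: "ultra_case \<Rightarrow> (nat \<Rightarrow> real) \<Rightarrow> 'v::real_vector topology \<Rightarrow>
    ('a::euclidean_space \<Rightarrow> 'v) set" where
  "CM s M T = {f. smooth_into T f \<and> (\<forall>l\<in>dual_space T. l \<circ> f \<in> CM_real s M)}"

text \<open>\<open>C\<^sup>[\<^sup>M\<^sup>]\<^sub>K(\<real>\<^sup>\<ell>, F)\<close>, a subspace of \<open>\<B>\<^sup>[\<^sup>M\<^sup>](\<real>\<^sup>\<ell>, F)\<close> for compact \<open>K\<close>, and \<open>\<D>\<^sup>[\<^sup>M\<^sup>](\<real>\<^sup>\<ell>, F)\<close>.\<close>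

definition CMK :: "ultra_case \<Rightarrow> (nat \<Rightarrow> real) \<Rightarrow> 'a::euclidean_space set \<Rightarrow>
    'v::real_vector topology \<Rightarrow> ('a \<Rightarrow> 'v) topology" where
  "CMK s M K T = subtopology (BM s M T) {f \<in> CM s M T. \<forall>x. x \<notin> K \<longrightarrow> f x = 0}"

definition DMspace :: "ultra_case \<Rightarrow> (nat \<Rightarrow> real) \<Rightarrow> 'v::real_vector topology \<Rightarrow>
    ('a::euclidean_space \<Rightarrow> 'v) topology" where
  "DMspace s M T = lc_ind_limit {CMK s M K T | K. compact K}"

end

theory Submission
  imports Defs
begin

text \<open>Bounded sets of all spaces involved are described by uniform supports and uniform bounds on derivatives;
  for the inductive limits one writes down a continuous seminorm that is unbounded on a set violating the
  description. A bijection is then a bornological isomorphism once it preserves these bounds in both directions,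
  singletons taking care of the carriers.

  Currying: moderate growth splits a bound on \<open>f\<^sup>(\<^sup>j\<^sup>+\<^sup>k\<^sup>)\<close> into bounds in the two variables, and the difference
  quotients of \<open>f\<^sup>\<or>\<close> converge at rate \<open>t\<close> within a bounded set. Uncurrying: the hypothesis bounds \<open>\<lambda> \<circ> g\<close> only for one
  functional \<open>\<lambda>\<close> at a time (in the Roumieu case with \<open>\<rho>\<close> depending on \<open>\<lambda>\<close>); a gliding hump over \<open>\<ell>\<^sup>1\<close>-combinations
  of point evaluations of derivatives makes the bound uniform, and log-convexity joins the two variables.\<close>

section \<open>Seminorms, limits and bounded sets\<close>

text \<open>The topology of \<open>DMspace s M F\<close> sees \<open>F\<close> only through single
  continuous functionals, while \<open>F\<close> is itself an inductive limit known only through its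
  continuous seminorms. Seminorms and functionals on \<open>F\<close> therefore have to be written
  down explicitly, as suprema and series of weighted derivative evaluations. Which weights are
  admissible is governed by a duality of quantifiers. A growth estimate holds for all \<rho>
  (Beurling) or for some \<rho> (Roumieu); weights \<open>\<sigma>\<close> are admissible if they
  dominate some, respectively every, geometric sequence along the orders that occur. Estimate and
  weights thus meet in one \<rho>. Conversely, a violated estimate yields admissible weights along
  which it is unbounded: a constant \<rho>, respectively \<open>\<sigma> n = real n + 1\<close>.
  This device gives both the uniform estimates on bounded sets and the functionals needed for
  uncurrying. The quantifier over \<rho> is absorbed into dominating sequences \<open>a\<close>, so
  that the two cases share most arguments and currying is a single argument for smooth and
  ultradifferentiable functions.\<close>

lemma scaleR_fun_apply [simp]: "(r *\<^sub>R f) x = r *\<^sub>R f x"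
  by (simp add: scaleR_fun_def)

lemma seminorm_onD:
  assumes "seminorm_on V p"
  shows "x \<in> V \<Longrightarrow> 0 \<le> p x"
    and "x \<in> V \<Longrightarrow> y \<in> V \<Longrightarrow> p (x + y) \<le> p x + p y"
    and "x \<in> V \<Longrightarrow> p (c *\<^sub>R x) = \<bar>c\<bar> * p x"
  using assms unfolding seminorm_on_def by blast+

lemma seminorm_on_0: "seminorm_on V p \<Longrightarrow> 0 \<in> V \<Longrightarrow> p 0 = 0"
  using seminorm_onD(3)[of V p 0 0] by simp

lemma seminorm_on_minus: "seminorm_on V p \<Longrightarrow> x \<in> V \<Longrightarrow> p (- x) = p x"
  using seminorm_onD(3)[of V p x "-1"] by simp

lemma seminorm_on_diff_commute:
  "seminorm_on V p \<Longrightarrow> subspace V \<Longrightarrow> x \<in> V \<Longrightarrow> y \<in> V \<Longrightarrow> p (x - y) = p (y - x)"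
  using seminorm_on_minus[of V p "x - y"] by (simp add: subspace_diff)

lemma seminorm_on_triangle:
  assumes "seminorm_on V p" "subspace V" "x \<in> V" "y \<in> V" "z \<in> V"
  shows "p (x - z) \<le> p (x - y) + p (y - z)"
  using seminorm_onD(2)[OF assms(1), of "x - y" "y - z"] assms by (simp add: subspace_diff)

lemma seminorm_on_abs_diff_le:
  assumes "seminorm_on V p" "subspace V" "x \<in> V" "y \<in> V"
  shows "\<bar>p x - p y\<bar> \<le> p (x - y)"
proof -
  have "p (x - y) = p (y - x)" using assms by (intro seminorm_on_diff_commute)
  then show ?thesis
    using seminorm_onD(2)[OF assms(1), of "x - y" y] seminorm_onD(2)[OF assms(1), of "y - x" x] assms
    by (simp add: subspace_diff)
qed

lemma seminorm_on_subset: "seminorm_on W p \<Longrightarrow> V \<subseteq> W \<Longrightarrow> seminorm_on V p"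
  unfolding seminorm_on_def by blast

lemma linear_on_setD:
  assumes "linear_on_set V g"
  shows "x \<in> V \<Longrightarrow> y \<in> V \<Longrightarrow> g (x + y) = g x + g y"
    and "x \<in> V \<Longrightarrow> g (c *\<^sub>R x) = c *\<^sub>R g x"
  using assms unfolding linear_on_set_def by blast+

lemma linear_on_set_0: "linear_on_set V g \<Longrightarrow> 0 \<in> V \<Longrightarrow> g 0 = 0"
  using linear_on_setD(2)[of V g 0 0] by simp

lemma linear_on_set_diff:
  assumes "linear_on_set V g" "subspace V" "x \<in> V" "y \<in> V"
  shows "g (x - y) = g x - g y"
  using linear_on_setD(1)[OF assms(1), of "x - y" y] assms by (simp add: subspace_diff)

lemma seminorm_on_linear:
  assumes "linear_on_set V g" "seminorm_on W p" "g ` V \<subseteq> W"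
  shows "seminorm_on V (\<lambda>x. p (g x))"
  using assms(3) seminorm_onD[OF assms(2)] linear_on_setD[OF assms(1)]
  unfolding seminorm_on_def by (auto simp: image_subset_iff)

lemma seminorm_on_norm_linear:
  fixes g :: "'v::real_vector \<Rightarrow> 'w::real_normed_vector"
  assumes "linear_on_set V g"
  shows "seminorm_on V (\<lambda>x. norm (g x))"
  using linear_on_setD[OF assms] unfolding seminorm_on_def by (auto simp: norm_triangle_ineq)

lemma seminorm_on_sum:
  assumes "\<And>i. i \<in> I \<Longrightarrow> seminorm_on V (p i)"
  shows "seminorm_on V (\<lambda>x. \<Sum>i\<in>I. p i x)"
  unfolding seminorm_on_def
proof (intro conjI ballI allI)
  fix x y assume "x \<in> V" "y \<in> V"
  then show "(\<Sum>i\<in>I. p i (x + y)) \<le> (\<Sum>i\<in>I. p i x) + (\<Sum>i\<in>I. p i y)"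
    unfolding sum.distrib[symmetric] by (intro sum_mono seminorm_onD[OF assms])
next
  fix x c assume "x \<in> V"
  then show "(\<Sum>i\<in>I. p i (c *\<^sub>R x)) = \<bar>c\<bar> * (\<Sum>i\<in>I. p i x)"
    unfolding sum_distrib_left by (intro sum.cong refl seminorm_onD[OF assms])
qed (auto intro!: sum_nonneg seminorm_onD[OF assms])

lemma seminorm_on_mult: "seminorm_on V p \<Longrightarrow> 0 \<le> c \<Longrightarrow> seminorm_on V (\<lambda>x. c * p x)"
  using mult_left_mono[of "p (_ + _)" "p _ + p _" c] unfolding seminorm_on_def
  by (auto simp: algebra_simps)

lemma seminorm_on_SUP:
  assumes p: "\<And>i. i \<in> I \<Longrightarrow> seminorm_on V (p i)" and I: "I \<noteq> {}"
    and bdd: "\<And>x. x \<in> V \<Longrightarrow> bdd_above ((\<lambda>i. p i x) ` I)" and V: "subspace V"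
  shows "seminorm_on V (\<lambda>x. SUP i\<in>I. p i x)"
proof -
  have le: "p i x \<le> (SUP i\<in>I. p i x)" if "i \<in> I" "x \<in> V" for i x
    using that bdd by (intro cSUP_upper) auto
  have scale: "(SUP i\<in>I. p i (c *\<^sub>R x)) \<le> \<bar>c\<bar> * (SUP i\<in>I. p i x)" if "x \<in> V" for c x
    using that le by (intro cSUP_least I) (auto simp: seminorm_onD(3)[OF p] intro!: mult_left_mono)
  show ?thesis
    unfolding seminorm_on_def
  proof (intro conjI ballI allI)
    fix x assume x: "x \<in> V"
    obtain i where i: "i \<in> I" using I by blast
    show "0 \<le> (SUP i\<in>I. p i x)"
      using le[OF i x] seminorm_onD(1)[OF p[OF i] x] by linarith
    show "(SUP i\<in>I. p i (x + y)) \<le> (SUP i\<in>I. p i x) + (SUP i\<in>I. p i y)" if y: "y \<in> V" for y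
    proof (rule cSUP_least[OF I])
      fix j assume j: "j \<in> I"
      show "p j (x + y) \<le> (SUP i\<in>I. p i x) + (SUP i\<in>I. p i y)"
        using seminorm_onD(2)[OF p[OF j] x y] le[OF j x] le[OF j y] by linarith
    qed
    show "(SUP i\<in>I. p i (c *\<^sub>R x)) = \<bar>c\<bar> * (SUP i\<in>I. p i x)" for c
    proof (cases "c = 0")
      case True
      then show ?thesis using I seminorm_on_0[OF p] subspace_0[OF V] by simp
    next
      case False
      \<comment> \<open>Scaling back by \<open>inverse c\<close> turns the one-sided estimate
        \<open>scale\<close> into an equality.\<close>
      have "(SUP i\<in>I. p i (inverse c *\<^sub>R c *\<^sub>R x)) \<le> \<bar>inverse c\<bar> * (SUP i\<in>I. p i (c *\<^sub>R x))"
        using x V by (intro scale) (auto intro: subspace_scale)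
      then have "\<bar>c\<bar> * (SUP i\<in>I. p i x) \<le> (SUP i\<in>I. p i (c *\<^sub>R x))"
        using False by (simp add: field_simps)
      with scale[OF x, of c] show ?thesis by linarith
    qed
  qed
qed

section \<open>Limits and bounded sets in terms of seminorms\<close>

text \<open>The sets \<open>U\<close> for which \<open>d \<in> U\<close> forces \<open>u t\<close>
  into \<open>U\<close> eventually are stable under finite intersections and arbitrary unions, so
  the generating sets decide convergence.\<close>

lemma limitin_topology_generated_by:
  assumes "d \<in> \<Union>S" and "\<And>U. U \<in> S \<Longrightarrow> d \<in> U \<Longrightarrow> eventually (\<lambda>t. u t \<in> U) F"
  shows "limitin (topology_generated_by S) u d F"
proof -
  have "d \<in> U \<longrightarrow> eventually (\<lambda>t. u t \<in> U) F" if "generate_topology_on S U" for U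
    using that
  proof induction
    case (UN K)
    then show ?case by (blast intro: eventually_mono)
  qed (use assms in \<open>auto simp: eventually_conj_iff\<close>)
  then show ?thesis
    using assms(1) unfolding limitin_def
    by (simp add: topology_generated_by_topspace openin_topology_generated_by_iff)
qed

text \<open>The generating balls have arbitrary centres \<open>x\<close>, whereas convergence is
  measured from \<open>d\<close>. If \<open>d\<close> lies in the ball of radius \<open>e\<close>
  about \<open>x\<close>, the triangle inequality puts the ball of radius
  \<open>e - p (d - x)\<close> about \<open>d\<close> inside it.\<close>

lemma limitin_seminorm_topology:
  assumes V: "subspace V" and P: "\<And>p. p \<in> P \<Longrightarrow> seminorm_on V p"
  shows "limitin (seminorm_topology V P) u d F \<longleftrightarrow>
    d \<in> V \<and> eventually (\<lambda>t. u t \<in> V) F \<and> (\<forall>p\<in>P. ((\<lambda>t. p (u t - d)) \<longlongrightarrow> 0) F)" (is "?L \<longleftrightarrow> ?R")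
proof
  assume L: ?L
  then have d: "d \<in> V" using limitin_topspace by fastforce
  have ev: "eventually (\<lambda>t. u t \<in> V) F"
    using limitinD[OF L openin_topspace] d by simp
  have "((\<lambda>t. p (u t - d)) \<longlongrightarrow> 0) F" if p: "p \<in> P" for p
  proof (rule tendstoI)
    fix e :: real assume e: "e > 0"
    have "eventually (\<lambda>t. u t \<in> {y \<in> V. p (y - d) < e}) F"
      using limitinD[OF L openin_seminorm_ball[OF p d e]] d e seminorm_on_0[OF P[OF p]] subspace_0[OF V]
      by simp
    then show "eventually (\<lambda>t. dist (p (u t - d)) 0 < e) F"
    proof (rule eventually_mono)
      fix t assume t: "u t \<in> {y \<in> V. p (y - d) < e}"
      then have "0 \<le> p (u t - d)" using seminorm_onD(1)[OF P[OF p]] subspace_diff[OF V _ d] by blast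
      with t show "dist (p (u t - d)) 0 < e" by simp
    qed
  qed
  with d ev show ?R by blast
next
  assume R: ?R
  show ?L
    unfolding seminorm_topology_def
  proof (rule limitin_topology_generated_by)
    fix U assume "U \<in> insert V {{y \<in> V. p (y - x) < e} | p x e. p \<in> P \<and> x \<in> V \<and> e > 0}" and dU: "d \<in> U"
    then consider "U = V" | p x e where "U = {y \<in> V. p (y - x) < e}" "p \<in> P" "x \<in> V" by blast
    then show "eventually (\<lambda>t. u t \<in> U) F"
    proof cases
      case 2
      have "e - p (d - x) > 0" using dU 2 by simp
      then have "eventually (\<lambda>t. dist (p (u t - d)) 0 < e - p (d - x)) F"
        using R 2 tendstoD by blast
      with R have "eventually (\<lambda>t. u t \<in> V \<and> dist (p (u t - d)) 0 < e - p (d - x)) F"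
        by (simp add: eventually_conj_iff)
      then show ?thesis
      proof (rule eventually_mono)
        fix t assume t: "u t \<in> V \<and> dist (p (u t - d)) 0 < e - p (d - x)"
        then show "u t \<in> U"
          using seminorm_on_triangle[OF P[OF 2(2)] V, of "u t" d x] 2 R by auto
      qed
    qed (use R in auto)
  qed (use R in auto)
qed

text \<open>The converse avoids decomposing neighbourhoods of zero: if no multiple of
  \<open>U\<close> covers \<open>B\<close>, points \<open>b n\<close> of \<open>B\<close> outside
  \<open>n + 1\<close> times \<open>U\<close> give the sequence \<open>b n / (n + 1)\<close>, which
  tends to zero because every seminorm is bounded on \<open>B\<close>, yet never enters
  \<open>U\<close>.\<close>

lemma bounded_in_seminorm_topology:
  assumes V: "subspace V" and P: "\<And>p. p \<in> P \<Longrightarrow> seminorm_on V p"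
  shows "bounded_in (seminorm_topology V P) B \<longleftrightarrow> B \<subseteq> V \<and> (\<forall>p\<in>P. \<exists>C. \<forall>x\<in>B. p x \<le> C)" (is "?L \<longleftrightarrow> ?R")
proof
  assume L: ?L
  then have B: "B \<subseteq> V" by (simp add: bounded_in_def)
  have "\<exists>C. \<forall>x\<in>B. p x \<le> C" if p: "p \<in> P" for p
  proof -
    have "openin (seminorm_topology V P) {y \<in> V. p (y - 0) < 1}"
      using openin_seminorm_ball[OF p subspace_0[OF V], of 1] by simp
    moreover have "0 \<in> {y \<in> V. p (y - 0) < 1}" using subspace_0[OF V] seminorm_on_0[OF P[OF p]] by simp
    ultimately obtain r where r: "r > 0" "B \<subseteq> (\<lambda>x. r *\<^sub>R x) ` {y \<in> V. p (y - 0) < 1}"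
      using L unfolding bounded_in_def by blast
    have "p x \<le> r" if "x \<in> B" for x
    proof -
      obtain y where "x = r *\<^sub>R y" "y \<in> V" "p y < 1"
        using subsetD[OF r(2) \<open>x \<in> B\<close>] by (auto elim!: imageE)
      then show ?thesis using seminorm_onD(3)[OF P[OF p], of y r] r(1) by simp
    qed
    then show ?thesis by blast
  qed
  with B show ?R by blast
next
  assume R: ?R
  show ?L
    unfolding bounded_in_def
  proof (intro conjI allI impI)
    fix U assume U: "openin (seminorm_topology V P) U \<and> 0 \<in> U"
    show "\<exists>r>0. B \<subseteq> (\<lambda>x. r *\<^sub>R x) ` U"
    proof (rule ccontr)
      assume "\<not> (\<exists>r>0. B \<subseteq> (\<lambda>x. r *\<^sub>R x) ` U)"
      then have "\<forall>n. \<exists>b. b \<in> B \<and> b \<notin> (\<lambda>x. real (Suc n) *\<^sub>R x) ` U"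
        by (metis of_nat_0_less_iff subsetI zero_less_Suc)
      then obtain b where b: "\<And>n. b n \<in> B" "\<And>n. b n \<notin> (\<lambda>x. real (Suc n) *\<^sub>R x) ` U" by metis
      have "limitin (seminorm_topology V P) (\<lambda>n. inverse (real (Suc n)) *\<^sub>R b n) 0 sequentially"
      proof (rule limitin_seminorm_topology[THEN iffD2, OF V P]; (intro conjI ballI)?)
        fix p assume p: "p \<in> P"
        then obtain C where C: "\<And>x. x \<in> B \<Longrightarrow> p x \<le> C" using R by blast
        have bV: "b n \<in> V" for n using b R by blast
        have up: "p (inverse (real (Suc n)) *\<^sub>R b n) \<le> C * inverse (real (Suc n))" for n
          using mult_right_mono[OF C[OF b(1)[of n]], of "inverse (real (Suc n))"]
            seminorm_onD(3)[OF P[OF p] bV[of n], of "inverse (real (Suc n))"] by (simp add: mult.commute)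
        have lo: "0 \<le> p (inverse (real (Suc n)) *\<^sub>R b n)" for n
          using seminorm_onD(1)[OF P[OF p] subspace_scale[OF V bV]] .
        show "(\<lambda>n. p (inverse (real (Suc n)) *\<^sub>R b n - 0)) \<longlonglongrightarrow> 0"
          unfolding diff_zero
          by (rule tendsto_sandwich[OF always_eventually[OF allI[OF lo]] always_eventually[OF allI[OF up]]
                tendsto_const tendsto_mult_right_zero[OF LIMSEQ_inverse_real_of_nat]])
      next
        show "\<forall>\<^sub>F n in sequentially. inverse (real (Suc n)) *\<^sub>R b n \<in> V"
          using b R subspace_scale[OF V] by (intro always_eventually) blast
      qed (use subspace_0[OF V] in auto)
      then have "eventually (\<lambda>n. inverse (real (Suc n)) *\<^sub>R b n \<in> U) sequentially"
        by (rule limitinD) (use U in simp_all)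
      then obtain n where "inverse (real (Suc n)) *\<^sub>R b n \<in> U"
        using eventually_happens'[OF sequentially_bot] by blast
      then have "b n \<in> (\<lambda>x. real (Suc n) *\<^sub>R x) ` U"
        by (intro image_eqI[of _ _ "inverse (real (Suc n)) *\<^sub>R b n"]) auto
      then show False using b(2) by blast
    qed
  qed (use R in auto)
qed

lemma locally_convexD:
  assumes "locally_convex T"
  shows "subspace (topspace T)" "T = seminorm_topology (topspace T) (cont_seminorms T)"
    "p \<in> cont_seminorms T \<Longrightarrow> seminorm_on (topspace T) p"
    "p \<in> cont_seminorms T \<Longrightarrow> continuous_map T euclideanreal p"
  using assms unfolding locally_convex_def cont_seminorms_def by blast+

lemma limitin_locally_convex:
  assumes "locally_convex T"
  shows "limitin T u d F \<longleftrightarrow> d \<in> topspace T \<and> eventually (\<lambda>t. u t \<in> topspace T) F \<and>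
    (\<forall>p\<in>cont_seminorms T. ((\<lambda>t. p (u t - d)) \<longlongrightarrow> 0) F)"
  using limitin_seminorm_topology[of "topspace T" "cont_seminorms T" u d F] locally_convexD[OF assms] by simp

lemma bounded_in_locally_convex:
  assumes "locally_convex T"
  shows "bounded_in T B \<longleftrightarrow> B \<subseteq> topspace T \<and> (\<forall>p\<in>cont_seminorms T. \<exists>C. \<forall>x\<in>B. p x \<le> C)"
  using bounded_in_seminorm_topology[of "topspace T" "cont_seminorms T" B] locally_convexD[OF assms] by simp

lemma bounded_in_singleton: "locally_convex T \<Longrightarrow> bounded_in T {x} \<longleftrightarrow> x \<in> topspace T"
  by (auto simp: bounded_in_locally_convex)

lemma atin_euclidean: "atin euclidean x = at x"
  by (rule filter_eqI) (auto simp: eventually_atin eventually_at_topological)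

lemma continuous_map_euclidean_limitin:
  "continuous_map euclidean T g \<longleftrightarrow> (\<forall>x. limitin T g (g x) (at x))"
  by (simp add: continuous_map_atin atin_euclidean)

section \<open>Continuity of seminorms and of linear maps\<close>

text \<open>For a space \<open>Z\<close> known only through some of its open sets: by the reverse
  triangle inequality it suffices that \<open>q\<close> lies below a function \<open>r\<close> with
  \<open>r (y - x)\<close> small near each \<open>x\<close>. This covers the projective limit of the
  Beurling case, which is not presented by seminorms.\<close>

lemma cont_seminormsI:
  assumes V: "subspace (topspace Z)" and q: "seminorm_on (topspace Z) q"
    and le: "\<And>x. x \<in> topspace Z \<Longrightarrow> q x \<le> r x"
    and op: "\<And>x e. x \<in> topspace Z \<Longrightarrow> e > 0 \<Longrightarrow>
      \<exists>U. openin Z U \<and> x \<in> U \<and> (\<forall>y\<in>U. r (y - x) < e)"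
  shows "continuous_map Z euclideanreal q"
proof -
  have "limitin euclideanreal q (q x) (atin Z x)" if x: "x \<in> topspace Z" for x
    unfolding limitin_canonical_iff
  proof (rule tendstoI)
    fix e :: real assume e: "e > 0"
    obtain U where U: "openin Z U" "x \<in> U" "\<And>y. y \<in> U \<Longrightarrow> r (y - x) < e"
      using op[OF x e] by auto
    have "dist (q y) (q x) < e" if y: "y \<in> U" for y
    proof -
      have yZ: "y \<in> topspace Z" using y U(1) openin_subset by blast
      then have "\<bar>q y - q x\<bar> \<le> q (y - x)" using seminorm_on_abs_diff_le[OF q V] x by blast
      also have "\<dots> \<le> r (y - x)" using le yZ x V by (blast intro: subspace_diff)
      finally show ?thesis using U(3)[OF y] by (simp add: dist_real_def)
    qed
    then show "\<forall>\<^sub>F y in atin Z x. dist (q y) (q x) < e"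
      unfolding eventually_atin by (intro disjI2 exI[of _ U]) (use U(1,2) in auto)
  qed
  then show ?thesis by (simp add: continuous_map_atin)
qed

lemma cont_seminorms_mono:
  assumes V: "subspace (topspace Z)" and q: "seminorm_on (topspace Z) q"
    and p: "seminorm_on (topspace Z) p" "continuous_map Z euclideanreal p"
    and tr: "\<And>x. x \<in> topspace Z \<Longrightarrow> continuous_map Z Z (\<lambda>y. y - x)"
    and le: "\<And>x. x \<in> topspace Z \<Longrightarrow> q x \<le> p x"
  shows "continuous_map Z euclideanreal q"
proof (rule cont_seminormsI[OF V q le])
  fix x and e :: real assume x: "x \<in> topspace Z" and e: "e > 0"
  have "continuous_map Z euclideanreal (p \<circ> (\<lambda>y. y - x))"
    by (rule continuous_map_compose[OF tr[OF x] p(2)])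
  then have "openin Z {y \<in> topspace Z. (p \<circ> (\<lambda>y. y - x)) y \<in> {..<e}}"
    by (rule openin_continuous_map_preimage) auto
  then show "\<exists>U. openin Z U \<and> x \<in> U \<and> (\<forall>y\<in>U. p (y - x) < e)"
    using x e seminorm_on_0[OF p(1) subspace_0[OF V]]
    by (intro exI[of _ "{y \<in> topspace Z. p (y - x) < e}"]) auto
qed

lemma continuous_map_diff_locally_convex:
  assumes T: "locally_convex T" and x: "x \<in> topspace T"
  shows "continuous_map T T (\<lambda>y. y - x)"
  unfolding continuous_map_atin
proof
  fix z assume z: "z \<in> topspace T"
  have "limitin T (\<lambda>y. y) z (atin T z)"
    using z by (simp add: limitin_def eventually_atin) blast
  then show "limitin T (\<lambda>y. y - x) (z - x) (atin T z)"
    using x z locally_convexD(1)[OF T]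
    by (auto simp: limitin_locally_convex[OF T] intro: subspace_diff elim: eventually_mono)
qed

lemma continuous_map_dominated:
  assumes T: "locally_convex T" and q: "seminorm_on (topspace T) q" and p: "p \<in> cont_seminorms T"
    and le: "\<And>x. x \<in> topspace T \<Longrightarrow> q x \<le> p x"
  shows "q \<in> cont_seminorms T"
  unfolding cont_seminorms_def
  using cont_seminorms_mono[OF _ q _ _ _ le] locally_convexD[OF T] p q continuous_map_diff_locally_convex[OF T]
  by blast

lemma cont_seminorms_sum:
  assumes "finite I" "\<And>i. i \<in> I \<Longrightarrow> p i \<in> cont_seminorms T"
  shows "(\<lambda>x. \<Sum>i\<in>I. p i x) \<in> cont_seminorms T"
  using assms unfolding cont_seminorms_def
  by (auto intro!: seminorm_on_sum continuous_map_sum)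

lemma cont_seminorms_mult:
  assumes "p \<in> cont_seminorms T" "0 \<le> c"
  shows "(\<lambda>x. c * p x) \<in> cont_seminorms T"
  using assms unfolding cont_seminorms_def
  by (auto intro!: seminorm_on_mult continuous_map_real_mult)

lemma continuous_map_linear_locally_convex:
  assumes S: "locally_convex S" and T: "locally_convex T"
    and L: "linear_on_set (topspace S) L" "L ` topspace S \<subseteq> topspace T"
    and c: "\<And>q. q \<in> cont_seminorms T \<Longrightarrow> (\<lambda>x. q (L x)) \<in> cont_seminorms S"
  shows "continuous_map S T L"
proof -
  have "continuous_map S (seminorm_topology (topspace T) (cont_seminorms T)) L"
  proof (rule continuous_map_into_seminorm_topology)
    fix q x and e :: real assume q: "q \<in> cont_seminorms T" and x: "x \<in> topspace T" and e: "e > 0"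
    have *: "continuous_map S euclideanreal (\<lambda>y. q (L y - x))"
    proof (unfold continuous_map_atin, intro ballI)
      fix z assume z: "z \<in> topspace S"
      have lim: "limitin S (\<lambda>y. y) z (atin S z)"
        using z by (simp add: limitin_def eventually_atin) blast
      then have ev: "eventually (\<lambda>y. y \<in> topspace S) (atin S z)"
        and t: "((\<lambda>y. q (L (y - z))) \<longlongrightarrow> 0) (atin S z)"
        using c[OF q] by (auto simp: limitin_locally_convex[OF S])
      have "eventually (\<lambda>y. norm (q (L y - x) - q (L z - x)) \<le> q (L (y - z))) (atin S z)"
        using ev
      proof (rule eventually_mono)
        fix y assume y: "y \<in> topspace S"
        have "L y - x - (L z - x) = L (y - z)"
          using linear_on_set_diff[OF L(1) locally_convexD(1)[OF S] y z] by simp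
        moreover have "L y - x \<in> topspace T" "L z - x \<in> topspace T"
          using L(2) x y z locally_convexD(1)[OF T] by (auto intro!: subspace_diff)
        ultimately show "norm (q (L y - x) - q (L z - x)) \<le> q (L (y - z))"
          using seminorm_on_abs_diff_le[OF locally_convexD(3)[OF T q] locally_convexD(1)[OF T], of "L y - x" "L z - x"]
          by simp
      qed
      then have "((\<lambda>y. q (L y - x) - q (L z - x)) \<longlongrightarrow> 0) (atin S z)"
        using t by (rule Lim_null_comparison)
      then show "limitin euclideanreal (\<lambda>y. q (L y - x)) (q (L z - x)) (atin S z)"
        by (simp add: LIM_zero_cancel)
    qed
    have "openin S {y \<in> topspace S. q (L y - x) \<in> {..<e}}"
      using * by (rule openin_continuous_map_preimage) auto
    then show "openin S {y \<in> topspace S. q (L y - x) < e}" by simp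
  qed (use L in auto)
  then show ?thesis using locally_convexD(2)[OF T] by simp
qed

section \<open>Continuous linear functionals and separation of points\<close>

lemma dual_spaceD:
  assumes "l \<in> dual_space T"
  shows "linear_on_set (topspace T) l" "continuous_map T euclideanreal l"
  using assms unfolding dual_space_def by blast+

lemma dual_space_abs: "l \<in> dual_space T \<Longrightarrow> (\<lambda>x. \<bar>l x\<bar>) \<in> cont_seminorms T"
  using seminorm_on_norm_linear[of "topspace T" l]
  by (simp add: dual_space_def cont_seminorms_def continuous_map_real_abs)

text \<open>The functionals constructed on function spaces arise in this way, as explicit linear
  forms below an explicit continuous seminorm.\<close>

lemma dual_spaceI:
  assumes T: "locally_convex T" and l: "linear_on_set (topspace T) l" and p: "p \<in> cont_seminorms T"
    and le: "\<And>x. x \<in> topspace T \<Longrightarrow> \<bar>l x\<bar> \<le> p x"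
  shows "l \<in> dual_space T"
proof -
  have q: "(\<lambda>x. \<bar>l x\<bar>) \<in> cont_seminorms T"
    using seminorm_on_norm_linear[OF l] by (intro continuous_map_dominated[OF T _ p le]) auto
  have "continuous_map T euclideanreal l"
    unfolding continuous_map_atin
  proof
    fix z assume z: "z \<in> topspace T"
    have "limitin T (\<lambda>y. y) z (atin T z)"
      using z by (simp add: limitin_def eventually_atin) blast
    then have "eventually (\<lambda>y. y \<in> topspace T) (atin T z)" "((\<lambda>y. \<bar>l (y - z)\<bar>) \<longlongrightarrow> 0) (atin T z)"
      using q by (auto simp: limitin_locally_convex[OF T])
    then have "((\<lambda>y. l y - l z) \<longlongrightarrow> 0) (atin T z)"
      by (elim Lim_null_comparison[rotated] eventually_mono)
        (simp add: linear_on_set_diff[OF l locally_convexD(1)[OF T] _ z])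
    then show "limitin euclideanreal l (l z) (atin T z)"
      by (simp add: LIM_zero_cancel)
  qed
  with l show ?thesis by (simp add: dual_space_def)
qed

text \<open>The Hausdorff property in the form that functionals separate points. In this form it
  passes from \<open>T\<close> to the function spaces by evaluation at a point, with no extension
  theorem, and it yields the uniqueness of limits behind the definite description in
  \<open>dir_deriv\<close>.\<close>

definition separated_lc :: "'v::real_vector topology \<Rightarrow> bool" where
  "separated_lc T \<longleftrightarrow> locally_convex T \<and> (\<forall>v\<in>topspace T. v \<noteq> 0 \<longrightarrow> (\<exists>l\<in>dual_space T. l v \<noteq> 0))"

lemma limitin_linear:
  assumes "continuous_map S T L" "limitin S u d F"
  shows "limitin T (\<lambda>t. L (u t)) (L d) F"
  using continuous_map_limit[OF assms] by (simp add: o_def)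

lemma limitin_unique_separated:
  assumes T: "separated_lc T" and "limitin T u d F" "limitin T u d' F" and F: "F \<noteq> bot"
  shows "d = d'"
proof (rule ccontr)
  assume ne: "d \<noteq> d'"
  have V: "d \<in> topspace T" "d' \<in> topspace T"
    using assms(2,3) by (simp_all add: limitin_topspace)
  have sub: "subspace (topspace T)" using T by (simp add: separated_lc_def locally_convex_def)
  obtain l where l: "l \<in> dual_space T" "l (d - d') \<noteq> 0"
    using T ne subspace_diff[OF sub V] unfolding separated_lc_def by auto
  have "((\<lambda>t. l (u t)) \<longlongrightarrow> l d) F" "((\<lambda>t. l (u t)) \<longlongrightarrow> l d') F"
    using limitin_linear[OF dual_spaceD(2)[OF l(1)] assms(2)]
      limitin_linear[OF dual_spaceD(2)[OF l(1)] assms(3)] by simp_all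
  then have "l d = l d'" by (rule tendsto_unique[OF F])
  then show False
    using l linear_on_set_diff[OF dual_spaceD(1)[OF l(1)] sub V] by simp
qed

section \<open>Euclidean spaces as separated locally convex spaces\<close>

lemma locally_convex_euclidean: "locally_convex (euclidean :: 'a::real_normed_vector topology)"
proof -
  have n: "norm \<in> cont_seminorms (euclidean :: 'a topology)"
    by (auto simp: cont_seminorms_def seminorm_on_def norm_triangle_ineq continuous_on_norm_id)
  let ?T = "seminorm_topology (UNIV :: 'a set) (cont_seminorms euclidean)"
  have sn: "seminorm_on UNIV p" if "p \<in> cont_seminorms (euclidean :: 'a topology)" for p
    using that by (simp add: cont_seminorms_def)
  have "openin ?T U \<longleftrightarrow> open U" for U :: "'a set"
  proof
    assume U: "openin ?T U"
    have "continuous_map euclidean ?T (\<lambda>x. x)"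
      unfolding continuous_map_euclidean_limitin
    proof (intro allI; rule limitin_seminorm_topology[THEN iffD2, OF subspace_UNIV sn]; (intro conjI ballI)?)
      fix x :: 'a and p assume p: "p \<in> cont_seminorms (euclidean :: 'a topology)"
      then have "isCont p 0"
        by (simp add: cont_seminorms_def continuous_on_eq_continuous_at)
      then have "p \<midarrow>0\<rightarrow> 0" using seminorm_on_0[OF sn[OF p]] by (simp add: isCont_def)
      then show "((\<lambda>y. p (y - x)) \<longlongrightarrow> 0) (at x)"
        using LIM_offset_zero_cancel[of "\<lambda>y. p (y - x)" x 0] by simp
    qed auto
    then show "open U" using openin_continuous_map_preimage[OF _ U] by fastforce
  next
    assume U: "open U"
    show "openin ?T U"
    proof (subst openin_subopen, intro ballI)
      fix x assume "x \<in> U"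
      then obtain e where e: "e > 0" "ball x e \<subseteq> U" using U open_contains_ball by blast
      have "openin ?T {y \<in> UNIV. norm (y - x) < e}"
        using e by (intro openin_seminorm_ball n) auto
      then show "\<exists>W. openin ?T W \<and> x \<in> W \<and> W \<subseteq> U"
        using e by (intro exI[of _ "{y \<in> UNIV. norm (y - x) < e}"])
          (auto simp: subset_iff dist_norm norm_minus_commute)
    qed
  qed
  then show ?thesis by (simp add: locally_convex_def topology_eq)
qed

lemma dual_space_euclidean_inner: "(\<lambda>y. y \<bullet> b) \<in> dual_space (euclidean :: 'a::real_inner topology)"
  by (auto simp: dual_space_def linear_on_set_def inner_add_left intro!: continuous_intros)

lemma separated_lc_euclidean: "separated_lc (euclidean :: 'a::real_inner topology)"
  unfolding separated_lc_def
proof (intro conjI ballI impI locally_convex_euclidean)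
  fix v :: 'a assume "v \<noteq> 0"
  then show "\<exists>l\<in>dual_space euclidean. l v \<noteq> 0"
    using dual_space_euclidean_inner[of v] by (intro bexI[of _ "\<lambda>y. y \<bullet> v"]) auto
qed

lemma norm_cont_seminorms: "norm \<in> cont_seminorms (euclidean :: 'a::real_normed_vector topology)"
  by (auto simp: cont_seminorms_def seminorm_on_def norm_triangle_ineq continuous_on_norm_id)

section \<open>Smooth maps into locally convex spaces\<close>

lemma separated_lcD:
  assumes "separated_lc T"
  shows "locally_convex T" "subspace (topspace T)"
  using assms by (simp_all add: separated_lc_def locally_convex_def)

lemma limitin_add_lc:
  assumes T: "locally_convex T" and u: "limitin T u d F" and w: "limitin T w e F"
  shows "limitin T (\<lambda>t. u t + w t) (d + e) F"
proof -
  note V = locally_convexD(1)[OF T]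
  have u': "d \<in> topspace T" "eventually (\<lambda>t. u t \<in> topspace T) F"
    and pu: "\<And>p. p \<in> cont_seminorms T \<Longrightarrow> ((\<lambda>t. p (u t - d)) \<longlongrightarrow> 0) F"
    using u by (simp_all add: limitin_locally_convex[OF T])
  have w': "e \<in> topspace T" "eventually (\<lambda>t. w t \<in> topspace T) F"
    and pw: "\<And>p. p \<in> cont_seminorms T \<Longrightarrow> ((\<lambda>t. p (w t - e)) \<longlongrightarrow> 0) F"
    using w by (simp_all add: limitin_locally_convex[OF T])
  have ev: "eventually (\<lambda>t. u t \<in> topspace T \<and> w t \<in> topspace T) F"
    using u'(2) w'(2) by (rule eventually_conj)
  show ?thesis
    unfolding limitin_locally_convex[OF T]
  proof (intro conjI ballI)
    show "d + e \<in> topspace T" using u' w' V by (simp add: subspace_add)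
    show "eventually (\<lambda>t. u t + w t \<in> topspace T) F"
      using ev by (rule eventually_mono) (simp add: subspace_add[OF V])
    fix p assume p: "p \<in> cont_seminorms T"
    note sn = locally_convexD(3)[OF T p]
    have lim: "((\<lambda>t. p (u t - d) + p (w t - e)) \<longlongrightarrow> 0) F"
      using tendsto_add[OF pu[OF p] pw[OF p]] by simp
    have "eventually (\<lambda>t. norm (p (u t + w t - (d + e))) \<le> p (u t - d) + p (w t - e)) F"
      using ev
    proof (rule eventually_mono)
      fix t assume t: "u t \<in> topspace T \<and> w t \<in> topspace T"
      have 1: "u t - d \<in> topspace T" "w t - e \<in> topspace T"
        using t u'(1) w'(1) by (simp_all add: subspace_diff[OF V])
      have 2: "u t + w t - (d + e) = (u t - d) + (w t - e)" by simp
      show "norm (p (u t + w t - (d + e))) \<le> p (u t - d) + p (w t - e)"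
        using seminorm_onD(2)[OF sn 1] seminorm_onD(1)[OF sn subspace_add[OF V 1]] unfolding 2 by simp
    qed
    then show "((\<lambda>t. p (u t + w t - (d + e))) \<longlongrightarrow> 0) F"
      using lim by (rule Lim_null_comparison)
  qed
qed

lemma continuous_linear_scale:
  assumes T: "locally_convex T"
  shows "linear_on_set (topspace T) (\<lambda>x. c *\<^sub>R x)" "continuous_map T T (\<lambda>x. c *\<^sub>R x)"
proof -
  note V = locally_convexD(1)[OF T]
  show lin: "linear_on_set (topspace T) (\<lambda>x. c *\<^sub>R x)"
    by (simp add: linear_on_set_def scaleR_add_right)
  show "continuous_map T T (\<lambda>x. c *\<^sub>R x)"
  proof (rule continuous_map_linear_locally_convex[OF T T lin])
    fix q assume q: "q \<in> cont_seminorms T"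
    note sn = locally_convexD(3)[OF T q]
    show "(\<lambda>x. q (c *\<^sub>R x)) \<in> cont_seminorms T"
    proof (rule continuous_map_dominated[OF T _ cont_seminorms_mult[OF q, of "\<bar>c\<bar>"]])
      show "seminorm_on (topspace T) (\<lambda>x. q (c *\<^sub>R x))"
        using V by (intro seminorm_on_linear[OF lin sn]) (auto simp: subspace_scale)
    qed (simp_all add: seminorm_onD(3)[OF sn])
  qed (use V in \<open>auto simp: subspace_scale\<close>)
qed

lemma dir_deriv_eqI:
  assumes "separated_lc T" "limitin T (\<lambda>t. (f (x + t *\<^sub>R v) - f x) /\<^sub>R t) d (at (0::real))"
  shows "dir_deriv T v f x = d"
  unfolding dir_deriv_def
  using assms(2) by (rule the_equality) (rule limitin_unique_separated[OF assms(1) _ assms(2)], simp_all)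

text \<open>A continuous family indexed by direction lists, in which consing a direction means
  differentiating, is the family of iterated derivatives. Derivatives are thus identified by
  guessing \<open>D\<close>, without computing with the definite description again.\<close>

lemma smooth_intoI:
  fixes D :: "'a::euclidean_space list \<Rightarrow> 'a \<Rightarrow> 'v::real_vector"
  assumes T: "separated_lc T" and D0: "D [] = f"
    and cont: "\<And>vs. continuous_map euclidean T (D vs)"
    and lim: "\<And>vs v x. limitin T (\<lambda>t. (D vs (x + t *\<^sub>R v) - D vs x) /\<^sub>R t) (D (v # vs) x) (at (0::real))"
  shows "smooth_into T f" "iter_deriv T f vs = D vs"
proof -
  have eq: "iter_deriv T f vs = D vs" for vs
  proof (induction vs)
    case (Cons v vs)
    show ?case
      unfolding iter_deriv.simps Cons.IH by (rule ext) (rule dir_deriv_eqI[OF T lim])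
  qed (simp add: D0)
  then show "iter_deriv T f vs = D vs" .
  show "smooth_into T f"
    unfolding smooth_into_def eq using cont lim by blast
qed

lemma smooth_intoD:
  assumes "smooth_into T f"
  shows "continuous_map euclidean T (iter_deriv T f vs)"
    and "separated_lc T \<Longrightarrow>
      limitin T (\<lambda>t. (iter_deriv T f vs (x + t *\<^sub>R v) - iter_deriv T f vs x) /\<^sub>R t)
        (iter_deriv T f (v # vs) x) (at (0::real))"
    and "iter_deriv T f vs x \<in> topspace T"
proof -
  show c: "continuous_map euclidean T (iter_deriv T f vs)"
    using assms by (simp add: smooth_into_def)
  show "iter_deriv T f vs x \<in> topspace T"
    using continuous_map_image_subset_topspace[OF c] by auto
  assume T: "separated_lc T"
  obtain d where d: "limitin T (\<lambda>t. (iter_deriv T f vs (x + t *\<^sub>R v) - iter_deriv T f vs x) /\<^sub>R t) d (at (0::real))"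
    using assms unfolding smooth_into_def by metis
  then show "limitin T (\<lambda>t. (iter_deriv T f vs (x + t *\<^sub>R v) - iter_deriv T f vs x) /\<^sub>R t)
        (iter_deriv T f (v # vs) x) (at (0::real))"
    using dir_deriv_eqI[OF T d] by simp
qed

text \<open>Coinductive criterion: a set of continuous maps closed under directional derivatives
  consists of smooth maps. Choosing the derivatives inside \<open>S\<close> and recursing over the
  direction list gives the family required by \<open>smooth_intoI\<close>.\<close>

lemma smooth_into_coinduct:
  assumes T: "separated_lc T" and f: "f \<in> S"
    and cont: "\<And>f. f \<in> S \<Longrightarrow> continuous_map euclidean T f"
    and lim: "\<And>f v. f \<in> S \<Longrightarrow>
      \<exists>g\<in>S. \<forall>x. limitin T (\<lambda>t. (f (x + t *\<^sub>R v) - f x) /\<^sub>R t) (g x) (at (0::real))"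
  shows "smooth_into T f"
proof -
  obtain G where G: "\<And>f v. f \<in> S \<Longrightarrow> G f v \<in> S"
    "\<And>f v x. f \<in> S \<Longrightarrow> limitin T (\<lambda>t. (f (x + t *\<^sub>R v) - f x) /\<^sub>R t) (G f v x) (at (0::real))"
    using lim by metis
  define D where "D = rec_list f (\<lambda>v _ h. G h v)"
  have D: "D [] = f" "\<And>v vs. D (v # vs) = G (D vs) v" by (simp_all add: D_def)
  have DS: "D vs \<in> S" for vs by (induction vs) (simp_all add: D f G)
  show ?thesis
    by (rule smooth_intoI(1)[OF T, of D]) (simp_all only: D cont[OF DS] G(2)[OF DS])
qed

lemma iter_deriv_append: "iter_deriv T f (vs @ ws) = iter_deriv T (iter_deriv T f ws) vs"
  by (induction vs) simp_all

lemma smooth_into_iter_deriv: "smooth_into T f \<Longrightarrow> smooth_into T (iter_deriv T f ws)"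
  unfolding smooth_into_def iter_deriv_append[symmetric] by blast

lemma smooth_into_in_topspace: "smooth_into T f \<Longrightarrow> f x \<in> topspace T"
  using smooth_intoD(3)[of T f "[]" x] by simp

lemma smooth_into_linear:
  assumes S: "separated_lc S" and T: "separated_lc T"
    and L: "linear_on_set (topspace S) L" "continuous_map S T L" and f: "smooth_into S f"
  shows "smooth_into T (\<lambda>x. L (f x))"
    and "iter_deriv T (\<lambda>x. L (f x)) vs = (\<lambda>x. L (iter_deriv S f vs x))"
proof -
  note V = separated_lcD(2)[OF S]
  have cont: "continuous_map euclidean T (\<lambda>x. L (iter_deriv S f vs x))" for vs
    using continuous_map_compose[OF smooth_intoD(1)[OF f] L(2)] by (simp only: o_def)
  have lim: "limitin T (\<lambda>t. (L (iter_deriv S f vs (x + t *\<^sub>R v)) - L (iter_deriv S f vs x)) /\<^sub>R t)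
      (L (iter_deriv S f (v # vs) x)) (at (0::real))" for vs v x
  proof -
    have "L ((iter_deriv S f vs (x + t *\<^sub>R v) - iter_deriv S f vs x) /\<^sub>R t)
       = (L (iter_deriv S f vs (x + t *\<^sub>R v)) - L (iter_deriv S f vs x)) /\<^sub>R t" for t
      using smooth_intoD(3)[OF f] V
      by (simp add: linear_on_setD(2)[OF L(1)] linear_on_set_diff[OF L(1)] subspace_diff)
    then show ?thesis
      using limitin_linear[OF L(2) smooth_intoD(2)[OF f S, of vs x v]] by simp
  qed
  show "smooth_into T (\<lambda>x. L (f x))"
    by (rule smooth_intoI(1)[OF T, of "\<lambda>vs x. L (iter_deriv S f vs x)"]) (simp, rule cont, rule lim)
  show "iter_deriv T (\<lambda>x. L (f x)) vs = (\<lambda>x. L (iter_deriv S f vs x))"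
    by (rule smooth_intoI(2)[OF T, of "\<lambda>vs x. L (iter_deriv S f vs x)"]) (simp, rule cont, rule lim)
qed

lemma smooth_into_add:
  assumes T: "separated_lc T" and f: "smooth_into T f" and g: "smooth_into T g"
  shows "smooth_into T (\<lambda>x. f x + g x)"
    and "iter_deriv T (\<lambda>x. f x + g x) vs = (\<lambda>x. iter_deriv T f vs x + iter_deriv T g vs x)"
proof -
  note lc = separated_lcD(1)[OF T]
  have cont: "continuous_map euclidean T (\<lambda>x. iter_deriv T f vs x + iter_deriv T g vs x)" for vs
    unfolding continuous_map_euclidean_limitin
    using smooth_intoD(1)[OF f, of vs] smooth_intoD(1)[OF g, of vs]
    by (auto simp: continuous_map_euclidean_limitin intro!: limitin_add_lc[OF lc])
  have lim: "limitin T (\<lambda>t. (iter_deriv T f vs (x + t *\<^sub>R v) + iter_deriv T g vs (x + t *\<^sub>R v) -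
        (iter_deriv T f vs x + iter_deriv T g vs x)) /\<^sub>R t)
      (iter_deriv T f (v # vs) x + iter_deriv T g (v # vs) x) (at (0::real))" for vs v x
    using limitin_add_lc[OF lc smooth_intoD(2)[OF f T, of vs x v] smooth_intoD(2)[OF g T, of vs x v]]
    by (simp only: add_diff_add scaleR_add_right)
  show "smooth_into T (\<lambda>x. f x + g x)"
    by (rule smooth_intoI(1)[OF T, of "\<lambda>vs x. iter_deriv T f vs x + iter_deriv T g vs x"]) (simp, rule cont, rule lim)
  show "iter_deriv T (\<lambda>x. f x + g x) vs = (\<lambda>x. iter_deriv T f vs x + iter_deriv T g vs x)"
    by (rule smooth_intoI(2)[OF T, of "\<lambda>vs x. iter_deriv T f vs x + iter_deriv T g vs x"]) (simp, rule cont, rule lim)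
qed

lemma smooth_into_scale:
  assumes T: "separated_lc T" and f: "smooth_into T f"
  shows "smooth_into T (\<lambda>x. c *\<^sub>R f x)"
    and "iter_deriv T (\<lambda>x. c *\<^sub>R f x) vs = (\<lambda>x. c *\<^sub>R iter_deriv T f vs x)"
  using smooth_into_linear[OF T T continuous_linear_scale[OF separated_lcD(1)[OF T]] f] by auto

lemma smooth_into_zero:
  assumes T: "separated_lc T"
  shows "smooth_into T (\<lambda>x. 0)" and "iter_deriv T (\<lambda>x. 0) vs = (\<lambda>x. 0)"
proof -
  have z: "0 \<in> topspace T" using separated_lcD(2)[OF T] by (rule subspace_0)
  show "smooth_into T (\<lambda>x. 0)"
    by (rule smooth_intoI(1)[OF T, of "\<lambda>_ _. 0"]) (use z in simp_all)
  show "iter_deriv T (\<lambda>x. 0) vs = (\<lambda>x. 0)"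
    by (rule smooth_intoI(2)[OF T, of "\<lambda>_ _. 0"]) (use z in simp_all)
qed

text \<open>The complement of \<open>K\<close> is open, so at its points the difference quotients
  vanish for small \<open>t\<close>.\<close>

lemma iter_deriv_outside:
  assumes T: "separated_lc T" and K: "closed K" and f: "\<And>x. x \<notin> K \<Longrightarrow> f x = 0"
    and x: "x \<notin> K"
  shows "iter_deriv T f vs x = 0"
  using x
proof (induction vs arbitrary: x)
  case (Cons v vs)
  have "open (- K)" using K by auto
  have "((\<lambda>t. x + t *\<^sub>R v) \<longlongrightarrow> x + 0 *\<^sub>R v) (at (0::real))" by (intro tendsto_intros)
  then have "eventually (\<lambda>t. x + t *\<^sub>R v \<in> - K) (at (0::real))"
    by (rule topological_tendstoD) (use \<open>open (- K)\<close> Cons.prems in auto)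
  then have "eventually (\<lambda>t. (iter_deriv T f vs (x + t *\<^sub>R v) - iter_deriv T f vs x) /\<^sub>R t = 0) (at (0::real))"
    by (rule eventually_mono) (use Cons in simp)
  then have "limitin T (\<lambda>t. (iter_deriv T f vs (x + t *\<^sub>R v) - iter_deriv T f vs x) /\<^sub>R t) 0 (at (0::real))"
    using subspace_0[OF separated_lcD(2)[OF T]] by (intro limitin_eventually)
  then show ?case using dir_deriv_eqI[OF T] by simp
qed (use f in simp)

lemma smooth_into_dual:
  assumes T: "separated_lc T" and l: "l \<in> dual_space T" and f: "smooth_into T f"
  shows "smooth_into euclideanreal (l \<circ> f)"
    and "iter_deriv euclideanreal (l \<circ> f) vs x = l (iter_deriv T f vs x)"
  using smooth_into_linear[OF T separated_lc_euclidean dual_spaceD[OF l] f] by (simp_all add: o_def)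

section \<open>Calculus of smooth maps between Euclidean spaces\<close>

lemma iter_deriv_euclidean_tendsto:
  fixes f :: "'a::euclidean_space \<Rightarrow> 'b::euclidean_space"
  assumes "smooth_into euclidean f"
  shows "((\<lambda>t. (iter_deriv euclidean f vs (x + t *\<^sub>R v) - iter_deriv euclidean f vs x) /\<^sub>R t)
    \<longlongrightarrow> iter_deriv euclidean f (v # vs) x) (at (0::real))"
  using smooth_intoD(2)[OF assms separated_lc_euclidean, of vs x v] by simp

lemma iter_deriv_has_vector_derivative:
  fixes f :: "'a::euclidean_space \<Rightarrow> 'b::euclidean_space"
  assumes f: "smooth_into euclidean f"
  shows "((\<lambda>s. iter_deriv euclidean f vs (x + s *\<^sub>R v)) has_vector_derivative
    iter_deriv euclidean f (v # vs) (x + s *\<^sub>R v)) (at s)"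
proof -
  have "((\<lambda>h. (iter_deriv euclidean f vs (x + (s + h) *\<^sub>R v) - iter_deriv euclidean f vs (x + s *\<^sub>R v)) /\<^sub>R h)
      \<longlongrightarrow> iter_deriv euclidean f (v # vs) (x + s *\<^sub>R v)) (at 0)"
    using iter_deriv_euclidean_tendsto[OF f, of vs "x + s *\<^sub>R v" v] by (simp add: scaleR_add_left add.assoc)
  then have "((\<lambda>h. norm (((iter_deriv euclidean f vs (x + (s + h) *\<^sub>R v) - iter_deriv euclidean f vs (x + s *\<^sub>R v)) /\<^sub>R h) -
      iter_deriv euclidean f (v # vs) (x + s *\<^sub>R v))) \<longlongrightarrow> 0) (at 0)"
    using LIM_zero tendsto_norm_zero by blast
  moreover have "norm (iter_deriv euclidean f vs (x + (s + h) *\<^sub>R v) - iter_deriv euclidean f vs (x + s *\<^sub>R v)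
        - h *\<^sub>R iter_deriv euclidean f (v # vs) (x + s *\<^sub>R v)) / norm h
     = norm (((iter_deriv euclidean f vs (x + (s + h) *\<^sub>R v) - iter_deriv euclidean f vs (x + s *\<^sub>R v)) /\<^sub>R h) -
      iter_deriv euclidean f (v # vs) (x + s *\<^sub>R v))" (is "norm (?A - h *\<^sub>R ?D) / norm h = _")
    if "h \<noteq> 0" for h
  proof -
    have "?A /\<^sub>R h - ?D = (?A - h *\<^sub>R ?D) /\<^sub>R h" using that by (simp add: scaleR_diff_right)
    then show ?thesis by (simp add: divide_inverse mult.commute)
  qed
  ultimately have "((\<lambda>h. norm (iter_deriv euclidean f vs (x + (s + h) *\<^sub>R v) - iter_deriv euclidean f vs (x + s *\<^sub>R v)
        - h *\<^sub>R iter_deriv euclidean f (v # vs) (x + s *\<^sub>R v)) / norm h) \<longlongrightarrow> 0) (at 0)"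
    by (subst LIM_equal) auto
  then show ?thesis
    unfolding has_vector_derivative_def has_derivative_at
    by (simp only: bounded_linear_scaleR_left simp_thms)
qed

lemma has_vector_derivative_scale_arg:
  assumes "(\<phi> has_vector_derivative D) (at (s * t))"
  shows "((\<lambda>s. \<phi> (s * t)) has_vector_derivative t *\<^sub>R D) (at (s::real))"
proof -
  have "((\<lambda>s. s * t) has_vector_derivative t) (at s)"
    by (auto intro!: derivative_eq_intros simp: has_real_derivative_iff_has_vector_derivative[symmetric])
  from vector_diff_chain_at[OF this assms] show ?thesis by (simp add: o_def)
qed

lemma iter_deriv_continuous:
  fixes f :: "'a::euclidean_space \<Rightarrow> 'b::euclidean_space"
  assumes f: "smooth_into euclidean f"
  shows "continuous_on UNIV (iter_deriv euclidean f vs)"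
  using smooth_intoD(1)[OF f, of vs] by simp

lemma iter_deriv_inner:
  fixes f :: "'a::euclidean_space \<Rightarrow> 'b::euclidean_space"
  assumes f: "smooth_into euclidean f"
  shows "smooth_into euclideanreal (\<lambda>x. f x \<bullet> b)"
    and "iter_deriv euclideanreal (\<lambda>x. f x \<bullet> b) vs x = iter_deriv euclidean f vs x \<bullet> b"
  using smooth_into_dual[OF separated_lc_euclidean dual_space_euclidean_inner[of b] f] by (simp_all add: o_def)

section \<open>Linearity in the directions and symmetry of iterated derivatives\<close>

lemma iter_deriv_mvt_real:
  fixes g :: "'a::euclidean_space \<Rightarrow> real"
  assumes g: "smooth_into euclidean g"
  shows "\<exists>\<theta>. 0 \<le> \<theta> \<and> \<theta> \<le> 1 \<and>
    iter_deriv euclidean g vs (x + t *\<^sub>R v) - iter_deriv euclidean g vs x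
    = t * iter_deriv euclidean g (v # vs) (x + (\<theta> * t) *\<^sub>R v)"
proof -
  let ?\<phi> = "\<lambda>s. iter_deriv euclidean g vs (x + s *\<^sub>R v)"
  let ?\<phi>' = "\<lambda>s. iter_deriv euclidean g (v # vs) (x + s *\<^sub>R v)"
  have "((\<lambda>s. ?\<phi> (s * t)) has_real_derivative t * ?\<phi>' (s * t)) (at s)" for s
    using has_vector_derivative_scale_arg[OF iter_deriv_has_vector_derivative[OF g, of vs x v "s * t"]]
    by (simp only: has_real_derivative_iff_has_vector_derivative real_scaleR_def)
  from MVT2[OF zero_less_one this] obtain \<theta> where "0 < \<theta>" "\<theta> < 1"
    "?\<phi> (1 * t) - ?\<phi> (0 * t) = (1 - 0) * (t * ?\<phi>' (\<theta> * t))" by blast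
  then show ?thesis
    by (intro exI[of _ \<theta>]) (simp only: mult_zero_left mult_1 scaleR_zero_left add_0_right diff_zero less_imp_le simp_thms)
qed

text \<open>\<open>smooth_into\<close> only asks for continuous directional derivatives, so
  additivity in the direction has to be derived. The increment along \<open>v + w\<close> is split
  at \<open>x + t v\<close>; by the mean value theorem the second piece is \<open>t\<close> times a
  \<open>w\<close>-derivative at points tending to \<open>x\<close>, and continuity gives the
  limit.\<close>

lemma iter_deriv_add_direction_real:
  fixes g :: "'a::euclidean_space \<Rightarrow> real"
  assumes g: "smooth_into euclidean g"
  shows "iter_deriv euclidean g ((v + w) # vs) x = iter_deriv euclidean g (v # vs) x + iter_deriv euclidean g (w # vs) x"
proof -
  let ?G = "iter_deriv euclidean g vs"
  have "\<exists>\<theta>. \<forall>t. 0 \<le> \<theta> t \<and> \<theta> t \<le> 1 \<and> ?G ((x + t *\<^sub>R v) + t *\<^sub>R w) - ?G (x + t *\<^sub>R v)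
      = t * iter_deriv euclidean g (w # vs) ((x + t *\<^sub>R v) + (\<theta> t * t) *\<^sub>R w)"
    by (rule choice, intro allI iter_deriv_mvt_real[OF g])
  then obtain \<theta> where \<theta>: "\<And>t. 0 \<le> \<theta> t" "\<And>t. \<theta> t \<le> 1"
      "\<And>t. ?G ((x + t *\<^sub>R v) + t *\<^sub>R w) - ?G (x + t *\<^sub>R v)
      = t * iter_deriv euclidean g (w # vs) ((x + t *\<^sub>R v) + (\<theta> t * t) *\<^sub>R w)" by blast
  have "((\<lambda>t. \<theta> t * t) \<longlongrightarrow> 0) (at 0)"
  proof (rule Lim_null_comparison[where g = "\<lambda>t. \<bar>t\<bar>"])
    show "\<forall>\<^sub>F t in at 0. norm (\<theta> t * t) \<le> \<bar>t\<bar>"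
      using \<theta>(1,2) by (intro always_eventually) (simp add: abs_mult mult_left_le_one_le)
    show "((\<lambda>t::real. \<bar>t\<bar>) \<longlongrightarrow> 0) (at 0)" by (rule tendsto_rabs_zero) (rule tendsto_ident_at)
  qed
  then have "((\<lambda>t. (x + t *\<^sub>R v) + (\<theta> t * t) *\<^sub>R w) \<longlongrightarrow> (x + 0 *\<^sub>R v) + 0 *\<^sub>R w) (at 0)"
    by (intro tendsto_intros)
  then have "((\<lambda>t. iter_deriv euclidean g (w # vs) ((x + t *\<^sub>R v) + (\<theta> t * t) *\<^sub>R w))
      \<longlongrightarrow> iter_deriv euclidean g (w # vs) ((x + 0 *\<^sub>R v) + 0 *\<^sub>R w)) (at 0)"
    by (rule continuous_on_tendsto_compose[OF iter_deriv_continuous[OF g]]) auto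
  then have lim: "((\<lambda>t. (?G (x + t *\<^sub>R v) - ?G x) /\<^sub>R t +
        iter_deriv euclidean g (w # vs) ((x + t *\<^sub>R v) + (\<theta> t * t) *\<^sub>R w))
      \<longlongrightarrow> iter_deriv euclidean g (v # vs) x + iter_deriv euclidean g (w # vs) x) (at 0)"
    using iter_deriv_euclidean_tendsto[OF g, of vs x v] by (intro tendsto_add) simp_all
  have "((\<lambda>t. (?G (x + t *\<^sub>R (v + w)) - ?G x) /\<^sub>R t)
      \<longlongrightarrow> iter_deriv euclidean g (v # vs) x + iter_deriv euclidean g (w # vs) x) (at 0)"
  proof (rule Lim_transform_eventually[OF lim])
    have "(?G (x + t *\<^sub>R v) - ?G x) /\<^sub>R t + iter_deriv euclidean g (w # vs) ((x + t *\<^sub>R v) + (\<theta> t * t) *\<^sub>R w)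
        = (?G (x + t *\<^sub>R (v + w)) - ?G x) /\<^sub>R t" if "t \<noteq> 0" for t
    proof -
      have "iter_deriv euclidean g (w # vs) ((x + t *\<^sub>R v) + (\<theta> t * t) *\<^sub>R w)
          = (?G ((x + t *\<^sub>R v) + t *\<^sub>R w) - ?G (x + t *\<^sub>R v)) / t"
        by (simp only: \<theta>(3) nonzero_mult_div_cancel_left[OF that])
      moreover have "x + t *\<^sub>R (v + w) = (x + t *\<^sub>R v) + t *\<^sub>R w" by (simp add: scaleR_add_right add.assoc)
      ultimately show ?thesis
        by (simp only: real_scaleR_def divide_inverse mult.commute[of _ "inverse t"] right_diff_distrib)
    qed
    then show "\<forall>\<^sub>F t in at 0. (?G (x + t *\<^sub>R v) - ?G x) /\<^sub>R t +
        iter_deriv euclidean g (w # vs) ((x + t *\<^sub>R v) + (\<theta> t * t) *\<^sub>R w) = (?G (x + t *\<^sub>R (v + w)) - ?G x) /\<^sub>R t"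
      by (rule eventually_mono[OF eventually_neq_at_within[of 0]])
  qed
  with iter_deriv_euclidean_tendsto[OF g, of vs x "v + w"] show ?thesis
    by (rule tendsto_unique[OF at_neq_bot])
qed

lemma iter_deriv_scale_direction:
  fixes f :: "'a::euclidean_space \<Rightarrow> 'b::euclidean_space"
  assumes f: "smooth_into euclidean f"
  shows "iter_deriv euclidean f ((c *\<^sub>R v) # vs) x = c *\<^sub>R iter_deriv euclidean f (v # vs) x"
proof -
  have "((\<lambda>s. iter_deriv euclidean f vs (x + s *\<^sub>R c *\<^sub>R v)) has_vector_derivative
      c *\<^sub>R iter_deriv euclidean f (v # vs) x) (at 0)"
    using has_vector_derivative_scale_arg[OF iter_deriv_has_vector_derivative[OF f, of vs x v "0 * c"]]
    by (simp del: iter_deriv.simps)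
  moreover have "((\<lambda>s. iter_deriv euclidean f vs (x + s *\<^sub>R c *\<^sub>R v)) has_vector_derivative
      iter_deriv euclidean f ((c *\<^sub>R v) # vs) x) (at 0)"
    using iter_deriv_has_vector_derivative[OF f, of vs x "c *\<^sub>R v" 0] by (simp del: iter_deriv.simps)
  ultimately show ?thesis by (rule vector_derivative_unique_at[symmetric])
qed

lemma iter_deriv_add_direction:
  fixes f :: "'a::euclidean_space \<Rightarrow> 'b::euclidean_space"
  assumes f: "smooth_into euclidean f"
  shows "iter_deriv euclidean f ((v + w) # vs) x = iter_deriv euclidean f (v # vs) x + iter_deriv euclidean f (w # vs) x"
  by (rule euclidean_eqI)
    (simp only: inner_add_left iter_deriv_inner(2)[OF f, symmetric] iter_deriv_add_direction_real[OF iter_deriv_inner(1)[OF f]])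

lemma iter_deriv_sum_direction:
  fixes f :: "'a::euclidean_space \<Rightarrow> 'b::euclidean_space"
  assumes f: "smooth_into euclidean f"
  shows "iter_deriv euclidean f (v # vs) x = (\<Sum>b\<in>Basis. (v \<bullet> b) *\<^sub>R iter_deriv euclidean f (b # vs) x)"
proof -
  have z: "iter_deriv euclidean f (0 # vs) x = 0"
    using iter_deriv_scale_direction[OF f, of 0 0 vs x] by simp
  have "iter_deriv euclidean f ((\<Sum>b\<in>B. (v \<bullet> b) *\<^sub>R b) # vs) x
      = (\<Sum>b\<in>B. (v \<bullet> b) *\<^sub>R iter_deriv euclidean f (b # vs) x)" if "finite B" for B
    using that
  proof (induction B rule: finite_induct)
    case (insert b B)
    then show ?case
      by (simp only: sum.insert[OF insert(1,2)] iter_deriv_add_direction[OF f] iter_deriv_scale_direction[OF f])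
  qed (use z in simp)
  from this[OF finite_Basis] show ?thesis by (simp only: euclidean_representation)
qed

text \<open>Both mixed derivatives are limits of the same second difference quotient.\<close>

lemma iter_deriv_commute_real:
  fixes g :: "'a::euclidean_space \<Rightarrow> real"
  assumes g: "smooth_into euclidean g"
  shows "iter_deriv euclidean g (v # w # vs) x = iter_deriv euclidean g (w # v # vs) x"
proof -
  let ?G = "iter_deriv euclidean g vs"
  define \<Delta> where "\<Delta> t = ?G (x + t *\<^sub>R v + t *\<^sub>R w) - ?G (x + t *\<^sub>R v) - ?G (x + t *\<^sub>R w) + ?G x" for t :: real
  have key: "((\<lambda>t. (?G (x + t *\<^sub>R a + t *\<^sub>R b) - ?G (x + t *\<^sub>R a) - ?G (x + t *\<^sub>R b) + ?G x) / t\<^sup>2)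
      \<longlongrightarrow> iter_deriv euclidean g (b # a # vs) x) (at 0)" for a b
  proof -
    let ?E = "\<lambda>t. ?G (x + t *\<^sub>R a + t *\<^sub>R b) - ?G (x + t *\<^sub>R a) - ?G (x + t *\<^sub>R b) + ?G x"
    have "\<exists>r q. (0 \<le> r \<and> r \<le> 1) \<and> (0 \<le> q \<and> q \<le> 1) \<and>
        ?E t = t\<^sup>2 * iter_deriv euclidean g (b # a # vs) (x + (r * t) *\<^sub>R a + (q * t) *\<^sub>R b)" for t
    proof -
      \<comment> \<open>Differencing along \<open>b\<close> lets the mean value theorem act along
        \<open>a\<close>; a second application, along \<open>b\<close>, turns the remaining
        difference into the mixed derivative at an intermediate point.\<close>
      define h where "h = (\<lambda>y. ?G (y + t *\<^sub>R b) - ?G y)"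
      have "((\<lambda>s. h (x + s *\<^sub>R a)) has_vector_derivative
          iter_deriv euclidean g (a # vs) (x + s *\<^sub>R a + t *\<^sub>R b) - iter_deriv euclidean g (a # vs) (x + s *\<^sub>R a)) (at s)" for s
        using has_vector_derivative_diff[OF iter_deriv_has_vector_derivative[OF g, of vs "x + t *\<^sub>R b" a s]
          iter_deriv_has_vector_derivative[OF g, of vs x a s]]
        by (simp only: h_def add.commute[of _ "t *\<^sub>R b"] add.left_commute add.assoc)
      from has_vector_derivative_scale_arg[OF this]
      have "((\<lambda>s. h (x + (s * t) *\<^sub>R a)) has_real_derivative
          t * (iter_deriv euclidean g (a # vs) (x + (s * t) *\<^sub>R a + t *\<^sub>R b) - iter_deriv euclidean g (a # vs) (x + (s * t) *\<^sub>R a))) (at s)" for s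
        by (simp only: has_real_derivative_iff_has_vector_derivative real_scaleR_def)
      from MVT2[OF zero_less_one this]
      obtain r where r: "0 < r" "r < 1" "h (x + t *\<^sub>R a) - h x =
          t * (iter_deriv euclidean g (a # vs) (x + (r * t) *\<^sub>R a + t *\<^sub>R b) - iter_deriv euclidean g (a # vs) (x + (r * t) *\<^sub>R a))"
        by (auto simp del: iter_deriv.simps)
      obtain q where q: "0 \<le> q" "q \<le> 1"
        "iter_deriv euclidean g (a # vs) (x + (r * t) *\<^sub>R a + t *\<^sub>R b) - iter_deriv euclidean g (a # vs) (x + (r * t) *\<^sub>R a)
          = t * iter_deriv euclidean g (b # a # vs) (x + (r * t) *\<^sub>R a + (q * t) *\<^sub>R b)"
        using iter_deriv_mvt_real[OF g, of "a # vs" "x + (r * t) *\<^sub>R a" t b] by blast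
      have "?E t = h (x + t *\<^sub>R a) - h x" by (simp add: h_def)
      also have "\<dots> = t\<^sup>2 * iter_deriv euclidean g (b # a # vs) (x + (r * t) *\<^sub>R a + (q * t) *\<^sub>R b)"
        unfolding r(3) q(3) by (simp only: power2_eq_square mult.assoc)
      finally show ?thesis using r q by (intro exI[of _ r] exI[of _ q]) simp
    qed
    then obtain r q where rq: "\<And>t. 0 \<le> r t \<and> r t \<le> 1" "\<And>t. 0 \<le> q t \<and> q t \<le> 1"
        "\<And>t. ?E t = t\<^sup>2 * iter_deriv euclidean g (b # a # vs) (x + (r t * t) *\<^sub>R a + (q t * t) *\<^sub>R b)"
      by metis
    have null: "((\<lambda>t. \<theta> t * t) \<longlongrightarrow> 0) (at 0)" if "\<And>t. 0 \<le> \<theta> t \<and> \<theta> t \<le> 1" for \<theta> :: "real \<Rightarrow> real"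
    proof (rule Lim_null_comparison[where g = "\<lambda>t. \<bar>t\<bar>"])
      show "\<forall>\<^sub>F t in at 0. norm (\<theta> t * t) \<le> \<bar>t\<bar>"
        using that by (intro always_eventually) (simp add: abs_mult mult_left_le_one_le)
      show "((\<lambda>t::real. \<bar>t\<bar>) \<longlongrightarrow> 0) (at 0)" by (rule tendsto_rabs_zero) (rule tendsto_ident_at)
    qed
    have "((\<lambda>t. x + (r t * t) *\<^sub>R a + (q t * t) *\<^sub>R b) \<longlongrightarrow> x + 0 *\<^sub>R a + 0 *\<^sub>R b) (at 0)"
      by (intro tendsto_intros null rq)
    then have lim: "((\<lambda>t. iter_deriv euclidean g (b # a # vs) (x + (r t * t) *\<^sub>R a + (q t * t) *\<^sub>R b))
        \<longlongrightarrow> iter_deriv euclidean g (b # a # vs) (x + 0 *\<^sub>R a + 0 *\<^sub>R b)) (at 0)"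
      by (rule continuous_on_tendsto_compose[OF iter_deriv_continuous[OF g]]) auto
    show ?thesis
    proof (rule Lim_transform_eventually)
      show "((\<lambda>t. iter_deriv euclidean g (b # a # vs) (x + (r t * t) *\<^sub>R a + (q t * t) *\<^sub>R b))
        \<longlongrightarrow> iter_deriv euclidean g (b # a # vs) x) (at 0)" using lim by simp
      show "\<forall>\<^sub>F t in at 0. iter_deriv euclidean g (b # a # vs) (x + (r t * t) *\<^sub>R a + (q t * t) *\<^sub>R b) = ?E t / t\<^sup>2"
        unfolding rq(3) by (rule eventually_mono[OF eventually_neq_at_within[of 0]]) (simp del: iter_deriv.simps)
    qed
  qed
  have "((\<lambda>t. \<Delta> t / t\<^sup>2) \<longlongrightarrow> iter_deriv euclidean g (w # v # vs) x) (at 0)"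
    using key[of v w] by (simp add: \<Delta>_def)
  moreover have "((\<lambda>t. \<Delta> t / t\<^sup>2) \<longlongrightarrow> iter_deriv euclidean g (v # w # vs) x) (at 0)"
  proof -
    have "\<Delta> t = ?G (x + t *\<^sub>R w + t *\<^sub>R v) - ?G (x + t *\<^sub>R w) - ?G (x + t *\<^sub>R v) + ?G x" for t
      by (simp add: \<Delta>_def algebra_simps)
    then show ?thesis using key[of w v] by simp
  qed
  ultimately show ?thesis by (metis tendsto_unique at_neq_bot)
qed

lemma iter_deriv_commute:
  fixes f :: "'a::euclidean_space \<Rightarrow> 'b::euclidean_space"
  assumes f: "smooth_into euclidean f"
  shows "iter_deriv euclidean f (v # w # vs) = iter_deriv euclidean f (w # v # vs)"
proof (rule ext, rule euclidean_eqI)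
  fix x and b :: 'b
  show "iter_deriv euclidean f (v # w # vs) x \<bullet> b = iter_deriv euclidean f (w # v # vs) x \<bullet> b"
    unfolding iter_deriv_inner(2)[OF f, symmetric]
    by (rule iter_deriv_commute_real[OF iter_deriv_inner(1)[OF f]])
qed

lemma iter_deriv_move:
  fixes f :: "'a::euclidean_space \<Rightarrow> 'b::euclidean_space"
  assumes f: "smooth_into euclidean f"
  shows "iter_deriv euclidean f (us @ v # ws) = iter_deriv euclidean f (v # us @ ws)"
proof (induction us)
  case (Cons u us)
  have "iter_deriv euclidean f ((u # us) @ v # ws) = dir_deriv euclidean u (iter_deriv euclidean f (us @ v # ws))"
    by simp
  also have "\<dots> = iter_deriv euclidean f (u # v # us @ ws)" unfolding Cons.IH by simp
  also have "\<dots> = iter_deriv euclidean f (v # (u # us) @ ws)"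
    unfolding append_Cons by (rule iter_deriv_commute[OF f])
  finally show ?case .
qed simp

text \<open>Multilinearity turns bounds for each single direction list into one bound for all lists
  of \<open>k\<close> unit vectors: coefficients in the basis are at most 1, and there are finitely
  many lists of basis vectors.\<close>

lemma iter_deriv_multilinear_bound:
  fixes A :: "('a::euclidean_space \<Rightarrow> 'b::euclidean_space) set"
  assumes A: "\<And>f. f \<in> A \<Longrightarrow> smooth_into euclidean f"
    and bd: "\<And>vs. \<exists>C. \<forall>f\<in>A. \<forall>x\<in>X. norm (iter_deriv euclidean f vs x) \<le> C"
  shows "\<exists>C. \<forall>f\<in>A. \<forall>x\<in>X. \<forall>vs. length vs = k \<and> (\<forall>v\<in>set vs. norm v \<le> 1) \<longrightarrow>
    norm (iter_deriv euclidean f vs x) \<le> C"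
proof -
  \<comment> \<open>Generalised by trailing directions \<open>ws\<close>: the leading vector is
    expanded in the basis and each basis vector is moved behind the others, where the induction
    hypothesis takes it up as part of \<open>ws\<close>.\<close>
  have "\<exists>C. \<forall>f\<in>A. \<forall>x\<in>X. \<forall>vs. length vs = k \<and> (\<forall>v\<in>set vs. norm v \<le> 1) \<longrightarrow>
    norm (iter_deriv euclidean f (vs @ ws) x) \<le> C" for ws
  proof (induction k arbitrary: ws)
    case 0
    then show ?case using bd[of ws] by auto
  next
    case (Suc k)
    have "\<exists>C. \<forall>b. \<forall>f\<in>A. \<forall>x\<in>X. \<forall>vs. length vs = k \<and> (\<forall>v\<in>set vs. norm v \<le> 1) \<longrightarrow>
        norm (iter_deriv euclidean f (vs @ b # ws) x) \<le> C b"
      by (rule choice, rule allI, rule Suc.IH)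
    then obtain C where C: "\<And>b f x vs. f \<in> A \<Longrightarrow> x \<in> X \<Longrightarrow> length vs = k \<Longrightarrow> (\<forall>v\<in>set vs. norm v \<le> 1) \<Longrightarrow>
        norm (iter_deriv euclidean f (vs @ b # ws) x) \<le> C b" by blast
    have "norm (iter_deriv euclidean f (vs @ ws) x) \<le> (\<Sum>b\<in>Basis. C b)"
      if f: "f \<in> A" and x: "x \<in> X" and vs: "length vs = Suc k" "\<forall>v\<in>set vs. norm v \<le> 1" for f x vs
    proof -
      obtain v us where v: "vs = v # us" "length us = k" using vs(1) by (auto simp: length_Suc_conv)
      have "norm (iter_deriv euclidean f (vs @ ws) x)
          = norm (\<Sum>b\<in>Basis. (v \<bullet> b) *\<^sub>R iter_deriv euclidean f (us @ b # ws) x)"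
        unfolding v append_Cons
        by (subst iter_deriv_sum_direction[OF A[OF f]]) (simp only: iter_deriv_move[OF A[OF f]])
      also have "\<dots> \<le> (\<Sum>b\<in>Basis. C b)"
      proof (rule order_trans[OF norm_sum sum_mono])
        fix b :: 'a assume b: "b \<in> Basis"
        have "\<bar>v \<bullet> b\<bar> \<le> 1" using Basis_le_norm[OF b, of v] vs(2) v by auto
        moreover have "norm (iter_deriv euclidean f (us @ b # ws) x) \<le> C b"
          using C[OF f x v(2)] vs(2) v(1) by simp
        ultimately show "norm ((v \<bullet> b) *\<^sub>R iter_deriv euclidean f (us @ b # ws) x) \<le> C b"
          using mult_mono[of "\<bar>v \<bullet> b\<bar>" 1 "norm (iter_deriv euclidean f (us @ b # ws) x)" "C b"] by simp
      qed
      finally show ?thesis .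
    qed
    then show ?case by blast
  qed
  from this[of "[]"] show ?thesis by simp
qed

section \<open>Frechet derivatives and remainder estimates\<close>

text \<open>By the mean value theorem the remainder is the change of a directional derivative
  between \<open>x\<close> and a point \<open>z\<close> of the segment. Expanding the direction in
  the basis bounds it by \<open>norm (y - x)\<close> times \<open>?s z\<close>, which is small by
  continuity of the partial derivatives. This connects \<open>frechet_iter\<close> with
  \<open>iter_deriv\<close>.\<close>

lemma iter_deriv_has_derivative:
  fixes g :: "'a::euclidean_space \<Rightarrow> real"
  assumes g: "smooth_into euclidean g"
  shows "(iter_deriv euclidean g vs has_derivative (\<lambda>h. iter_deriv euclidean g (h # vs) x)) (at x)"
proof -
  let ?G = "iter_deriv euclidean g vs" and ?D = "\<lambda>h. iter_deriv euclidean g (h # vs)"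
  have lin: "linear (\<lambda>h. ?D h x)"
    by (rule linearI) (rule iter_deriv_add_direction[OF g], rule iter_deriv_scale_direction[OF g])
  show ?thesis
    unfolding has_derivative_at_alt
  proof (intro conjI allI impI linear_conv_bounded_linear[THEN iffD1] lin)
    fix e :: real assume e: "e > 0"
    let ?s = "\<lambda>z. \<Sum>b\<in>Basis. \<bar>?D b z - ?D b x\<bar>"
    have "continuous_on UNIV ?s"
      by (intro continuous_intros iter_deriv_continuous[OF g])
    then have "isCont ?s x" by (simp only: continuous_on_eq_continuous_at[OF open_UNIV] UNIV_I ball_simps)
    from this[unfolded continuous_at_eps_delta, rule_format, OF e]
    obtain d where d: "d > 0" "\<And>z. dist z x < d \<Longrightarrow> dist (?s z) (?s x) < e" by (elim exE conjE) blast
    have "norm (?G y - ?G x - ?D (y - x) x) \<le> e * norm (y - x)" if y: "norm (y - x) < d" for y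
    proof -
      obtain \<theta> where \<theta>: "0 \<le> \<theta>" "\<theta> \<le> 1" "?G (x + 1 *\<^sub>R (y - x)) - ?G x = 1 * ?D (y - x) (x + (\<theta> * 1) *\<^sub>R (y - x))"
        using iter_deriv_mvt_real[OF g, of vs x 1 "y - x"] by blast
      define z where "z = x + \<theta> *\<^sub>R (y - x)"
      have "dist z x \<le> norm (y - x)" using \<theta> by (simp add: z_def dist_norm mult_left_le_one_le)
      then have s: "?s z < e" using d(2)[of z] y by (simp add: dist_real_def)
      have "?G y - ?G x - ?D (y - x) x = ?D (y - x) z - ?D (y - x) x"
        using \<theta>(3) by (simp add: z_def)
      also have "\<dots> = (\<Sum>b\<in>Basis. ((y - x) \<bullet> b) * (?D b z - ?D b x))"
        by (subst (1 2) iter_deriv_sum_direction[OF g])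
          (simp only: sum_subtractf[symmetric] right_diff_distrib real_scaleR_def)
      also have "norm \<dots> \<le> (\<Sum>b\<in>Basis. norm (y - x) * \<bar>?D b z - ?D b x\<bar>)"
        by (rule order_trans[OF norm_sum sum_mono]) (auto simp: abs_mult intro!: mult_right_mono Basis_le_norm)
      also have "\<dots> = norm (y - x) * ?s z" by (simp only: sum_distrib_left)
      also have "\<dots> \<le> norm (y - x) * e" using s by (intro mult_left_mono) auto
      finally show ?thesis by (simp only: mult.commute)
    qed
    then show "\<exists>d>0. \<forall>y. norm (y - x) < d \<longrightarrow> norm (?G y - ?G x - ?D (y - x) x) \<le> e * norm (y - x)"
      using d(1) by blast
  qed
qed

lemma frechet_iter_eq_iter_deriv:
  assumes "smooth_into euclideanreal g"
  shows "frechet_iter g vs = iter_deriv euclideanreal g vs"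
proof (induction vs)
  case (Cons v vs)
  have "frechet_derivative (iter_deriv euclideanreal g vs) (at x) v = iter_deriv euclideanreal g (v # vs) x" for x
    using frechet_derivative_at[OF iter_deriv_has_derivative[OF assms, of vs x]] by metis
  then show ?case by (simp only: frechet_iter.simps Cons.IH)
qed simp

lemma iter_deriv_diff_bound:
  fixes f :: "'a::euclidean_space \<Rightarrow> 'b::euclidean_space"
  assumes f: "smooth_into euclidean f" and B: "\<And>z. norm (iter_deriv euclidean f (v # vs) z) \<le> B"
  shows "norm (iter_deriv euclidean f vs (x + t *\<^sub>R v) - iter_deriv euclidean f vs x) \<le> \<bar>t\<bar> * B"
proof -
  have "norm ((\<lambda>s. iter_deriv euclidean f vs (x + s *\<^sub>R v)) t - (\<lambda>s. iter_deriv euclidean f vs (x + s *\<^sub>R v)) 0) \<le> B * norm (t - 0)"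
  proof (rule differentiable_bound[where S = UNIV and f' = "\<lambda>s h. h *\<^sub>R iter_deriv euclidean f (v # vs) (x + s *\<^sub>R v)"])
    fix s
    show "((\<lambda>s. iter_deriv euclidean f vs (x + s *\<^sub>R v)) has_derivative
        (\<lambda>h. h *\<^sub>R iter_deriv euclidean f (v # vs) (x + s *\<^sub>R v))) (at s within UNIV)"
      using iter_deriv_has_vector_derivative[OF f, of vs x v s] by (simp only: has_vector_derivative_def)
    show "onorm (\<lambda>h. h *\<^sub>R iter_deriv euclidean f (v # vs) (x + s *\<^sub>R v)) \<le> B"
      by (rule onorm_le) (simp add: mult.commute[of B] mult_left_mono[OF B] del: iter_deriv.simps)
  qed auto
  then show ?thesis by (simp add: mult.commute)
qed

text \<open>After subtraction of the linear part the derivative is at most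
  \<open>\<bar>t\<bar> * B\<close> between 0 and \<open>t\<close>. The factor 1/2 of Taylor's
  formula is given away, as only the quadratic order in \<open>t\<close> matters for difference
  quotients.\<close>

lemma iter_deriv_taylor_bound:
  fixes f :: "'a::euclidean_space \<Rightarrow> 'b::euclidean_space"
  assumes f: "smooth_into euclidean f" and B: "\<And>z. norm (iter_deriv euclidean f (v # v # vs) z) \<le> B"
  shows "norm (iter_deriv euclidean f vs (x + t *\<^sub>R v) - iter_deriv euclidean f vs x
    - t *\<^sub>R iter_deriv euclidean f (v # vs) x) \<le> t\<^sup>2 * B"
proof -
  let ?\<phi> = "\<lambda>s. iter_deriv euclidean f vs (x + s *\<^sub>R v) - s *\<^sub>R iter_deriv euclidean f (v # vs) x"
  have "norm (?\<phi> t - ?\<phi> 0) \<le> (\<bar>t\<bar> * B) * norm (t - 0)"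
  proof (rule differentiable_bound[where S = "closed_segment 0 t" and
        f' = "\<lambda>s h. h *\<^sub>R (iter_deriv euclidean f (v # vs) (x + s *\<^sub>R v) - iter_deriv euclidean f (v # vs) x)"])
    fix s assume s: "s \<in> closed_segment 0 t"
    show "(?\<phi> has_derivative (\<lambda>h. h *\<^sub>R (iter_deriv euclidean f (v # vs) (x + s *\<^sub>R v) -
        iter_deriv euclidean f (v # vs) x))) (at s within closed_segment 0 t)"
      unfolding has_vector_derivative_def[symmetric]
      by (rule has_vector_derivative_diff[OF has_vector_derivative_at_within[OF iter_deriv_has_vector_derivative[OF f]]])
        (auto intro!: derivative_eq_intros)
    have "\<bar>s\<bar> \<le> \<bar>t\<bar>" using s segment_bound(1)[OF s] by simp
    have B0: "0 \<le> B" using B[of x] norm_ge_zero order_trans by blast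
    have "norm (iter_deriv euclidean f (v # vs) (x + s *\<^sub>R v) - iter_deriv euclidean f (v # vs) x) \<le> \<bar>s\<bar> * B"
      by (rule iter_deriv_diff_bound[OF f B])
    also have "\<dots> \<le> \<bar>t\<bar> * B" using \<open>\<bar>s\<bar> \<le> \<bar>t\<bar>\<close> B0 by (rule mult_right_mono)
    finally have *: "norm (iter_deriv euclidean f (v # vs) (x + s *\<^sub>R v) - iter_deriv euclidean f (v # vs) x) \<le> \<bar>t\<bar> * B" .
    show "onorm (\<lambda>h. h *\<^sub>R (iter_deriv euclidean f (v # vs) (x + s *\<^sub>R v) - iter_deriv euclidean f (v # vs) x)) \<le> \<bar>t\<bar> * B"
      by (rule onorm_le) (simp add: mult.commute[of "\<bar>t\<bar> * B"] mult_left_mono[OF *] del: iter_deriv.simps)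
  qed auto
  then show ?thesis by (simp add: power2_eq_square mult.commute mult.left_commute algebra_simps)
qed

section \<open>Inductive limits over compact sets and test functions\<close>

lemma subspace_Union_compact:
  fixes S :: "'a::topological_space set \<Rightarrow> 'v::real_vector topology"
  assumes sub: "\<And>K. compact K \<Longrightarrow> subspace (topspace (S K))"
    and mono: "\<And>K K'. K \<subseteq> K' \<Longrightarrow> topspace (S K) \<subseteq> topspace (S K')"
  shows "subspace (\<Union>T\<in>{S K | K. compact K}. topspace T)"
proof (rule subspaceI)
  show "0 \<in> (\<Union>T\<in>{S K | K. compact K}. topspace T)"
    using subspace_0[OF sub[OF compact_empty]] compact_empty by blast
next
  fix f g assume "f \<in> (\<Union>T\<in>{S K | K. compact K}. topspace T)" "g \<in> (\<Union>T\<in>{S K | K. compact K}. topspace T)"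
  then obtain K K' where K: "compact K" "f \<in> topspace (S K)" "compact K'" "g \<in> topspace (S K')" by auto
  have "f \<in> topspace (S (K \<union> K'))" "g \<in> topspace (S (K \<union> K'))"
    using K(2,4) mono[of K "K \<union> K'"] mono[of K' "K \<union> K'"] by auto
  then have "f + g \<in> topspace (S (K \<union> K'))"
    by (rule subspace_add[OF sub[OF compact_Un[OF K(1,3)]]])
  then show "f + g \<in> (\<Union>T\<in>{S K | K. compact K}. topspace T)"
    using compact_Un[OF K(1,3)] by blast
next
  fix c f assume "f \<in> (\<Union>T\<in>{S K | K. compact K}. topspace T)"
  then obtain K where K: "compact K" "f \<in> topspace (S K)" by auto
  then have "c *\<^sub>R f \<in> topspace (S K)" using subspace_scale[OF sub[OF K(1)]] by blast
  then show "c *\<^sub>R f \<in> (\<Union>T\<in>{S K | K. compact K}. topspace T)" using K(1) by blast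
qed

lemma lc_ind_limit_seminorm:
  assumes "subspace (\<Union>T\<in>TT. topspace T)" "seminorm_on (\<Union>T\<in>TT. topspace T) p"
    and "\<And>T. T \<in> TT \<Longrightarrow> continuous_map T euclideanreal p"
  shows "p \<in> cont_seminorms (lc_ind_limit TT)"
proof -
  have "continuous_map (lc_ind_limit TT) euclideanreal p"
    unfolding lc_ind_limit_def by (rule continuous_map_seminorm[OF assms(1)]) (use assms(2,3) in auto)
  then show ?thesis using assms(2) by (simp add: cont_seminorms_def)
qed

lemma cont_seminorms_lc_ind_limitD:
  assumes "subspace (\<Union>T\<in>TT. topspace T)" "T \<in> TT" "locally_convex T"
    and p: "p \<in> cont_seminorms (lc_ind_limit TT)"
  shows "p \<in> cont_seminorms T"
proof -
  have "seminorm_on (topspace T) p"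
    using p assms(2) by (auto simp: cont_seminorms_def intro: seminorm_on_subset)
  moreover have "continuous_map T euclideanreal p"
    using continuous_map_compose[OF lc_ind_limit_inclusion[OF assms(1-3)], of euclideanreal p] p
    by (simp add: cont_seminorms_def o_def)
  ultimately show ?thesis by (simp add: cont_seminorms_def)
qed

lemma bounded_in_lc_ind_limit_step:
  assumes "subspace (\<Union>T\<in>TT. topspace T)" "T \<in> TT" "locally_convex T" "bounded_in T B"
  shows "bounded_in (lc_ind_limit TT) B"
  using assms(4) cont_seminorms_lc_ind_limitD[OF assms(1-3)] assms(2)
  unfolding bounded_in_locally_convex[OF assms(3)] bounded_in_locally_convex[OF locally_convex_lc_ind_limit[OF assms(1)]]
  by auto

text \<open>On each step of the limit only finitely many of the points \<open>x\<^sub>j \<rightarrow> \<infinity>\<close> matter, so arbitrary weights are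
  admissible.\<close>

lemma escaping_seminorm:
  fixes S :: "'a::euclidean_space set \<Rightarrow> ('a \<Rightarrow> 'v::real_vector) topology"
  assumes sub: "subspace (\<Union>T\<in>{S K | K. compact K}. topspace T)"
    and supp: "\<And>K f x. f \<in> topspace (S K) \<Longrightarrow> x \<notin> K \<Longrightarrow> f x = 0"
    and V: "subspace V" "\<And>K f x. f \<in> topspace (S K) \<Longrightarrow> f x \<in> V"
    and N: "\<And>j. seminorm_on V (Q j)"
    and cont: "\<And>j x K. compact K \<Longrightarrow> continuous_map (S K) euclideanreal (\<lambda>f. Q j (f x))"
    and X: "\<And>j. norm (X j) > real j" and w: "\<And>j. w j \<ge> 0"
  shows "\<exists>p\<in>cont_seminorms (lc_ind_limit {S K | K. compact K}).
    \<forall>f\<in>topspace (lc_ind_limit {S K | K. compact K}). \<forall>j. w j * Q j (f (X j)) \<le> p f"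
proof -
  let ?TT = "{S K | K. compact K}"
  \<comment> \<open>Since \<open>norm (X j) > real j\<close>, a function supported in the ball of
    radius \<open>n\<close> meets only indices below \<open>n\<close>, so the sum is finite on every
    step.\<close>
  define p where "p f = (\<Sum>j | f (X j) \<noteq> 0. w j * Q j (f (X j)))" for f :: "'a \<Rightarrow> 'v"
  have Q0: "Q j 0 = 0" for j using seminorm_on_0[OF N subspace_0[OF V(1)]] .
  have zero: "f (X j) = 0" if f: "f \<in> topspace (S K)" and K: "K \<subseteq> cball 0 (real n)" and j: "n \<le> j" for f K n j
  proof (rule supp[OF f])
    show "X j \<notin> K" using K X[of j] j by (auto dest!: subsetD)
  qed
  have fin: "finite {j. f (X j) \<noteq> 0}"
    and p_eq: "p f = (\<Sum>j<n. w j * Q j (f (X j)))"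
    if f: "f \<in> topspace (S K)" and K: "K \<subseteq> cball 0 (real n)" for f K n
  proof -
    have sub: "{j. f (X j) \<noteq> 0} \<subseteq> {..<n}" using zero[OF f K] by (metis (mono_tags) lessThan_iff mem_Collect_eq not_le subsetI)
    then show "finite {j. f (X j) \<noteq> 0}" using finite_subset by blast
    show "p f = (\<Sum>j<n. w j * Q j (f (X j)))"
      unfolding p_def by (rule sum.mono_neutral_left) (use sub Q0 in auto)
  qed
  have ball: "\<exists>n. K \<subseteq> cball 0 (real n)" if K: "compact K" for K :: "'a set"
  proof -
    obtain r where r: "\<And>x. x \<in> K \<Longrightarrow> norm x \<le> r" using compact_imp_bounded[OF K] bounded_iff by blast
    obtain n where "r \<le> real n" using real_arch_simple by blast
    then show ?thesis using r by (intro exI[of _ n]) force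
  qed
  have snQ: "seminorm_on (\<Union>T\<in>?TT. topspace T) (\<lambda>f. \<Sum>j<n. w j * Q j (f (X j)))" for n
    by (intro seminorm_on_sum seminorm_on_mult seminorm_on_linear[OF _ N] w)
      (use V(2) in \<open>auto simp: linear_on_set_def\<close>)
  have contQ: "continuous_map (S K) euclideanreal p" if K: "compact K" for K
  proof -
    obtain n where n: "K \<subseteq> cball 0 (real n)" using ball[OF K] by blast
    have "continuous_map (S K) euclideanreal (\<lambda>f. \<Sum>j<n. w j * Q j (f (X j)))"
      by (intro continuous_map_sum continuous_map_real_mult cont[OF K]) auto
    then show ?thesis by (rule continuous_map_eq) (simp add: p_eq[OF _ n])
  qed
  \<comment> \<open>The index set of the sum depends on \<open>f\<close>; the seminorm laws are
    therefore inherited from one partial sum long enough for \<open>f\<close>, \<open>g\<close> and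
    \<open>f + g\<close> at once.\<close>
  have common: "\<exists>n. p f = (\<Sum>j<n. w j * Q j (f (X j))) \<and> p g = (\<Sum>j<n. w j * Q j (g (X j))) \<and>
      p (f + g) = (\<Sum>j<n. w j * Q j ((f + g) (X j)))"
    if f: "f \<in> (\<Union>T\<in>?TT. topspace T)" and g: "g \<in> (\<Union>T\<in>?TT. topspace T)" for f g
  proof -
    have "f + g \<in> (\<Union>T\<in>?TT. topspace T)" using subspace_add[OF sub f g] .
    then obtain K1 K2 K3 where K: "compact K1" "f \<in> topspace (S K1)" "compact K2" "g \<in> topspace (S K2)"
      "compact K3" "f + g \<in> topspace (S K3)" using f g by auto
    obtain n where n: "K1 \<union> K2 \<union> K3 \<subseteq> cball 0 (real n)" using ball[of "K1 \<union> K2 \<union> K3"] K by auto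
    then show ?thesis using p_eq[OF K(2), of n] p_eq[OF K(4), of n] p_eq[OF K(6), of n] by auto
  qed
  have pP: "p \<in> cont_seminorms (lc_ind_limit ?TT)"
  proof (rule lc_ind_limit_seminorm[OF sub])
    show "seminorm_on (\<Union>T\<in>?TT. topspace T) p"
      unfolding seminorm_on_def
    proof (intro conjI ballI allI)
      fix f assume f: "f \<in> (\<Union>T\<in>?TT. topspace T)"
      obtain n where n: "p f = (\<Sum>j<n. w j * Q j (f (X j)))" using common[OF f f] by blast
      then show "0 \<le> p f" using seminorm_onD(1)[OF snQ f, of n] by simp
      show "p (f + g) \<le> p f + p g" if g: "g \<in> (\<Union>T\<in>?TT. topspace T)" for g
      proof -
        obtain n where n: "p f = (\<Sum>j<n. w j * Q j (f (X j)))" "p g = (\<Sum>j<n. w j * Q j (g (X j)))"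
          "p (f + g) = (\<Sum>j<n. w j * Q j ((f + g) (X j)))" using common[OF f g] by blast
        show ?thesis unfolding n by (rule seminorm_onD(2)[OF snQ f g])
      qed
      fix c
      have cf: "c *\<^sub>R f \<in> (\<Union>T\<in>?TT. topspace T)" using subspace_scale[OF sub f] .
      obtain m where m: "p f = (\<Sum>j<m. w j * Q j (f (X j)))"
          "p (c *\<^sub>R f) = (\<Sum>j<m. w j * Q j ((c *\<^sub>R f) (X j)))" using common[OF f cf] by blast
      show "p (c *\<^sub>R f) = \<bar>c\<bar> * p f" unfolding m by (rule seminorm_onD(3)[OF snQ f])
    qed
  qed (use contQ in auto)
  have "w j * Q j (f (X j)) \<le> p f" if f: "f \<in> (\<Union>T\<in>?TT. topspace T)" for f j
  proof -
    obtain K where K: "compact K" "f \<in> topspace (S K)" using f by auto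
    obtain n where n: "K \<subseteq> cball 0 (real n)" using ball[OF K(1)] by blast
    have nn: "0 \<le> w i * Q i (f (X i))" for i using w seminorm_onD(1)[OF N V(2)[OF K(2)]] by simp
    show ?thesis
    proof (cases "f (X j) = 0")
      case True
      then show ?thesis using Q0 nn unfolding p_def by (simp add: sum_nonneg)
    next
      case False
      then show ?thesis unfolding p_def by (intro member_le_sum) (use fin[OF K(2) n] nn in auto)
    qed
  qed
  with pP show ?thesis unfolding topspace_lc_ind_limit by blast
qed

text \<open>If the supports escape, there are \<open>F j\<close> in \<open>B\<close> not vanishing
  at points \<open>X j\<close> of norm above \<open>j\<close>, and this is detected by some
  \<open>Q j\<close> in \<open>N\<close>. The weights \<open>w j\<close> make the
  \<open>j\<close>-th term of the escaping seminorm equal to \<open>j\<close> at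
  \<open>F j\<close>.\<close>

lemma bounded_in_common_support:
  fixes S :: "'a::euclidean_space set \<Rightarrow> ('a \<Rightarrow> 'v::real_vector) topology"
  assumes sub: "subspace (\<Union>T\<in>{S K | K. compact K}. topspace T)"
    and supp: "\<And>K f x. f \<in> topspace (S K) \<Longrightarrow> x \<notin> K \<Longrightarrow> f x = 0"
    and V: "subspace V" "\<And>K f x. f \<in> topspace (S K) \<Longrightarrow> f x \<in> V"
    and N: "\<And>q. q \<in> N \<Longrightarrow> seminorm_on V q"
    and cont: "\<And>q x K. q \<in> N \<Longrightarrow> compact K \<Longrightarrow> continuous_map (S K) euclideanreal (\<lambda>f. q (f x))"
    and sep: "\<And>v. v \<in> V \<Longrightarrow> v \<noteq> 0 \<Longrightarrow> \<exists>q\<in>N. q v \<noteq> 0"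
    and B: "bounded_in (lc_ind_limit {S K | K. compact K}) B"
  shows "\<exists>K. compact K \<and> (\<forall>f\<in>B. \<forall>x. x \<notin> K \<longrightarrow> f x = 0)"
proof (rule ccontr)
  let ?TT = "{S K | K. compact K}"
  assume neg: "\<not> (\<exists>K. compact K \<and> (\<forall>f\<in>B. \<forall>x. x \<notin> K \<longrightarrow> f x = 0))"
  have BU: "B \<subseteq> (\<Union>T\<in>?TT. topspace T)" using B unfolding bounded_in_def topspace_lc_ind_limit by blast
  have "\<forall>j. \<exists>f x q. f \<in> B \<and> norm x > real j \<and> q \<in> N \<and> q (f x) \<noteq> 0"
  proof
    fix j
    obtain f x where fx: "f \<in> B" "x \<notin> cball 0 (real j)" "f x \<noteq> 0"
      using neg compact_cball[of "0::'a" "real j"] by blast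
    have "f \<in> (\<Union>T\<in>?TT. topspace T)" using BU fx(1) by blast
    then have "f x \<in> V" using V(2) by blast
    then obtain q where "q \<in> N" "q (f x) \<noteq> 0" using sep fx(3) by blast
    with fx show "\<exists>f x q. f \<in> B \<and> norm x > real j \<and> q \<in> N \<and> q (f x) \<noteq> 0"
      by (intro exI[of _ f] exI[of _ x] exI[of _ q]) simp
  qed
  then obtain F X Q where F: "\<And>j. F j \<in> B" and X: "\<And>j. norm (X j) > real j"
    and Q: "\<And>j. Q j \<in> N" "\<And>j. Q j (F j (X j)) \<noteq> 0" by metis
  define w where "w j = real j / Q j (F j (X j))" for j
  have FV: "F j x \<in> V" for j x
    using subsetD[OF BU F[of j]] V(2) by blast
  have pos: "Q j (F j (X j)) > 0" for j
    using seminorm_onD(1)[OF N[OF Q(1)] FV] Q(2) by (simp add: order_less_le)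
  have w: "w j \<ge> 0" for j using pos[of j] by (simp add: w_def)
  have "\<exists>p\<in>cont_seminorms (lc_ind_limit ?TT). \<forall>f\<in>topspace (lc_ind_limit ?TT). \<forall>j. w j * Q j (f (X j)) \<le> p f"
    by (rule escaping_seminorm[where V = V, OF sub])
      (erule supp, assumption, rule V(1), erule V(2), rule N[OF Q(1)], erule cont[OF Q(1)], rule X, rule w)
  then obtain p where p: "p \<in> cont_seminorms (lc_ind_limit ?TT)"
    "\<And>f j. f \<in> topspace (lc_ind_limit ?TT) \<Longrightarrow> w j * Q j (f (X j)) \<le> p f" by blast
  obtain C where C: "\<And>f. f \<in> B \<Longrightarrow> p f \<le> C"
    using B p(1) unfolding bounded_in_locally_convex[OF locally_convex_lc_ind_limit[OF sub]] by blast
  obtain j where j: "C < real j" using reals_Archimedean2 by blast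
  have "w j * Q j (F j (X j)) \<le> p (F j)"
    by (rule p(2)) (use subsetD[OF BU F[of j]] in simp)
  moreover have "w j * Q j (F j (X j)) = real j" using Q(2)[of j] by (simp add: w_def)
  ultimately show False using C[OF F[of j]] j by simp
qed

section \<open>Test functions with values in a locally convex space\<close>

lemma subspace_CinfK_carrier:
  assumes T: "separated_lc T"
  shows "subspace (CinfK_carrier K T)"
proof (rule subspaceI)
  show "0 \<in> CinfK_carrier K T"
    using smooth_into_zero(1)[OF T] by (simp add: CinfK_carrier_def zero_fun_def)
  show "f + g \<in> CinfK_carrier K T" if "f \<in> CinfK_carrier K T" "g \<in> CinfK_carrier K T" for f g
    using that smooth_into_add(1)[OF T, of f g] by (simp add: CinfK_carrier_def plus_fun_def)
  show "c *\<^sub>R f \<in> CinfK_carrier K T" if "f \<in> CinfK_carrier K T" for f c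
    using that smooth_into_scale(1)[OF T, where f = f and c = c] by (simp add: CinfK_carrier_def scaleR_fun_def)
qed

lemma iter_deriv_add_fun:
  assumes "separated_lc T" "smooth_into T f" "smooth_into T g"
  shows "iter_deriv T (f + g) vs x = iter_deriv T f vs x + iter_deriv T g vs x"
  using smooth_into_add(2)[OF assms, where vs = vs] by (simp add: plus_fun_def)

lemma iter_deriv_scale_fun:
  assumes "separated_lc T" "smooth_into T f"
  shows "iter_deriv T (c *\<^sub>R f) vs x = c *\<^sub>R iter_deriv T f vs x"
  using smooth_into_scale(2)[OF assms, where c = c and vs = vs] by (simp add: scaleR_fun_def)

lemma seminorm_iter_deriv_bdd:
  assumes T: "separated_lc T" and p: "p \<in> cont_seminorms T" and K: "compact K" and f: "f \<in> CinfK_carrier K T"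
  shows "bdd_above (range (\<lambda>x. p (iter_deriv T f vs x)))"
proof -
  have sm: "smooth_into T f" and off: "\<And>x. x \<notin> K \<Longrightarrow> f x = 0" using f by (auto simp: CinfK_carrier_def)
  have "continuous_map euclidean euclideanreal (\<lambda>x. p (iter_deriv T f vs x))"
    using continuous_map_compose[OF smooth_intoD(1)[OF sm] locally_convexD(4)[OF separated_lcD(1)[OF T] p]]
    by (simp only: o_def)
  then have "continuous_on K (\<lambda>x. p (iter_deriv T f vs x))"
    using continuous_on_subset by fastforce
  then have "bounded ((\<lambda>x. p (iter_deriv T f vs x)) ` K)"
    using K by (intro compact_imp_bounded compact_continuous_image)
  then obtain C where C: "\<And>x. x \<in> K \<Longrightarrow> \<bar>p (iter_deriv T f vs x)\<bar> \<le> C"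
    by (auto simp: bounded_iff)
  have "p (iter_deriv T f vs x) \<le> max C 0" for x
  proof (cases "x \<in> K")
    case True
    then show ?thesis using C[OF True] by linarith
  next
    case False
    then show ?thesis
      using iter_deriv_outside[where f = f and vs = vs, OF T compact_imp_closed[OF K] off False]
        seminorm_on_0[OF locally_convexD(3)[OF separated_lcD(1)[OF T] p] subspace_0[OF separated_lcD(2)[OF T]]]
      by simp
  qed
  then show ?thesis by (rule bdd_aboveI2)
qed

lemma seminorm_on_SUP_iter_deriv:
  fixes T :: "'v::real_vector topology" and V :: "('a::euclidean_space \<Rightarrow> 'v) set"
  assumes T: "separated_lc T" and p: "p \<in> cont_seminorms T" and V: "subspace V"
    and VC: "\<And>f. f \<in> V \<Longrightarrow> \<exists>K. compact K \<and> f \<in> CinfK_carrier K T"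
  shows "seminorm_on V (\<lambda>f. SUP x. p (iter_deriv T f vs x))"
proof (rule seminorm_on_SUP[OF _ _ _ V])
  have sm: "smooth_into T f" if "f \<in> V" for f using VC[OF that] by (auto simp: CinfK_carrier_def)
  show "seminorm_on V (\<lambda>f. p (iter_deriv T f vs x))" for x
    by (rule seminorm_on_linear[OF _ locally_convexD(3)[OF separated_lcD(1)[OF T] p]])
      (auto simp: linear_on_set_def iter_deriv_add_fun[OF T] iter_deriv_scale_fun[OF T] sm intro!: smooth_intoD(3))
  show "bdd_above (range (\<lambda>x. p (iter_deriv T f vs x)))" if f: "f \<in> V" for f
  proof -
    obtain K where "compact K" "f \<in> CinfK_carrier K T" using VC[OF f] by blast
    then show ?thesis by (rule seminorm_iter_deriv_bdd[OF T p])
  qed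
qed auto

lemma topspace_CinfK [simp]: "topspace (CinfK K T) = CinfK_carrier K T"
  by (simp add: CinfK_def)

lemma subspace_Union_CinfK:
  assumes T: "separated_lc T"
  shows "subspace (\<Union>S\<in>{CinfK K T | K. compact (K :: 'a::euclidean_space set)}. topspace S)"
  by (rule subspace_Union_compact) (auto simp: subspace_CinfK_carrier[OF T], auto simp: CinfK_carrier_def)

lemma CinfK_seminorm_on:
  assumes T: "separated_lc T" and K: "compact K"
  shows "q \<in> {\<lambda>f. SUP x. p (iter_deriv T f vs x) | p vs. p \<in> cont_seminorms T} \<Longrightarrow>
    seminorm_on (CinfK_carrier K T) q"
  using seminorm_on_SUP_iter_deriv[OF T _ subspace_CinfK_carrier[OF T, of K]] K by blast

lemma locally_convex_CinfK:
  assumes T: "separated_lc T" and K: "compact K"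
  shows "locally_convex (CinfK K T)"
  unfolding CinfK_def
  by (rule locally_convex_seminorm_topology[OF subspace_CinfK_carrier[OF T] CinfK_seminorm_on[OF T K]])

lemma locally_convex_Dspace:
  assumes T: "separated_lc T"
  shows "locally_convex (Dspace T :: ('a::euclidean_space \<Rightarrow> 'v::real_vector) topology)"
  unfolding Dspace_def by (rule locally_convex_lc_ind_limit[OF subspace_Union_CinfK[OF T]])

lemma topspace_Dspace: "f \<in> topspace (Dspace T) \<longleftrightarrow> (\<exists>K. compact K \<and> f \<in> CinfK_carrier K T)"
  unfolding Dspace_def by auto

text \<open>The same formula is a defining seminorm on every step, hence continuous on the limit;
  compact support keeps the supremum finite.\<close>

lemma Dspace_cont_seminorm:
  fixes T :: "'v::real_vector topology"
  assumes T: "separated_lc T" and p: "p \<in> cont_seminorms T"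
  shows "(\<lambda>f. SUP x. p (iter_deriv T f vs x)) \<in> cont_seminorms (Dspace T :: ('a::euclidean_space \<Rightarrow> 'v) topology)"
  unfolding Dspace_def
proof (rule lc_ind_limit_seminorm[OF subspace_Union_CinfK[OF T]])
  show "seminorm_on (\<Union>S\<in>{CinfK K T | K. compact (K :: 'a set)}. topspace S) (\<lambda>f. SUP x. p (iter_deriv T f vs x))"
    by (rule seminorm_on_SUP_iter_deriv[OF T p subspace_Union_CinfK[OF T]]) auto
  show "continuous_map S euclideanreal (\<lambda>f. SUP x. p (iter_deriv T f vs x))"
    if S: "S \<in> {CinfK K T | K. compact (K :: 'a set)}" for S
  proof -
    obtain K where K: "S = CinfK K T" "compact K" using S by blast
    show ?thesis
      unfolding K(1) CinfK_def
      by (rule continuous_map_seminorm[OF subspace_CinfK_carrier[OF T] _ CinfK_seminorm_on[OF T K(2)]]) (use p in blast)+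
  qed
qed

lemma Dspace_seminorm_le_SUP:
  assumes "separated_lc T" "p \<in> cont_seminorms T" "f \<in> topspace (Dspace T)"
  shows "p (iter_deriv T f vs x) \<le> (SUP x. p (iter_deriv T f vs x))"
proof -
  obtain K where "compact K" "f \<in> CinfK_carrier K T" using assms(3) unfolding topspace_Dspace by blast
  then have "bdd_above (range (\<lambda>x. p (iter_deriv T f vs x)))" by (rule seminorm_iter_deriv_bdd[OF assms(1,2)])
  then show ?thesis by (rule cSUP_upper[OF UNIV_I])
qed

lemma Dspace_eval_dual:
  fixes T :: "'v::real_vector topology" and x :: "'a::euclidean_space"
  assumes T: "separated_lc T" and l: "l \<in> dual_space T"
  shows "(\<lambda>f. l (iter_deriv T f vs x)) \<in> dual_space (Dspace T)"
proof (rule dual_spaceI[OF locally_convex_Dspace[OF T] _ Dspace_cont_seminorm[OF T dual_space_abs[OF l], of vs]])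
  have sm: "smooth_into T f" if "f \<in> topspace (Dspace T)" for f :: "'a \<Rightarrow> 'v"
    using that by (auto simp: topspace_Dspace CinfK_carrier_def)
  show "linear_on_set (topspace (Dspace T)) (\<lambda>f. l (iter_deriv T f vs x))"
    using sm by (auto simp: linear_on_set_def iter_deriv_add_fun[OF T] iter_deriv_scale_fun[OF T]
        linear_on_setD[OF dual_spaceD(1)[OF l]] smooth_intoD(3))
  show "\<bar>l (iter_deriv T f vs x)\<bar> \<le> (SUP x. \<bar>l (iter_deriv T f vs x)\<bar>)" if "f \<in> topspace (Dspace T)" for f :: "'a \<Rightarrow> 'v"
    by (rule Dspace_seminorm_le_SUP[OF T dual_space_abs[OF l] that])
qed

lemma separated_lc_Dspace:
  fixes T :: "'v::real_vector topology"
  assumes T: "separated_lc T"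
  shows "separated_lc (Dspace T :: ('a::euclidean_space \<Rightarrow> 'v) topology)"
  unfolding separated_lc_def
proof (intro conjI ballI impI locally_convex_Dspace[OF T])
  fix f :: "'a \<Rightarrow> 'v" assume f: "f \<in> topspace (Dspace T)" "f \<noteq> 0"
  then obtain x where x: "f x \<noteq> 0" by (auto simp: fun_eq_iff)
  have "f x \<in> topspace T"
    using f(1) by (auto simp: topspace_Dspace CinfK_carrier_def intro: smooth_into_in_topspace)
  then obtain l where l: "l \<in> dual_space T" "l (f x) \<noteq> 0" using T x unfolding separated_lc_def by blast
  then show "\<exists>l\<in>dual_space (Dspace T). l f \<noteq> 0"
    using Dspace_eval_dual[OF T l(1), of "[]" x] by (intro bexI[of _ "\<lambda>f. l (f x)"]) auto
qed

text \<open>The separating functionals supply the seminorms that detect nonzero values and force a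
  common support. A bounded set thus lies in one step and is bounded there, and the converse is
  continuity of the inclusion of that step.\<close>

lemma bounded_in_Dspace:
  fixes T :: "'v::real_vector topology" and B :: "('a::euclidean_space \<Rightarrow> 'v) set"
  assumes T: "separated_lc T"
  shows "bounded_in (Dspace T) B \<longleftrightarrow>
    (\<exists>K. compact K \<and> B \<subseteq> CinfK_carrier K T) \<and>
    (\<forall>p\<in>cont_seminorms T. \<forall>vs. \<exists>C. \<forall>f\<in>B. \<forall>x. p (iter_deriv T f vs x) \<le> C)" (is "?L \<longleftrightarrow> ?R")
proof
  assume L: ?L
  note b = L[unfolded bounded_in_locally_convex[OF locally_convex_Dspace[OF T]]]
  have "\<exists>K. compact K \<and> (\<forall>f\<in>B. \<forall>x. x \<notin> K \<longrightarrow> f x = 0)"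
  proof (rule bounded_in_common_support[OF subspace_Union_CinfK[OF T] _ separated_lcD(2)[OF T] _ _ _ _ L[unfolded Dspace_def],
        where N = "(\<lambda>l v. \<bar>l v\<bar>) ` dual_space T"])
    show "f x = 0" if "f \<in> topspace (CinfK K T)" "x \<notin> K" for f :: "'a \<Rightarrow> 'v" and x K
      using that by (simp add: CinfK_carrier_def)
    show "f x \<in> topspace T" if "f \<in> topspace (CinfK K T)" for f :: "'a \<Rightarrow> 'v" and x K
      using that by (simp add: CinfK_carrier_def smooth_into_in_topspace)
    show "seminorm_on (topspace T) q" if "q \<in> (\<lambda>l v. \<bar>l v\<bar>) ` dual_space T" for q
      using that dual_space_abs[of _ T] locally_convexD(3)[OF separated_lcD(1)[OF T]] by auto
    show "continuous_map (CinfK K T) euclideanreal (\<lambda>f. q (f x))"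
      if q: "q \<in> (\<lambda>l v. \<bar>l v\<bar>) ` dual_space T" and K: "compact K" for q and x :: 'a and K
    proof -
      obtain l where l: "l \<in> dual_space T" "q = (\<lambda>v. \<bar>l v\<bar>)" using q by blast
      have "(\<lambda>f. \<bar>l (iter_deriv T f [] x)\<bar>) \<in> cont_seminorms (CinfK K T)"
      proof (rule cont_seminorms_lc_ind_limitD[OF subspace_Union_CinfK[OF T] _ locally_convex_CinfK[OF T K]])
        show "(\<lambda>f. \<bar>l (iter_deriv T f [] x)\<bar>) \<in> cont_seminorms (lc_ind_limit {CinfK K T | K. compact K})"
          using dual_space_abs[OF Dspace_eval_dual[OF T l(1), of "[]" x]] unfolding Dspace_def .
      qed (use K in blast)
      then show ?thesis by (simp add: cont_seminorms_def l(2))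
    qed
    show "\<exists>q\<in>(\<lambda>l v. \<bar>l v\<bar>) ` dual_space T. q v \<noteq> 0" if "v \<in> topspace T" "v \<noteq> 0" for v
      using T that unfolding separated_lc_def by auto
  qed
  then obtain K where K: "compact K" "\<And>f x. f \<in> B \<Longrightarrow> x \<notin> K \<Longrightarrow> f x = 0" by blast
  have BT: "B \<subseteq> topspace (Dspace T)" using b by blast
  then have "B \<subseteq> CinfK_carrier K T"
    using K(2) by (fastforce simp: CinfK_carrier_def topspace_Dspace)
  moreover have "\<exists>C. \<forall>f\<in>B. \<forall>x. p (iter_deriv T f vs x) \<le> C" if p: "p \<in> cont_seminorms T" for p vs
  proof -
    obtain C where C: "\<And>f. f \<in> B \<Longrightarrow> (SUP x. p (iter_deriv T f vs x)) \<le> C"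
      using bspec[OF conjunct2[OF b] Dspace_cont_seminorm[OF T p, of vs]] by auto
    have "p (iter_deriv T f vs x) \<le> C" if f: "f \<in> B" for f x
      using Dspace_seminorm_le_SUP[OF T p subsetD[OF BT f], of vs x] C[OF f] by linarith
    then show ?thesis by blast
  qed
  ultimately show ?R using K(1) by blast
next
  assume R: ?R
  then obtain K where K: "compact K" "B \<subseteq> CinfK_carrier K T" by blast
  have "bounded_in (CinfK K T) B"
    unfolding CinfK_def
  proof (rule bounded_in_seminorm_topology[THEN iffD2, OF subspace_CinfK_carrier[OF T] CinfK_seminorm_on[OF T K(1)]])
    show "B \<subseteq> CinfK_carrier K T \<and> (\<forall>q\<in>{\<lambda>f. SUP x. p (iter_deriv T f vs x) | p vs. p \<in> cont_seminorms T}.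
        \<exists>C. \<forall>f\<in>B. q f \<le> C)"
    proof (intro conjI ballI K(2))
      fix q assume "q \<in> {\<lambda>f::'a \<Rightarrow> 'v. SUP x. p (iter_deriv T f vs x) | p vs. p \<in> cont_seminorms T}"
      then obtain p vs where q: "p \<in> cont_seminorms T" "q = (\<lambda>f. SUP x. p (iter_deriv T f vs x))" by blast
      obtain C where C: "\<And>f x. f \<in> B \<Longrightarrow> p (iter_deriv T f vs x) \<le> C" using R q(1) by blast
      have "q f \<le> C" if "f \<in> B" for f unfolding q(2) using C[OF that] by (intro cSUP_least) auto
      then show "\<exists>C. \<forall>f\<in>B. q f \<le> C" by blast
    qed
  qed
  then show ?L
    unfolding Dspace_def
    by (intro bounded_in_lc_ind_limit_step[OF subspace_Union_CinfK[OF T] _ locally_convex_CinfK[OF T K(1)]])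
      (use K(1) in blast)
qed

section \<open>Weight sequences and growth of derivatives\<close>

definition unit_vectors :: "'a::real_normed_vector list \<Rightarrow> bool" where
  "unit_vectors vs \<longleftrightarrow> (\<forall>v\<in>set vs. norm v \<le> 1)"

lemma unit_vectors_simps [simp]:
  "unit_vectors []" "unit_vectors (v # vs) \<longleftrightarrow> norm v \<le> 1 \<and> unit_vectors vs"
  "unit_vectors (us @ vs) \<longleftrightarrow> unit_vectors us \<and> unit_vectors vs"
  by (auto simp: unit_vectors_def)

text \<open>Uniform bounds on a set of functions are expressed by letting its members share one
  sequence \<open>a\<close>, in which the constants and \<rho> are hidden.\<close>

definition dominated :: "(nat \<Rightarrow> real) \<Rightarrow> ('a::euclidean_space \<Rightarrow> 'b::euclidean_space) \<Rightarrow> bool" where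
  "dominated a f \<longleftrightarrow> smooth_into euclidean f \<and>
     (\<forall>vs x. unit_vectors vs \<longrightarrow> norm (iter_deriv euclidean f vs x) \<le> a (length vs))"

lemma dominatedD:
  assumes "dominated a f"
  shows "smooth_into euclidean f"
    and "unit_vectors vs \<Longrightarrow> norm (iter_deriv euclidean f vs x) \<le> a (length vs)"
  using assms by (simp_all add: dominated_def)

lemma dominated_mono: "dominated a f \<Longrightarrow> (\<And>k. a k \<le> b k) \<Longrightarrow> dominated b f"
  unfolding dominated_def by (meson order_trans)

definition weight_fact :: "(nat \<Rightarrow> real) \<Rightarrow> nat \<Rightarrow> real" where
  "weight_fact M k = fact k * M k"

fun for_rho :: "ultra_case \<Rightarrow> (real \<Rightarrow> bool) \<Rightarrow> bool" where
  "for_rho Beurling P \<longleftrightarrow> (\<forall>\<rho>>0. P \<rho>)"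
| "for_rho Roumieu P \<longleftrightarrow> (\<exists>\<rho>>0. P \<rho>)"

text \<open>The quantifier opposite to \<open>for_rho\<close>: an estimate holding in the sense of
  the one and a weight condition holding in the sense of the other have a \<rho> in common.\<close>

fun for_rho_dual :: "ultra_case \<Rightarrow> (real \<Rightarrow> bool) \<Rightarrow> bool" where
  "for_rho_dual Beurling P \<longleftrightarrow> (\<exists>\<rho>>0. P \<rho>)"
| "for_rho_dual Roumieu P \<longleftrightarrow> (\<forall>\<rho>>0. P \<rho>)"

lemma for_rho_and_dual: "for_rho s P \<Longrightarrow> for_rho_dual s R \<Longrightarrow> \<exists>\<rho>>0. P \<rho> \<and> R \<rho>"
  by (cases s) auto

lemma for_rho_cong: "(\<And>\<rho>. \<rho> > 0 \<Longrightarrow> P \<rho> \<longleftrightarrow> R \<rho>) \<Longrightarrow> for_rho s P \<longleftrightarrow> for_rho s R"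
  by (cases s) auto

lemma for_rho_mono: "for_rho s P \<Longrightarrow> (\<And>\<rho>. \<rho> > 0 \<Longrightarrow> P \<rho> \<Longrightarrow> R \<rho>) \<Longrightarrow> for_rho s R"
  by (cases s) auto

lemma for_rho_ex: "for_rho s P \<Longrightarrow> \<exists>\<rho>>0. P \<rho>"
  by (cases s) (auto intro: zero_less_one)

definition ultra_seq :: "ultra_case \<Rightarrow> (nat \<Rightarrow> real) \<Rightarrow> (nat \<Rightarrow> real) \<Rightarrow> bool" where
  "ultra_seq s M a \<longleftrightarrow> for_rho s (\<lambda>\<rho>. \<exists>C. \<forall>k. a k \<le> C * \<rho> ^ k * weight_fact M k)"

text \<open>Weights that witness the failure of a growth estimate: the \<rho> at which it fails in
  the Beurling case, a sequence overtaking every \<rho> in the Roumieu case.\<close>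

fun test_seq :: "ultra_case \<Rightarrow> (nat \<Rightarrow> real) \<Rightarrow> bool" where
  "test_seq Beurling \<sigma> \<longleftrightarrow> (\<exists>\<rho>>0. \<sigma> = (\<lambda>_. \<rho>))"
| "test_seq Roumieu \<sigma> \<longleftrightarrow> \<sigma> = (\<lambda>n. real n + 1)"

lemma test_seq_pos: "test_seq s \<sigma> \<Longrightarrow> \<sigma> n > 0"
  by (cases s) auto

text \<open>Admissible weights: derivatives of order \<open>k i\<close>, divided by
  \<open>\<sigma> i ^ k i * weight_fact M (k i)\<close>, stay bounded in \<open>i\<close> for each
  function of the class. The index type is free, so that sequences of derivatives and one derivative
  at all points are both covered.\<close>

definition test_weights :: "ultra_case \<Rightarrow> ('i \<Rightarrow> real) \<Rightarrow> ('i \<Rightarrow> nat) \<Rightarrow> bool" where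
  "test_weights s \<sigma> k \<longleftrightarrow> (\<forall>i. \<sigma> i > 0) \<and> for_rho_dual s (\<lambda>\<rho>. \<exists>C. \<forall>i. \<rho> ^ k i \<le> C * \<sigma> i ^ k i)"

lemma test_weights_pos: "test_weights s \<sigma> k \<Longrightarrow> \<sigma> i > 0"
  by (simp add: test_weights_def)

lemma test_weights_const: "test_weights s (\<lambda>_. 1) (\<lambda>_. k)"
  unfolding test_weights_def by (cases s) (auto intro: zero_less_one)

lemma test_seq_weights:
  assumes "test_seq s \<sigma>"
  shows "test_weights s \<sigma> k"
proof (cases s)
  case Beurling
  then obtain \<rho> where "\<rho> > 0" "\<sigma> = (\<lambda>_. \<rho>)" using assms by auto
  then show ?thesis unfolding Beurling test_weights_def for_rho_dual.simps
    by (intro conjI exI[of _ \<rho>] exI[of _ 1]) auto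
next
  case Roumieu
  then have \<sigma>: "\<And>n. \<sigma> n = real n + 1" using assms by simp
  have "\<exists>C. \<forall>n. \<rho> ^ k n \<le> C * \<sigma> n ^ k n" if \<rho>: "\<rho> > 0" for \<rho>
  proof -
    obtain N where N: "\<rho> \<le> real N" using real_arch_simple by blast
    let ?b = "\<lambda>n. \<rho> ^ k n / \<sigma> n ^ k n"
    have pos: "\<sigma> n ^ k n > 0" for n by (simp add: \<sigma>)
    have b: "?b n \<ge> 0" for n using pos[of n] \<rho> by simp
    \<comment> \<open>From \<open>N\<close> on the weight \<open>n + 1\<close> exceeds \<rho> and
      the ratio is at most 1, whatever the order; the finitely many earlier ratios are summed into
      the constant.\<close>
    have "?b n \<le> 1 + (\<Sum>i<N. ?b i)" for n
    proof (cases "n < N")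
      case True
      then have "?b n \<le> (\<Sum>i<N. ?b i)" using b by (intro member_le_sum) auto
      then show ?thesis by linarith
    next
      case False
      then have "\<rho> ^ k n \<le> \<sigma> n ^ k n" using N \<rho> by (intro power_mono) (auto simp: \<sigma>)
      then have "?b n \<le> 1" using pos[of n] by simp
      then show ?thesis using sum_nonneg[of "{..<N}" ?b] b by fastforce
    qed
    then show ?thesis using pos by (simp add: pos_divide_le_eq) blast
  qed
  then show ?thesis unfolding Roumieu test_weights_def by (simp add: \<sigma>)
qed

text \<open>In the Roumieu case the \<open>n\<close>-th index is a counterexample for \<rho> = n + 1
  and C = n simultaneously, so that one sequence defeats every pair of constants.\<close>

lemma not_for_rho_test_seq:
  assumes "\<not> for_rho s (\<lambda>\<rho>. \<exists>C. \<forall>i\<in>I. \<phi> i \<le> C * \<rho> ^ \<kappa> i * weight_fact M (\<kappa> i))"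
  shows "\<exists>\<sigma> \<iota>. test_seq s \<sigma> \<and> (\<forall>n. \<iota> n \<in> I \<and> \<phi> (\<iota> n) > real n * \<sigma> n ^ \<kappa> (\<iota> n) * weight_fact M (\<kappa> (\<iota> n)))"
proof -
  have "\<exists>\<sigma>. test_seq s \<sigma> \<and> (\<forall>n. \<exists>i. i \<in> I \<and> \<phi> i > real n * \<sigma> n ^ \<kappa> i * weight_fact M (\<kappa> i))"
  proof (cases s)
    case Beurling
    then obtain \<rho> where "\<rho> > 0" "\<And>C. \<exists>i\<in>I. \<phi> i > C * \<rho> ^ \<kappa> i * weight_fact M (\<kappa> i)"
      using assms by (auto simp: not_le)
    then show ?thesis using Beurling by (intro exI[of _ "\<lambda>_. \<rho>"]) auto
  next
    case Roumieu
    then have *: "\<And>\<rho> C. \<rho> > 0 \<Longrightarrow> \<exists>i\<in>I. \<phi> i > C * \<rho> ^ \<kappa> i * weight_fact M (\<kappa> i)"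
      using assms by (auto simp: not_le)
    have "\<exists>i. i \<in> I \<and> \<phi> i > real n * (real n + 1) ^ \<kappa> i * weight_fact M (\<kappa> i)" for n
      using *[of "real n + 1" "real n"] by auto
    then show ?thesis using Roumieu by (intro exI[of _ "\<lambda>n. real n + 1"]) auto
  qed
  then show ?thesis by metis
qed

lemma ultra_seq_mono:
  assumes "ultra_seq s M b" and "\<And>k. a k \<le> b k"
  shows "ultra_seq s M a"
  using assms(1) unfolding ultra_seq_def
  by (rule for_rho_mono) (use assms(2) in \<open>meson order_trans\<close>)

context
  fixes M :: "nat \<Rightarrow> real"
  assumes M: "weight_sequence M"
begin

lemma weight_fact_pos: "weight_fact M k > 0"
  using M by (simp add: weight_fact_def weight_sequence_def)

lemma weight_fact_0: "weight_fact M 0 = 1"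
  using M by (simp add: weight_fact_def weight_sequence_def)

text \<open>With a negative \<open>C\<close> the bound would decrease as \<rho> grows; passing to
  \<open>max C 0\<close> makes it safe to enlarge \<rho>.\<close>

lemma bound_nonneg_const:
  assumes "\<And>i. i \<in> I \<Longrightarrow> \<phi> i \<le> C * \<rho> ^ \<kappa> i * weight_fact M (\<kappa> i)" and "\<rho> > 0" "\<rho> \<le> \<sigma>"
  shows "i \<in> I \<Longrightarrow> \<phi> i \<le> max C 0 * \<sigma> ^ \<kappa> i * weight_fact M (\<kappa> i)"
proof -
  assume i: "i \<in> I"
  have "\<phi> i \<le> C * \<rho> ^ \<kappa> i * weight_fact M (\<kappa> i)" using assms(1)[OF i] .
  also have "\<dots> \<le> max C 0 * \<rho> ^ \<kappa> i * weight_fact M (\<kappa> i)"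
    using assms(2) weight_fact_pos[of "\<kappa> i"] by (intro mult_right_mono) auto
  also have "\<dots> \<le> max C 0 * \<sigma> ^ \<kappa> i * weight_fact M (\<kappa> i)"
    using assms(2,3) weight_fact_pos[of "\<kappa> i"] by (intro mult_right_mono mult_left_mono power_mono) auto
  finally show ?thesis .
qed

text \<open>The quantifier over \<rho> is absorbed into one sequence: the supremum of
  \<open>\<phi>\<close> over the indices of order \<open>k\<close> inherits every estimate that
  \<open>\<phi>\<close> satisfies, and in the Beurling case it thereby serves all \<rho> at once.
  The value 0 at orders that do not occur is harmless because constants can be made
  nonnegative.\<close>

lemma ex_ultra_seq_iff:
  "(\<exists>a. ultra_seq s M a \<and> (\<forall>i\<in>I. \<phi> i \<le> a (\<kappa> i))) \<longleftrightarrow>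
   for_rho s (\<lambda>\<rho>. \<exists>C. \<forall>i\<in>I. \<phi> i \<le> C * \<rho> ^ \<kappa> i * weight_fact M (\<kappa> i))" (is "?L \<longleftrightarrow> ?R")
proof
  assume ?L
  then obtain a where a: "ultra_seq s M a" "\<And>i. i \<in> I \<Longrightarrow> \<phi> i \<le> a (\<kappa> i)" by blast
  show ?R
    using a(1) unfolding ultra_seq_def by (rule for_rho_mono) (use a(2) in \<open>meson order_trans\<close>)
next
  assume R: ?R
  define a where "a k = (if \<exists>i\<in>I. \<kappa> i = k then SUP i\<in>{i\<in>I. \<kappa> i = k}. \<phi> i else 0)" for k
  have up: "a k \<le> max C 0 * \<rho> ^ k * weight_fact M k"
    if C: "\<forall>i\<in>I. \<phi> i \<le> C * \<rho> ^ \<kappa> i * weight_fact M (\<kappa> i)" and \<rho>: "\<rho> > 0" for \<rho> C k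
  proof -
    have "\<phi> i \<le> max C 0 * \<rho> ^ k * weight_fact M k" if "i \<in> I" "\<kappa> i = k" for i
      using bound_nonneg_const[of I \<phi> C \<rho> \<kappa> \<rho>] C \<rho> that by auto
    then show ?thesis
      unfolding a_def using weight_fact_pos[of k] \<rho> by (auto intro!: cSUP_least)
  qed
  have "ultra_seq s M a"
    using R unfolding ultra_seq_def by (rule for_rho_mono) (use up in blast)
  moreover have "\<phi> i \<le> a (\<kappa> i)" if i: "i \<in> I" for i
  proof -
    obtain \<rho> C where \<rho>: "\<rho> > 0" "\<forall>i\<in>I. \<phi> i \<le> C * \<rho> ^ \<kappa> i * weight_fact M (\<kappa> i)"
      using for_rho_ex[OF R] by blast
    have "bdd_above (\<phi> ` {j \<in> I. \<kappa> j = \<kappa> i})"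
      by (rule bdd_aboveI2[of _ _ "C * \<rho> ^ \<kappa> i * weight_fact M (\<kappa> i)"]) (use \<rho>(2) in fastforce)
    then show ?thesis unfolding a_def using i by (auto intro!: cSUP_upper)
  qed
  ultimately show ?L by blast
qed

lemma ultra_seq_add:
  assumes "ultra_seq s M a" "ultra_seq s M b"
  shows "ultra_seq s M (\<lambda>k. a k + b k)"
proof -
  have one: "\<exists>C. \<forall>k. a k + b k \<le> C * \<rho> ^ k * weight_fact M k"
    if "\<forall>k. a k \<le> C1 * \<rho>1 ^ k * weight_fact M k" "\<forall>k. b k \<le> C2 * \<rho>2 ^ k * weight_fact M k"
      "\<rho>1 > 0" "\<rho>2 > 0" "\<rho>1 \<le> \<rho>" "\<rho>2 \<le> \<rho>" for \<rho> \<rho>1 \<rho>2 C1 C2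
  proof (intro exI allI)
    fix k
    show "a k + b k \<le> (max C1 0 + max C2 0) * \<rho> ^ k * weight_fact M k"
      using bound_nonneg_const[of UNIV a C1 \<rho>1 "\<lambda>k. k" \<rho> k] bound_nonneg_const[of UNIV b C2 \<rho>2 "\<lambda>k. k" \<rho> k] that
      by (simp add: distrib_right)
  qed
  show ?thesis
  proof (cases s)
    case Beurling
    show ?thesis using assms one unfolding Beurling ultra_seq_def for_rho.simps by (meson order_refl)
  next
    case Roumieu
    then obtain \<rho>1 \<rho>2 C1 C2 where *: "\<forall>k. a k \<le> C1 * \<rho>1 ^ k * weight_fact M k" "\<forall>k. b k \<le> C2 * \<rho>2 ^ k * weight_fact M k"
      "\<rho>1 > 0" "\<rho>2 > 0" using assms unfolding ultra_seq_def by auto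
    have "\<exists>C. \<forall>k. a k + b k \<le> C * (max \<rho>1 \<rho>2) ^ k * weight_fact M k"
      by (rule one[OF *]) auto
    then show ?thesis using *(3) Roumieu unfolding ultra_seq_def
      by (simp only: for_rho.simps) (rule exI[of _ "max \<rho>1 \<rho>2"], rule conjI, simp_all)
  qed
qed

lemma ultra_seq_scale:
  assumes "ultra_seq s M a" "c \<ge> 0"
  shows "ultra_seq s M (\<lambda>k. c * a k)"
  using assms(1) unfolding ultra_seq_def
proof (rule for_rho_mono)
  fix \<rho> assume "\<exists>C. \<forall>k. a k \<le> C * \<rho> ^ k * weight_fact M k"
  then obtain C where C: "\<And>k. a k \<le> C * \<rho> ^ k * weight_fact M k" by blast
  have "c * a k \<le> (c * C) * \<rho> ^ k * weight_fact M k" for k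
    using mult_left_mono[OF C[of k] assms(2)] by (simp add: mult.assoc)
  then show "\<exists>C. \<forall>k. c * a k \<le> C * \<rho> ^ k * weight_fact M k" by blast
qed

lemma ultra_seq_zero: "ultra_seq s M (\<lambda>k. 0)"
proof -
  have "\<exists>C. \<forall>k. (0::real) \<le> C * \<rho> ^ k * weight_fact M k" for \<rho> by (rule exI[of _ 0]) simp
  then show ?thesis unfolding ultra_seq_def by (cases s) (auto intro: zero_less_one)
qed

lemma ultra_seq_sum:
  "finite I \<Longrightarrow> (\<And>i. i \<in> I \<Longrightarrow> ultra_seq s M (a i)) \<Longrightarrow> ultra_seq s M (\<lambda>k. \<Sum>i\<in>I. a i k)"
  by (induction I rule: finite_induct) (auto simp: ultra_seq_zero ultra_seq_add)

lemma ultra_seq_power_2: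
  assumes "ultra_seq s M a"
  shows "ultra_seq s M (\<lambda>k. 2 ^ k * a k)"
proof -
  have one: "\<exists>C. \<forall>k. 2 ^ k * a k \<le> C * (2 * \<rho>) ^ k * weight_fact M k"
    if C: "\<forall>k. a k \<le> C * \<rho> ^ k * weight_fact M k" for \<rho> C
  proof (intro exI allI)
    fix k
    have "2 ^ k * a k \<le> 2 ^ k * (C * \<rho> ^ k * weight_fact M k)" by (rule mult_left_mono) (use C in auto)
    then show "2 ^ k * a k \<le> C * (2 * \<rho>) ^ k * weight_fact M k" by (simp add: power_mult_distrib mult_ac)
  qed
  show ?thesis
  proof (cases s)
    case Beurling
    have "\<exists>C. \<forall>k. 2 ^ k * a k \<le> C * \<rho> ^ k * weight_fact M k" if \<rho>: "\<rho> > 0" for \<rho>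
    proof -
      have "\<rho> / 2 > 0" using \<rho> by simp
      then obtain C where "\<forall>k. a k \<le> C * (\<rho> / 2) ^ k * weight_fact M k"
        using assms unfolding Beurling ultra_seq_def for_rho.simps by blast
      from one[OF this] show ?thesis by simp
    qed
    then show ?thesis unfolding Beurling ultra_seq_def for_rho.simps by blast
  next
    case Roumieu
    then obtain \<rho> C where "\<rho> > 0" "\<forall>k. a k \<le> C * \<rho> ^ k * weight_fact M k"
      using assms unfolding ultra_seq_def by auto
    with one[OF this(2)] show ?thesis
      unfolding Roumieu ultra_seq_def for_rho.simps by (intro exI[of _ "2 * \<rho>"]) auto
  qed
qed

lemma ultra_seq_test_weights:
  assumes a: "ultra_seq s M a" and \<sigma>: "test_weights s \<sigma> k"
  shows "\<exists>C. \<forall>i. a (k i) \<le> C * \<sigma> i ^ k i * weight_fact M (k i)"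
proof -
  obtain \<rho> C D where \<rho>: "\<rho> > 0" "\<And>j. a j \<le> C * \<rho> ^ j * weight_fact M j" "\<And>i. \<rho> ^ k i \<le> D * \<sigma> i ^ k i"
    using for_rho_and_dual[OF a[unfolded ultra_seq_def] conjunct2[OF \<sigma>[unfolded test_weights_def]]] by blast
  have "a (k i) \<le> max C 0 * D * \<sigma> i ^ k i * weight_fact M (k i)" for i
  proof -
    have "a (k i) \<le> max C 0 * \<rho> ^ k i * weight_fact M (k i)"
      using bound_nonneg_const[of UNIV a C \<rho> "\<lambda>k. k" \<rho> "k i"] \<rho>(1,2) by auto
    also have "\<dots> \<le> max C 0 * (D * \<sigma> i ^ k i) * weight_fact M (k i)"
      using \<rho>(3)[of i] weight_fact_pos[of "k i"] by (intro mult_right_mono mult_left_mono) auto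
    finally show ?thesis by (simp only: mult.assoc)
  qed
  then show ?thesis by blast
qed

end

section \<open>Consequences of moderate growth and of log-convexity\<close>

text \<open>\<open>H = 2 * B\<close>, where \<open>B\<close> bounds the roots in the definition of
  moderate growth and the 2 comes from the binomial coefficient, through
  \<open>fact (j + k) \<le> 2 ^ (j + k) * (fact j * fact k)\<close>. Order 0, absent from that
  supremum, is covered by \<open>M 0 = 1\<close> and \<open>B \<ge> 1\<close>.\<close>

lemma moderate_growth_bound:
  assumes M: "weight_sequence M" and mg: "moderate_growth M"
  shows "\<exists>H\<ge>1. \<forall>j k. weight_fact M (j + k) \<le> H ^ (j + k) * weight_fact M j * weight_fact M k"
proof -
  have pos: "M k > 0" and M0: "M 0 = 1" for k using M by (auto simp: weight_sequence_def)
  obtain A where A: "\<And>j k. 1 \<le> j \<Longrightarrow> 1 \<le> k \<Longrightarrow> (M (j + k) / (M j * M k)) powr (1 / real (j + k)) \<le> A"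
    using mg unfolding moderate_growth_def bdd_above_def by blast
  define B where "B = max A 1"
  have B: "B \<ge> 1" by (simp add: B_def)
  have MB: "M (j + k) \<le> B ^ (j + k) * (M j * M k)" for j k
  proof (cases "1 \<le> j \<and> 1 \<le> k")
    case True
    define r where "r = M (j + k) / (M j * M k)"
    have r: "r > 0" using pos by (simp add: r_def)
    have "r powr (1 / real (j + k)) \<le> B" using A[of j k] True by (simp add: r_def B_def)
    then have "(r powr (1 / real (j + k))) ^ (j + k) \<le> B ^ (j + k)" by (intro power_mono) auto
    also have "(r powr (1 / real (j + k))) ^ (j + k) = r"
      using r True by (simp add: powr_powr flip: powr_realpow)
    finally show ?thesis using pos[of j] pos[of k] by (simp add: r_def field_simps)
  next
    case False
    then have "j = 0 \<or> k = 0" by auto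
    then show ?thesis using mult_right_mono[OF one_le_power[OF B, of "j + k"], of "M (j + k)"] pos[of "j + k"] M0
      by (auto simp: less_imp_le)
  qed
  have "weight_fact M (j + k) \<le> (2 * B) ^ (j + k) * weight_fact M j * weight_fact M k" for j k
  proof -
    have "(j + k) choose j \<le> 2 ^ (j + k)" by (rule binomial_le_pow2)
    then have "real ((j + k) choose j) \<le> 2 ^ (j + k)" by (metis of_nat_le_iff of_nat_numeral of_nat_power)
    moreover have "real ((j + k) choose j) = fact (j + k) / (fact j * fact k)"
      using binomial_fact[of j "j + k", where 'a = real] by simp
    ultimately have f: "fact (j + k) \<le> (2 ^ (j + k) * (fact j * fact k) :: real)" by (simp add: field_simps)
    have "fact (j + k) * M (j + k) \<le> (2 ^ (j + k) * (fact j * fact k)) * (B ^ (j + k) * (M j * M k))"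
      using f MB[of j k] pos[of "j + k"] by (intro mult_mono) (auto simp: less_imp_le)
    then show ?thesis by (simp add: weight_fact_def power_mult_distrib mult_ac)
  qed
  then show ?thesis using B by (intro exI[of _ "2 * B"]) auto
qed

text \<open>Log-convexity makes the ratios of successive weights nondecreasing; \<open>step\<close>
  says so without division. As the weight of order 0 is 1, the weight of order \<open>k\<close> is a
  product of the first \<open>k\<close> ratios and hence at most the product of \<open>k\<close>
  later ones.\<close>

lemma weight_fact_supermult:
  assumes M: "weight_sequence M" and lc: "weakly_log_convex M"
  shows "weight_fact M j * weight_fact M k \<le> weight_fact M (j + k)"
proof -
  let ?w = "weight_fact M"
  note pos = weight_fact_pos[OF M]
  have lc: "(?w (Suc i))\<^sup>2 \<le> ?w i * ?w (Suc (Suc i))" for i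
    using lc by (simp add: weakly_log_convex_def log_convex_seq_def weight_fact_def)
  have step: "?w (Suc i) * ?w (k + i) \<le> ?w i * ?w (Suc (k + i))" for i k
  proof (induction k)
    case (Suc k)
    have "?w (k + i) * (?w (Suc i) * ?w (Suc (k + i))) \<le> (?w i * ?w (Suc (k + i))) * ?w (Suc (k + i))"
      using mult_right_mono[OF Suc, of "?w (Suc (k + i))"] pos[of "Suc (k + i)"] by (simp add: mult_ac)
    also have "\<dots> = ?w i * (?w (Suc (k + i)))\<^sup>2" by (simp add: power2_eq_square mult_ac)
    also have "\<dots> \<le> ?w i * (?w (k + i) * ?w (Suc (Suc (k + i))))" using lc pos[of i] by (intro mult_left_mono) (auto simp: less_imp_le)
    also have "\<dots> = ?w (k + i) * (?w i * ?w (Suc (Suc (k + i))))" by (simp add: mult_ac)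
    finally show ?case using pos[of "k + i"] by simp
  qed simp
  show ?thesis
  proof (induction k)
    case 0
    then show ?case using weight_fact_0[OF M] by simp
  next
    case (Suc k)
    have "?w k * (?w j * ?w (Suc k)) = (?w j * ?w k) * ?w (Suc k)" by (simp add: mult_ac)
    also have "\<dots> \<le> ?w (j + k) * ?w (Suc k)" using Suc pos[of "Suc k"] by (intro mult_right_mono) (auto simp: less_imp_le)
    also have "\<dots> \<le> ?w k * ?w (Suc (j + k))" using step[of k j] by (simp add: mult_ac)
    finally show ?case using pos[of k] by simp
  qed
qed

text \<open>Moderate growth splits the bound of order \<open>j + k\<close> at the price of a factor
  \<open>H\<close> in each variable. In the Roumieu case \<open>\<sigma> * H\<close> serves both
  variables. In the Beurling case \<open>\<rho>\<close> is fixed for the second variable while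
  \<open>b\<close> must still obey every \<open>\<tau>\<close>; so \<open>b j\<close> is taken as
  the supremum over \<open>k\<close> of
  \<open>a (j + k) / (\<rho> ^ k * weight_fact M k)\<close>.\<close>

lemma ultra_seq_split:
  assumes M: "weight_sequence M" and mg: "moderate_growth M" and a: "ultra_seq s M a"
  shows "for_rho s (\<lambda>\<rho>. \<exists>b. ultra_seq s M b \<and> (\<forall>j k. a (j + k) \<le> b j * (\<rho> ^ k * weight_fact M k)))"
proof -
  note pos = weight_fact_pos[OF M]
  obtain H where H: "H \<ge> 1" "\<And>j k. weight_fact M (j + k) \<le> H ^ (j + k) * weight_fact M j * weight_fact M k"
    using moderate_growth_bound[OF M mg] by blast
  have one: "a (j + k) \<le> max C 0 * \<tau> ^ j * weight_fact M j * (\<rho> ^ k * weight_fact M k)"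
    if C: "\<forall>k. a k \<le> C * \<sigma> ^ k * weight_fact M k" and \<sigma>: "\<sigma> > 0" "\<sigma> * H \<le> \<rho>" "\<sigma> * H \<le> \<tau>" for C \<sigma> \<rho> \<tau> j k
  proof -
    have "0 < \<sigma> * H" using \<sigma>(1) H(1) by simp
    then have \<tau>: "0 < \<tau>" "0 < \<rho>" using \<sigma>(2,3) by linarith+
    have "a (j + k) \<le> max C 0 * \<sigma> ^ (j + k) * weight_fact M (j + k)"
      using bound_nonneg_const[OF M, of UNIV a C \<sigma> "\<lambda>k. k" \<sigma> "j + k"] C \<sigma> by auto
    also have "\<dots> \<le> max C 0 * \<sigma> ^ (j + k) * (H ^ (j + k) * weight_fact M j * weight_fact M k)"
      using H(2) \<sigma>(1) by (intro mult_left_mono) auto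
    also have "\<dots> = max C 0 * ((\<sigma> * H) ^ j * (\<sigma> * H) ^ k) * (weight_fact M j * weight_fact M k)"
      by (simp add: power_mult_distrib power_add mult_ac)
    also have "\<dots> \<le> max C 0 * (\<tau> ^ j * \<rho> ^ k) * (weight_fact M j * weight_fact M k)"
      using \<sigma> \<tau> H(1) pos[of j] pos[of k]
      by (intro mult_right_mono mult_left_mono mult_mono power_mono) (auto simp: less_imp_le)
    finally show ?thesis by (simp add: mult_ac)
  qed
  show ?thesis
  proof (cases s)
    case Beurling
    have "\<exists>b. ultra_seq s M b \<and> (\<forall>j k. a (j + k) \<le> b j * (\<rho> ^ k * weight_fact M k))" if \<rho>: "\<rho> > 0" for \<rho>
    proof -
      let ?\<phi> = "\<lambda>(j, k). a (j + k) / (\<rho> ^ k * weight_fact M k)"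
      have p: "\<rho> ^ k * weight_fact M k > 0" for k using \<rho> pos by simp
      have "for_rho s (\<lambda>\<tau>. \<exists>C. \<forall>i\<in>UNIV. ?\<phi> i \<le> C * \<tau> ^ fst i * weight_fact M (fst i))"
        unfolding Beurling for_rho.simps
      proof (intro allI impI)
        fix \<tau> :: real assume \<tau>: "\<tau> > 0"
        \<comment> \<open>Small enough that both \<open>\<rho>\<close> and \<open>\<tau>\<close> are
          respected after the loss of the factor \<open>H\<close>.\<close>
        define \<sigma> where "\<sigma> = min \<rho> \<tau> / H"
        have \<sigma>: "\<sigma> > 0" "\<sigma> * H \<le> \<rho>" "\<sigma> * H \<le> \<tau>" using \<rho> \<tau> H(1) by (auto simp: \<sigma>_def)
        obtain C where "\<forall>k. a k \<le> C * \<sigma> ^ k * weight_fact M k"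
          using a \<sigma>(1) unfolding Beurling ultra_seq_def for_rho.simps by blast
        from one[OF this \<sigma>] have "?\<phi> (j, k) \<le> max C 0 * \<tau> ^ j * weight_fact M j" for j k
          using p[of k] by (simp add: pos_divide_le_eq)
        then show "\<exists>C. \<forall>i\<in>UNIV. ?\<phi> i \<le> C * \<tau> ^ fst i * weight_fact M (fst i)" by (intro exI[of _ "max C 0"]) auto
      qed
      then obtain b where b: "ultra_seq s M b" "\<And>i. ?\<phi> i \<le> b (fst i)"
        unfolding ex_ultra_seq_iff[OF M, symmetric] by blast
      have "a (j + k) \<le> b j * (\<rho> ^ k * weight_fact M k)" for j k
        using b(2)[of "(j, k)"] p[of k] by (simp add: pos_divide_le_eq)
      with b(1) show ?thesis by blast
    qed
    then show ?thesis unfolding Beurling for_rho.simps by blast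
  next
    case Roumieu
    then obtain \<sigma> C where C: "\<sigma> > 0" "\<forall>k. a k \<le> C * \<sigma> ^ k * weight_fact M k"
      using a unfolding ultra_seq_def by auto
    let ?\<rho> = "\<sigma> * H" and ?b = "\<lambda>j. max C 0 * (\<sigma> * H) ^ j * weight_fact M j"
    have "?\<rho> > 0" using C(1) H(1) by simp
    then have "ultra_seq s M ?b" unfolding Roumieu ultra_seq_def for_rho.simps by blast
    then show ?thesis
      unfolding Roumieu for_rho.simps using \<open>?\<rho> > 0\<close> one[OF C(2,1) order_refl order_refl] by blast
  qed
qed

text \<open>Splitting off a fixed number \<open>i\<close> of derivatives costs only a
  constant.\<close>

lemma ultra_seq_shift:
  assumes M: "weight_sequence M" and mg: "moderate_growth M" and a: "ultra_seq s M a"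
  shows "ultra_seq s M (\<lambda>k. a (k + i))"
proof -
  obtain \<rho> b where b: "\<rho> > 0" "ultra_seq s M b" "\<And>j k. a (j + k) \<le> b j * (\<rho> ^ k * weight_fact M k)"
    using for_rho_ex[OF ultra_seq_split[OF assms]] by blast
  have "ultra_seq s M (\<lambda>k. (\<rho> ^ i * weight_fact M i) * b k)"
    using b(1) weight_fact_pos[OF M, of i] by (intro ultra_seq_scale[OF M b(2)]) simp
  then show ?thesis by (rule ultra_seq_mono) (use b(3) in \<open>simp add: mult.commute\<close>)
qed

section \<open>The spaces of ultradifferentiable functions with global bounds\<close>

lemma limitin_initial_topology:
  assumes "d \<in> V" "eventually (\<lambda>t. u t \<in> V) F"
    and lim: "\<And>i. i \<in> I \<Longrightarrow> limitin (T i) (\<lambda>t. g i (u t)) (g i d) F"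
  shows "limitin (initial_topology V I g T) u d F"
  unfolding initial_topology_def
proof (rule limitin_topology_generated_by)
  fix U assume "U \<in> insert V {{x \<in> V. g i x \<in> U} | i U. i \<in> I \<and> openin (T i) U}" and d: "d \<in> U"
  then consider "U = V" | i W where "U = {x \<in> V. g i x \<in> W}" "i \<in> I" "openin (T i) W" by blast
  then show "eventually (\<lambda>t. u t \<in> U) F"
  proof cases
    case 2
    have "eventually (\<lambda>t. g i (u t) \<in> W) F"
      using limitinD[OF lim[OF 2(2)] 2(3)] d 2(1) by simp
    with assms(2) have "eventually (\<lambda>t. u t \<in> V \<and> g i (u t) \<in> W) F" by (rule eventually_conj)
    then show ?thesis unfolding 2(1) by (rule eventually_mono) simp
  qed (use assms(2) in simp)
qed (use assms(1) in simp)

lemma dominated_real_iff: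
  fixes g :: "'a::euclidean_space \<Rightarrow> real"
  shows "dominated a g \<longleftrightarrow> smooth_into euclideanreal g \<and>
    (\<forall>vs x. unit_vectors vs \<longrightarrow> \<bar>iter_deriv euclideanreal g vs x\<bar> \<le> a (length vs))"
  by (simp add: dominated_def)

context
  fixes M :: "nat \<Rightarrow> real"
  assumes M: "weight_sequence M"
begin

section \<open>The Banach spaces with fixed \<rho>\<close>

text \<open>Translates the defining norms, built on Frechet derivatives and real suprema, into
  bounds on iterated derivatives in unit directions. The sets under the supremum are bounded by
  multilinearity, and lists of zero vectors show that they are nonempty.\<close>

lemma weighted_derivs_bound_iff:
  fixes g :: "'a::euclidean_space \<Rightarrow> real"
  assumes g: "smooth_into euclideanreal g" and \<rho>: "\<rho> > 0"
  shows "(\<forall>y\<in>weighted_derivs M \<rho> X g. y \<le> C) \<longleftrightarrow>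
    (\<forall>vs. \<forall>x\<in>X. unit_vectors vs \<longrightarrow>
      \<bar>iter_deriv euclideanreal g vs x\<bar> \<le> C * \<rho> ^ length vs * weight_fact M (length vs))"
proof -
  let ?D = "\<lambda>k x. {\<bar>iter_deriv euclideanreal g vs x\<bar> | vs. length vs = k \<and> (\<forall>v\<in>set vs. norm v \<le> 1)}"
  have dn: "deriv_norm g k x = Sup (?D k x)" for k x
    by (simp add: deriv_norm_def frechet_iter_eq_iter_deriv[OF g])
  have bdd: "bdd_above (?D k x)" for k x
  proof -
    have "\<exists>C. \<forall>f\<in>{g}. \<forall>y\<in>{x}. \<forall>vs. length vs = k \<and> (\<forall>v\<in>set vs. norm v \<le> 1) \<longrightarrow>
      norm (iter_deriv euclideanreal f vs y) \<le> C"
      by (rule iter_deriv_multilinear_bound) (use g in auto)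
    then show ?thesis unfolding bdd_above_def by auto
  qed
  have ne: "?D k x \<noteq> {}" for k x
  proof -
    have "\<bar>iter_deriv euclideanreal g (replicate k 0) x\<bar> \<in> ?D k x" by force
    then show ?thesis by blast
  qed
  have pos: "\<rho> ^ k * fact k * M k > 0" for k
    using weight_fact_pos[OF M, of k] \<rho> by (simp add: weight_fact_def mult.assoc)
  have eq: "\<rho> ^ k * fact k * M k = \<rho> ^ k * weight_fact M k" for k
    by (simp add: weight_fact_def mult.assoc)
  have "(\<forall>y\<in>weighted_derivs M \<rho> X g. y \<le> C) \<longleftrightarrow> (\<forall>k. \<forall>x\<in>X. deriv_norm g k x \<le> C * (\<rho> ^ k * fact k * M k))"
    unfolding weighted_derivs_def pos_divide_le_eq[OF pos, symmetric] by blast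
  also have "\<dots> \<longleftrightarrow> (\<forall>k. \<forall>x\<in>X. \<forall>y\<in>?D k x. y \<le> C * (\<rho> ^ k * fact k * M k))"
    unfolding dn using cSup_le_iff[OF ne bdd] by simp
  also have "\<dots> \<longleftrightarrow> (\<forall>vs. \<forall>x\<in>X. unit_vectors vs \<longrightarrow>
      \<bar>iter_deriv euclideanreal g vs x\<bar> \<le> C * \<rho> ^ length vs * weight_fact M (length vs))"
    unfolding unit_vectors_def eq by (auto simp: mult.assoc)
  finally show ?thesis .
qed

lemma weighted_derivs_bdd_iff:
  fixes g :: "'a::euclidean_space \<Rightarrow> real"
  assumes "smooth_into euclideanreal g" "\<rho> > 0"
  shows "bdd_above (weighted_derivs M \<rho> X g) \<longleftrightarrow>
    (\<exists>C. \<forall>vs. \<forall>x\<in>X. unit_vectors vs \<longrightarrow>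
      \<bar>iter_deriv euclideanreal g vs x\<bar> \<le> C * \<rho> ^ length vs * weight_fact M (length vs))"
  unfolding bdd_above_def weighted_derivs_bound_iff[OF assms] ..

definition BM_norm :: "real \<Rightarrow> ('a::euclidean_space \<Rightarrow> real) \<Rightarrow> real" where
  "BM_norm \<rho> g = Sup (weighted_derivs M \<rho> UNIV g)"

lemma topspace_BM_rho:
  "g \<in> topspace (BM_rho M \<rho>) \<longleftrightarrow> smooth_into euclideanreal g \<and> bdd_above (weighted_derivs M \<rho> UNIV g)"
  by (simp add: BM_rho_def)

lemma BM_norm_upper:
  assumes "g \<in> topspace (BM_rho M \<rho>)" "\<rho> > 0" "unit_vectors vs"
  shows "\<bar>iter_deriv euclideanreal g vs x\<bar> \<le> BM_norm \<rho> g * \<rho> ^ length vs * weight_fact M (length vs)"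
proof -
  have g: "smooth_into euclideanreal g" "bdd_above (weighted_derivs M \<rho> UNIV g)"
    using assms(1) by (auto simp: topspace_BM_rho)
  have "\<forall>y\<in>weighted_derivs M \<rho> UNIV g. y \<le> BM_norm \<rho> g"
    unfolding BM_norm_def using g(2) by (auto intro: cSup_upper)
  then show ?thesis using weighted_derivs_bound_iff[OF g(1) assms(2), of UNIV "BM_norm \<rho> g"] assms(3) by blast
qed

lemma BM_norm_least:
  assumes "smooth_into euclideanreal g" "\<rho> > 0"
    and "\<And>vs x. unit_vectors vs \<Longrightarrow>
      \<bar>iter_deriv euclideanreal g vs x\<bar> \<le> C * \<rho> ^ length vs * weight_fact M (length vs)"
  shows "g \<in> topspace (BM_rho M \<rho>)" "BM_norm \<rho> g \<le> C"
proof -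
  have le: "\<forall>y\<in>weighted_derivs M \<rho> UNIV g. y \<le> C"
    using assms(3) unfolding weighted_derivs_bound_iff[OF assms(1,2)] by blast
  then show "g \<in> topspace (BM_rho M \<rho>)"
    using assms(1) by (auto simp: topspace_BM_rho bdd_above_def)
  have "weighted_derivs M \<rho> UNIV g \<noteq> {}" unfolding weighted_derivs_def by blast
  then show "BM_norm \<rho> g \<le> C" unfolding BM_norm_def using le by (intro cSup_least) auto
qed

lemma BM_rho_smooth: "g \<in> topspace (BM_rho M \<rho>) \<Longrightarrow> smooth_into euclideanreal g"
  by (simp add: topspace_BM_rho)

lemma BM_rho_add:
  assumes \<rho>: "\<rho> > 0" and f: "f \<in> topspace (BM_rho M \<rho>)" and g: "g \<in> topspace (BM_rho M \<rho>)"
  shows "f + g \<in> topspace (BM_rho M \<rho>)" "BM_norm \<rho> (f + g) \<le> BM_norm \<rho> f + BM_norm \<rho> g"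
proof -
  note s = BM_rho_smooth[OF f] BM_rho_smooth[OF g]
  have sm: "smooth_into euclideanreal (f + g)"
    using smooth_into_add(1)[OF separated_lc_euclidean s] by (simp add: plus_fun_def)
  have le: "\<bar>iter_deriv euclideanreal (f + g) vs x\<bar>
      \<le> (BM_norm \<rho> f + BM_norm \<rho> g) * \<rho> ^ length vs * weight_fact M (length vs)" if "unit_vectors vs" for vs x
    using BM_norm_upper[OF f \<rho> that, of x] BM_norm_upper[OF g \<rho> that, of x]
    unfolding iter_deriv_add_fun[OF separated_lc_euclidean s] distrib_right by linarith
  show "f + g \<in> topspace (BM_rho M \<rho>)" "BM_norm \<rho> (f + g) \<le> BM_norm \<rho> f + BM_norm \<rho> g"
    using BM_norm_least[OF sm \<rho> le] by blast+
qed

lemma BM_rho_scale: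
  assumes \<rho>: "\<rho> > 0" and f: "f \<in> topspace (BM_rho M \<rho>)"
  shows "c *\<^sub>R f \<in> topspace (BM_rho M \<rho>)" "BM_norm \<rho> (c *\<^sub>R f) \<le> \<bar>c\<bar> * BM_norm \<rho> f"
proof -
  note s = BM_rho_smooth[OF f]
  have sm: "smooth_into euclideanreal (c *\<^sub>R f)"
    using smooth_into_scale(1)[OF separated_lc_euclidean s, where c = c] by (simp add: scaleR_fun_def)
  have le: "\<bar>iter_deriv euclideanreal (c *\<^sub>R f) vs x\<bar>
      \<le> (\<bar>c\<bar> * BM_norm \<rho> f) * \<rho> ^ length vs * weight_fact M (length vs)" if "unit_vectors vs" for vs x
    using mult_left_mono[OF BM_norm_upper[OF f \<rho> that, of x], of "\<bar>c\<bar>"]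
    unfolding iter_deriv_scale_fun[OF separated_lc_euclidean s] by (simp add: abs_mult mult.assoc)
  show "c *\<^sub>R f \<in> topspace (BM_rho M \<rho>)" "BM_norm \<rho> (c *\<^sub>R f) \<le> \<bar>c\<bar> * BM_norm \<rho> f"
    using BM_norm_least[OF sm \<rho> le] by blast+
qed

lemma BM_rho_zero:
  assumes \<rho>: "\<rho> > 0"
  shows "(0 :: 'b::euclidean_space \<Rightarrow> real) \<in> topspace (BM_rho M \<rho>)" "BM_norm \<rho> (0 :: 'b \<Rightarrow> real) \<le> 0"
proof -
  note z = smooth_into_zero[OF separated_lc_euclidean[where 'a = real]]
  have "smooth_into euclideanreal (0 :: 'b \<Rightarrow> real)"
    using z(1) by (simp add: zero_fun_def)
  from BM_norm_least[OF this \<rho>, of 0]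
  show "(0 :: 'b \<Rightarrow> real) \<in> topspace (BM_rho M \<rho>)" "BM_norm \<rho> (0 :: 'b \<Rightarrow> real) \<le> 0"
    by (simp_all add: zero_fun_def z(2))
qed

lemma subspace_BM_rho: "\<rho> > 0 \<Longrightarrow> subspace (topspace (BM_rho M \<rho>))"
  by (intro subspaceI) (simp_all add: BM_rho_add BM_rho_scale BM_rho_zero)

lemma BM_norm_seminorm:
  assumes \<rho>: "\<rho> > 0"
  shows "seminorm_on (topspace (BM_rho M \<rho>)) (BM_norm \<rho>)"
  unfolding seminorm_on_def
proof (intro conjI ballI allI)
  fix f :: "'a \<Rightarrow> real" assume f: "f \<in> topspace (BM_rho M \<rho>)"
  show "0 \<le> BM_norm \<rho> f"
    using BM_norm_upper[OF f \<rho>, of "[]" 0] weight_fact_0[OF M] by simp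
  show "BM_norm \<rho> (f + g) \<le> BM_norm \<rho> f + BM_norm \<rho> g" if "g \<in> topspace (BM_rho M \<rho>)" for g
    using BM_rho_add(2)[OF \<rho> f that] .
  fix c
  show "BM_norm \<rho> (c *\<^sub>R f) = \<bar>c\<bar> * BM_norm \<rho> f"
  proof (cases "c = 0")
    case True
    have "BM_norm \<rho> (0 :: 'a \<Rightarrow> real) \<ge> 0"
      using BM_norm_upper[OF BM_rho_zero(1)[OF \<rho>] \<rho>, of "[]" "0 :: 'a"] weight_fact_0[OF M] by simp
    then have "BM_norm \<rho> (0 :: 'a \<Rightarrow> real) = 0" using BM_rho_zero(2)[OF \<rho>] by (intro antisym)
    then show ?thesis using True by simp
  next
    case False
    have "BM_norm \<rho> (inverse c *\<^sub>R c *\<^sub>R f) \<le> \<bar>inverse c\<bar> * BM_norm \<rho> (c *\<^sub>R f)"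
      by (rule BM_rho_scale(2)[OF \<rho> BM_rho_scale(1)[OF \<rho> f]])
    then have "\<bar>c\<bar> * BM_norm \<rho> f \<le> BM_norm \<rho> (c *\<^sub>R f)"
      using False by (simp add: field_simps)
    with BM_rho_scale(2)[OF \<rho> f, of c] show ?thesis by linarith
  qed
qed

lemma BM_rho_eq: "BM_rho M \<rho> = seminorm_topology (topspace (BM_rho M \<rho>)) {BM_norm \<rho>}"
proof -
  have "BM_norm \<rho> = (\<lambda>f :: 'a \<Rightarrow> real. Sup (weighted_derivs M \<rho> UNIV f))" by (rule ext) (simp add: BM_norm_def)
  then show ?thesis unfolding BM_rho_def by simp
qed

lemma locally_convex_BM_rho:
  assumes \<rho>: "\<rho> > 0"
  shows "locally_convex (BM_rho M \<rho>)"
  by (subst BM_rho_eq, rule locally_convex_seminorm_topology[OF subspace_BM_rho[OF \<rho>]])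
    (use BM_norm_seminorm[OF \<rho>] in auto)

lemma BM_norm_cont_seminorm:
  assumes \<rho>: "\<rho> > 0"
  shows "BM_norm \<rho> \<in> cont_seminorms (BM_rho M \<rho>)"
proof -
  have "continuous_map (BM_rho M \<rho>) euclideanreal (BM_norm \<rho>)"
    by (subst BM_rho_eq, rule continuous_map_seminorm[OF subspace_BM_rho[OF \<rho>]])
      (use BM_norm_seminorm[OF \<rho>] in auto)
  then show ?thesis using BM_norm_seminorm[OF \<rho>] by (simp add: cont_seminorms_def)
qed

lemma limitin_BM_rho:
  assumes \<rho>: "\<rho> > 0"
  shows "limitin (BM_rho M \<rho>) u d F \<longleftrightarrow> d \<in> topspace (BM_rho M \<rho>) \<and>
    eventually (\<lambda>t. u t \<in> topspace (BM_rho M \<rho>)) F \<and> ((\<lambda>t. BM_norm \<rho> (u t - d)) \<longlongrightarrow> 0) F"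
  using limitin_seminorm_topology[OF subspace_BM_rho[OF \<rho>], of "{BM_norm \<rho>}" u d F] BM_norm_seminorm[OF \<rho>]
  unfolding BM_rho_eq[symmetric] by simp

lemma ultra_dominated_iff:
  fixes B :: "('a::euclidean_space \<Rightarrow> 'b::euclidean_space) set"
  assumes "\<And>f. f \<in> B \<Longrightarrow> smooth_into euclidean f"
  shows "(\<exists>a. ultra_seq s M a \<and> (\<forall>f\<in>B. dominated a f)) \<longleftrightarrow>
    for_rho s (\<lambda>\<rho>. \<exists>C. \<forall>f\<in>B. \<forall>vs x. unit_vectors vs \<longrightarrow>
      norm (iter_deriv euclidean f vs x) \<le> C * \<rho> ^ length vs * weight_fact M (length vs))"
proof -
  let ?I = "{(f, vs, x). f \<in> B \<and> unit_vectors vs}"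
  let ?\<phi> = "\<lambda>(f, vs, x). norm (iter_deriv euclidean f vs x)"
  let ?\<kappa> = "\<lambda>(f :: 'a \<Rightarrow> 'b, vs :: 'a list, x :: 'a). length vs"
  have "(\<exists>a. ultra_seq s M a \<and> (\<forall>f\<in>B. dominated a f)) \<longleftrightarrow> (\<exists>a. ultra_seq s M a \<and> (\<forall>i\<in>?I. ?\<phi> i \<le> a (?\<kappa> i)))"
    using assms by (auto simp: dominated_def)
  also have "\<dots> \<longleftrightarrow> for_rho s (\<lambda>\<rho>. \<exists>C. \<forall>i\<in>?I. ?\<phi> i \<le> C * \<rho> ^ ?\<kappa> i * weight_fact M (?\<kappa> i))"
    by (rule ex_ultra_seq_iff[OF M])
  also have "\<dots> \<longleftrightarrow> for_rho s (\<lambda>\<rho>. \<exists>C. \<forall>f\<in>B. \<forall>vs x. unit_vectors vs \<longrightarrow>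
      norm (iter_deriv euclidean f vs x) \<le> C * \<rho> ^ length vs * weight_fact M (length vs))"
    by simp
  finally show ?thesis .
qed

lemma BM_rho_mono:
  assumes "\<rho> > 0" "\<rho> \<le> \<sigma>" and f: "f \<in> topspace (BM_rho M \<rho>)"
  shows "f \<in> topspace (BM_rho M \<sigma>)"
proof (rule BM_norm_least(1)[OF BM_rho_smooth[OF f]])
  fix vs x assume "unit_vectors (vs :: 'a list)"
  then show "\<bar>iter_deriv euclideanreal f vs x\<bar> \<le> max (BM_norm \<rho> f) 0 * \<sigma> ^ length vs * weight_fact M (length vs)"
    using bound_nonneg_const[OF M, of "{vs. unit_vectors vs}" "\<lambda>vs. \<bar>iter_deriv euclideanreal f vs x\<bar>" "BM_norm \<rho> f" \<rho> length \<sigma> vs]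
      BM_norm_upper[OF f assms(1)] assms(1,2) by auto
qed (use assms in auto)

section \<open>Projective and inductive limits over \<rho>\<close>

text \<open>The spaces grow with \<rho>, and the values 1/n and n are cofinal towards 0 and infinity
  respectively.\<close>

lemma topspace_BM_real_for_rho:
  fixes f :: "'a::euclidean_space \<Rightarrow> real"
  shows "f \<in> topspace (BM_real s M) \<longleftrightarrow> for_rho s (\<lambda>\<rho>. f \<in> topspace (BM_rho M \<rho>))"
proof (cases s)
  case Beurling
  have "for_rho Beurling (\<lambda>\<rho>. f \<in> topspace (BM_rho M \<rho>))" if "\<And>n. 1 \<le> n \<Longrightarrow> f \<in> topspace (BM_rho M (1 / real n))"
    unfolding for_rho.simps
  proof (intro allI impI)
    fix \<rho> :: real assume "\<rho> > 0"
    then obtain n where n: "n \<noteq> 0" "inverse (real n) < \<rho>" using real_arch_inverse by blast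
    then show "f \<in> topspace (BM_rho M \<rho>)"
      using BM_rho_mono[of "1 / real n" \<rho>] that[of n] by (simp add: inverse_eq_divide)
  qed
  then show ?thesis unfolding Beurling by auto
next
  case Roumieu
  have "\<exists>n\<ge>1. f \<in> topspace (BM_rho M (real n))" if "\<rho> > 0" "f \<in> topspace (BM_rho M \<rho>)" for \<rho>
  proof -
    obtain n where "\<rho> \<le> real n" using real_arch_simple by blast
    then show ?thesis using BM_rho_mono[OF that(1) _ that(2)] that(1) by (intro exI[of _ n]) auto
  qed
  then have ex: "(\<exists>\<rho>>0. f \<in> topspace (BM_rho M \<rho>)) \<longleftrightarrow> (\<exists>n\<ge>1. f \<in> topspace (BM_rho M (real n)))"
    by (metis of_nat_0_less_iff less_le_trans zero_less_one)
  have "topspace (BM_real Roumieu M) = (\<Union>n\<in>{n. 1 \<le> n}. topspace (BM_rho M (real n)))" by auto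
  then show ?thesis unfolding Roumieu for_rho.simps ex by blast
qed

lemma topspace_BM_rho_iff:
  assumes "\<rho> > 0"
  shows "f \<in> topspace (BM_rho M \<rho>) \<longleftrightarrow> smooth_into euclideanreal f \<and>
    (\<exists>C. \<forall>vs x. unit_vectors vs \<longrightarrow>
      norm (iter_deriv euclideanreal f vs x) \<le> C * \<rho> ^ length vs * weight_fact M (length vs))"
proof (cases "smooth_into euclideanreal f")
  case True
  show ?thesis
    using weighted_derivs_bdd_iff[OF True assms, of UNIV] by (simp add: topspace_BM_rho True)
qed (simp add: topspace_BM_rho)

lemma topspace_BM_real:
  fixes f :: "'a::euclidean_space \<Rightarrow> real"
  shows "f \<in> topspace (BM_real s M) \<longleftrightarrow> (\<exists>a. ultra_seq s M a \<and> dominated a f)"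
proof (cases "smooth_into euclideanreal f")
  case True
  have "for_rho s (\<lambda>\<rho>. f \<in> topspace (BM_rho M \<rho>)) \<longleftrightarrow> for_rho s (\<lambda>\<rho>. \<exists>C. \<forall>vs x. unit_vectors vs \<longrightarrow>
      norm (iter_deriv euclideanreal f vs x) \<le> C * \<rho> ^ length vs * weight_fact M (length vs))"
    by (rule for_rho_cong) (simp add: topspace_BM_rho_iff True)
  then show ?thesis
    using ultra_dominated_iff[of "{f}" s] True unfolding topspace_BM_real_for_rho by simp
next
  case False
  then show ?thesis
    unfolding topspace_BM_real_for_rho using for_rho_ex[of s "\<lambda>\<rho>. f \<in> topspace (BM_rho M \<rho>)"]
    by (auto simp: topspace_BM_rho_iff dominated_def)
qed

lemma subspace_BM_real: "subspace (topspace (BM_real s M) :: ('a::euclidean_space \<Rightarrow> real) set)"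
proof (cases s)
  case Beurling
  have V: "topspace (BM_real s M) = {f :: 'a \<Rightarrow> real. \<forall>\<rho>>0. f \<in> topspace (BM_rho M \<rho>)}"
    by (rule set_eqI) (simp only: mem_Collect_eq topspace_BM_real_for_rho Beurling for_rho.simps)
  show ?thesis
    unfolding subspace_def V by (simp add: BM_rho_zero BM_rho_add BM_rho_scale)
next
  case Roumieu
  have "f + g \<in> topspace (BM_real s M)" if f: "f \<in> topspace (BM_real s M)" and g: "g \<in> topspace (BM_real s M)"
    for f g :: "'a \<Rightarrow> real"
  proof -
    obtain \<rho> \<sigma> where "\<rho> > 0" "f \<in> topspace (BM_rho M \<rho>)" "\<sigma> > 0" "g \<in> topspace (BM_rho M \<sigma>)"
      using f g unfolding topspace_BM_real_for_rho Roumieu by auto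
    then have "f \<in> topspace (BM_rho M (max \<rho> \<sigma>))" "g \<in> topspace (BM_rho M (max \<rho> \<sigma>))" "max \<rho> \<sigma> > 0"
      using BM_rho_mono[of \<rho> "max \<rho> \<sigma>"] BM_rho_mono[of \<sigma> "max \<rho> \<sigma>"] by auto
    then show ?thesis unfolding topspace_BM_real_for_rho Roumieu for_rho.simps using BM_rho_add(1) by blast
  qed
  moreover have "c *\<^sub>R f \<in> topspace (BM_real s M)" if "f \<in> topspace (BM_real s M)" for f :: "'a \<Rightarrow> real" and c
    using that BM_rho_scale(1) unfolding topspace_BM_real_for_rho Roumieu for_rho.simps by blast
  moreover have "0 \<in> topspace (BM_real s M)"
    using BM_rho_zero(1)[of 1] unfolding topspace_BM_real_for_rho Roumieu by (auto intro!: exI[of _ 1])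
  ultimately show ?thesis unfolding subspace_def by blast
qed

lemma limitin_BM_rho_null_sequence:
  fixes b :: "nat \<Rightarrow> 'a::euclidean_space \<Rightarrow> real"
  assumes \<rho>: "\<rho> > 0" and C: "\<And>n vs x. unit_vectors vs \<Longrightarrow>
      norm (iter_deriv euclideanreal (b n) vs x) \<le> C * \<rho> ^ length vs * weight_fact M (length vs)"
    and sm: "\<And>n. smooth_into euclideanreal (b n)"
  shows "limitin (BM_rho M \<rho>) (\<lambda>n. inverse (real (Suc n)) *\<^sub>R b n) 0 sequentially"
proof -
  have b: "b n \<in> topspace (BM_rho M \<rho>)" "BM_norm \<rho> (b n) \<le> C" for n
    using BM_norm_least[OF sm[of n] \<rho>, of C] C[of _ n] by simp_all
  have up: "BM_norm \<rho> (inverse (real (Suc n)) *\<^sub>R b n) \<le> C * inverse (real (Suc n))" for n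
    using mult_right_mono[OF b(2), of "inverse (real (Suc n))" n]
      seminorm_onD(3)[OF BM_norm_seminorm[OF \<rho>] b(1), of "inverse (real (Suc n))" n] by (simp add: mult.commute)
  have lo: "0 \<le> BM_norm \<rho> (inverse (real (Suc n)) *\<^sub>R b n)" for n
    by (rule seminorm_onD(1)[OF BM_norm_seminorm[OF \<rho>] BM_rho_scale(1)[OF \<rho> b(1)]])
  have lim: "(\<lambda>n. BM_norm \<rho> (inverse (real (Suc n)) *\<^sub>R b n - 0)) \<longlonglongrightarrow> 0"
    unfolding diff_zero
    by (rule tendsto_sandwich[OF always_eventually[OF allI[OF lo]] always_eventually[OF allI[OF up]]
          tendsto_const tendsto_mult_right_zero[OF LIMSEQ_inverse_real_of_nat]])
  show ?thesis
    unfolding limitin_BM_rho[OF \<rho>]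
    by (intro conjI BM_rho_zero(1)[OF \<rho>] lim always_eventually allI BM_rho_scale(1)[OF \<rho> b(1)])
qed

text \<open>In the Beurling case convergence is tested in every step of the projective limit; in the
  Roumieu case it takes place in one step \<open>m\<close> with \<open>\<rho> \<le> real m\<close>,
  whose inclusion is continuous. Such null sequences later show that sets with common estimates are
  bounded.\<close>

lemma limitin_BM_real_null_sequence:
  fixes b :: "nat \<Rightarrow> 'a::euclidean_space \<Rightarrow> real"
  assumes a: "ultra_seq s M a" and b: "\<And>n. dominated a (b n)"
  shows "limitin (BM_real s M) (\<lambda>n. inverse (real (Suc n)) *\<^sub>R b n) 0 sequentially"
proof -
  have sm: "smooth_into euclideanreal (b n)" for n using dominatedD(1)[OF b] .
  have "for_rho s (\<lambda>\<rho>. limitin (BM_rho M \<rho>) (\<lambda>n. inverse (real (Suc n)) *\<^sub>R b n) 0 sequentially)"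
    using a unfolding ultra_seq_def
  proof (rule for_rho_mono)
    fix \<rho> :: real assume \<rho>: "\<rho> > 0" and "\<exists>C. \<forall>k. a k \<le> C * \<rho> ^ k * weight_fact M k"
    then obtain C where C: "\<And>k. a k \<le> C * \<rho> ^ k * weight_fact M k" by blast
    show "limitin (BM_rho M \<rho>) (\<lambda>n. inverse (real (Suc n)) *\<^sub>R b n) 0 sequentially"
      by (rule limitin_BM_rho_null_sequence[OF \<rho> order_trans[OF dominatedD(2)[OF b] C] sm])
  qed
  moreover have mem: "inverse (real (Suc n)) *\<^sub>R b n \<in> topspace (BM_real s M)" for n
    using a b by (intro subspace_scale[OF subspace_BM_real]) (auto simp: topspace_BM_real)
  moreover have z: "0 \<in> topspace (BM_real s M)" by (rule subspace_0[OF subspace_BM_real])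
  ultimately show ?thesis
  proof (cases s)
    case Beurling
    let ?TT = "{BM_rho M (1 / real n) | n. 1 \<le> n} :: ('a \<Rightarrow> real) topology set"
    have lim: "limitin T (\<lambda>n. inverse (real (Suc n)) *\<^sub>R b n) 0 sequentially" if T: "T \<in> ?TT" for T
    proof -
      obtain m where "T = BM_rho M (1 / real m)" "1 \<le> m" using T by blast
      then show ?thesis
        using \<open>for_rho s _\<close> unfolding Beurling for_rho.simps by simp
    qed
    have V: "(\<Inter>T\<in>?TT. topspace T) = topspace (BM_real s M)" unfolding Beurling by simp
    have "limitin (lc_proj_limit ?TT) (\<lambda>n. inverse (real (Suc n)) *\<^sub>R b n) 0 sequentially"
      unfolding lc_proj_limit_def
      by (rule limitin_initial_topology) (unfold V, rule z, rule always_eventually, rule allI, rule mem, rule lim)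
    then show ?thesis unfolding Beurling by simp
  next
    case Roumieu
    let ?TT = "{BM_rho M (real n) | n. 1 \<le> n} :: ('a \<Rightarrow> real) topology set"
    obtain \<rho> C where C: "\<rho> > 0" "\<And>k. a k \<le> C * \<rho> ^ k * weight_fact M k"
      using a unfolding ultra_seq_def Roumieu by auto
    obtain m where m: "\<rho> \<le> real m" using real_arch_simple by blast
    then have m1: "1 \<le> m" using C(1) by (cases m) auto
    have am: "a k \<le> max C 0 * real m ^ k * weight_fact M k" for k
      using bound_nonneg_const[OF M, of UNIV a C \<rho> "\<lambda>k. k" "real m" k] C m by auto
    have lim: "limitin (BM_rho M (real m)) (\<lambda>n. inverse (real (Suc n)) *\<^sub>R b n) 0 sequentially"
      by (rule limitin_BM_rho_null_sequence[OF _ order_trans[OF dominatedD(2)[OF b] am] sm]) (use m1 in auto)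
    have V: "(\<Union>T\<in>?TT. topspace T) = topspace (BM_real s M)" unfolding Roumieu by simp
    have "continuous_map (BM_rho M (real m)) (BM_real s M) (\<lambda>x. x :: 'a \<Rightarrow> real)"
      unfolding Roumieu BM_real.simps
    proof (rule lc_ind_limit_inclusion)
      show "subspace (\<Union>T\<in>?TT. topspace T)" unfolding V by (rule subspace_BM_real)
      show "locally_convex (BM_rho M (real m) :: ('a \<Rightarrow> real) topology)" by (rule locally_convex_BM_rho) (use m1 in simp)
    qed (use m1 in blast)
    from limitin_linear[OF this lim] show ?thesis .
  qed
qed

text \<open>These are the explicit seminorms of the whole argument. In the Beurling case the weights
  dominate one geometric sequence, so a single norm \<open>BM_norm \<tau>\<close> bounds the
  supremum. In the Roumieu case they dominate every one, so the supremum is continuous on each step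
  \<open>m\<close>, hence on the inductive limit.\<close>

lemma BM_real_test_seminorm:
  fixes x :: "'i \<Rightarrow> 'a::euclidean_space"
  assumes \<sigma>: "test_weights s \<sigma> (\<lambda>n. length (vs n))" and vs: "\<And>n. unit_vectors (vs n)"
  defines "e \<equiv> \<lambda>n f. iter_deriv euclideanreal f (vs n) (x n) / (\<sigma> n ^ length (vs n) * weight_fact M (length (vs n)))"
  shows "(\<lambda>f. SUP n. \<bar>e n f\<bar>) \<in> cont_seminorms (BM_real s M)"
    and "f \<in> topspace (BM_real s M) \<Longrightarrow> \<bar>e n f\<bar> \<le> (SUP n. \<bar>e n f\<bar>)"
proof -
  have pos: "\<sigma> n ^ k * weight_fact M k > 0" for n k
    using test_weights_pos[OF \<sigma>, of n] weight_fact_pos[OF M, of k] by simp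
  have sm: "smooth_into euclideanreal f" if "f \<in> topspace (BM_real s M)" for f :: "'a \<Rightarrow> real"
    using that by (auto simp: topspace_BM_real dest: dominatedD(1))
  have bound: "\<bar>e n f\<bar> \<le> C"
    if "a (length (vs n)) \<le> C * \<sigma> n ^ length (vs n) * weight_fact M (length (vs n))"
      "norm (iter_deriv euclideanreal f (vs n) (x n)) \<le> a (length (vs n))" for f n a C
  proof -
    have "\<bar>iter_deriv euclideanreal f (vs n) (x n)\<bar> \<le> C * (\<sigma> n ^ length (vs n) * weight_fact M (length (vs n)))"
      using that by (simp add: mult.assoc)
    then show ?thesis using pos[of n "length (vs n)"] by (simp add: e_def abs_divide pos_divide_le_eq)
  qed
  have bdd: "bdd_above (range (\<lambda>n. \<bar>e n f\<bar>))" if f: "f \<in> topspace (BM_real s M)" for f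
  proof -
    obtain a where a: "ultra_seq s M a" "dominated a f" using f by (auto simp: topspace_BM_real)
    obtain C where "\<And>n. a (length (vs n)) \<le> C * \<sigma> n ^ length (vs n) * weight_fact M (length (vs n))"
      using ultra_seq_test_weights[OF M a(1) \<sigma>] by blast
    then show ?thesis
      by (intro bdd_aboveI2[of _ _ C] bound[of a]) (use dominatedD(2)[OF a(2) vs] in auto)
  qed
  show up: "f \<in> topspace (BM_real s M) \<Longrightarrow> \<bar>e n f\<bar> \<le> (SUP n. \<bar>e n f\<bar>)" for f n
    by (rule cSUP_upper[OF UNIV_I bdd])
  have sn: "seminorm_on (topspace (BM_real s M)) (\<lambda>f. SUP n. \<bar>e n f\<bar>)"
  proof (rule seminorm_on_SUP[OF _ _ bdd subspace_BM_real])
    fix n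
    have "linear_on_set (topspace (BM_real s M)) (e n)"
      by (auto simp: linear_on_set_def e_def iter_deriv_add_fun[OF separated_lc_euclidean] sm
          iter_deriv_scale_fun[OF separated_lc_euclidean] add_divide_distrib)
    from seminorm_on_norm_linear[OF this]
    show "seminorm_on (topspace (BM_real s M)) (\<lambda>f. \<bar>e n f\<bar>)" by simp
  qed auto
  have rho: "(SUP n. \<bar>e n f\<bar>) \<le> C * BM_norm \<rho> f"
    if f: "f \<in> topspace (BM_rho M \<rho>)" and \<rho>: "\<rho> > 0"
      and C: "\<And>n. \<rho> ^ length (vs n) * weight_fact M (length (vs n)) \<le> C * \<sigma> n ^ length (vs n) * weight_fact M (length (vs n))"
    for f \<rho> C
  proof (rule cSUP_least)
    fix n
    have N: "0 \<le> BM_norm \<rho> f" using seminorm_onD(1)[OF BM_norm_seminorm[OF \<rho>] f] .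
    show "\<bar>e n f\<bar> \<le> C * BM_norm \<rho> f"
    proof (rule bound[of "\<lambda>k. BM_norm \<rho> f * (\<rho> ^ k * weight_fact M k)"])
      show "BM_norm \<rho> f * (\<rho> ^ length (vs n) * weight_fact M (length (vs n)))
          \<le> C * BM_norm \<rho> f * \<sigma> n ^ length (vs n) * weight_fact M (length (vs n))"
        using mult_left_mono[OF C[of n] N] by (simp add: mult_ac)
      show "norm (iter_deriv euclideanreal f (vs n) (x n)) \<le> BM_norm \<rho> f * (\<rho> ^ length (vs n) * weight_fact M (length (vs n)))"
        using BM_norm_upper[OF f \<rho> vs, of n "x n"] by (simp add: mult.assoc)
    qed
  qed auto
  show "(\<lambda>f. SUP n. \<bar>e n f\<bar>) \<in> cont_seminorms (BM_real s M)"
  proof (cases s)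
    case Beurling
    obtain \<rho> C where \<rho>: "\<rho> > 0" and C: "\<And>n. \<rho> ^ length (vs n) \<le> C * \<sigma> n ^ length (vs n)"
      using \<sigma> unfolding Beurling test_weights_def for_rho_dual.simps by blast
    \<comment> \<open>A radius of the form 1/m makes \<open>BM_rho M \<tau>\<close> a member of the
      projective system, so that its balls are open in the limit.\<close>
    obtain m where m: "m \<noteq> 0" "inverse (real m) < \<rho>" using real_arch_inverse \<rho> by blast
    define \<tau> where "\<tau> = 1 / real m"
    have \<tau>: "\<tau> > 0" "\<tau> \<le> \<rho>" using m by (auto simp: \<tau>_def inverse_eq_divide)
    let ?TT = "{BM_rho M (1 / real n) | n. 1 \<le> n} :: ('a \<Rightarrow> real) topology set"
    have TT: "BM_rho M \<tau> \<in> ?TT" using m by (auto simp: \<tau>_def)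
    have V: "(\<Inter>T\<in>?TT. topspace T) = topspace (BM_real s M)" unfolding Beurling by simp
    have "continuous_map (BM_real s M) euclideanreal (\<lambda>f. SUP n. \<bar>e n f\<bar>)"
    proof (rule cont_seminormsI[OF subspace_BM_real sn, where r = "\<lambda>f. \<bar>C\<bar> * BM_norm \<tau> f"])
      fix f :: "'a \<Rightarrow> real" assume f: "f \<in> topspace (BM_real s M)"
      then have f\<tau>: "f \<in> topspace (BM_rho M \<tau>)" using TT unfolding V[symmetric] by blast
      have "\<tau> ^ length (vs n) * weight_fact M (length (vs n))
          \<le> \<bar>C\<bar> * \<sigma> n ^ length (vs n) * weight_fact M (length (vs n))" for n
      proof (rule mult_right_mono)
        have "\<tau> ^ length (vs n) \<le> \<rho> ^ length (vs n)" using \<tau> by (intro power_mono) auto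
        also have "\<dots> \<le> C * \<sigma> n ^ length (vs n)" by (rule C)
        also have "\<dots> \<le> \<bar>C\<bar> * \<sigma> n ^ length (vs n)"
          using test_weights_pos[OF \<sigma>, of n] by (intro mult_right_mono) auto
        finally show "\<tau> ^ length (vs n) \<le> \<bar>C\<bar> * \<sigma> n ^ length (vs n)" .
      qed (use weight_fact_pos[OF M] in \<open>simp add: less_imp_le\<close>)
      from rho[OF f\<tau> \<tau>(1) this]
      show "(SUP n. \<bar>e n f\<bar>) \<le> \<bar>C\<bar> * BM_norm \<tau> f" .
      fix d :: real assume d: "d > 0"
      \<comment> \<open>The summand 1 keeps the divisor positive.\<close>
      define d' where "d' = d / (\<bar>C\<bar> + 1)"
      have d': "d' > 0" using d by (simp add: d'_def)
      let ?W = "{g \<in> topspace (BM_rho M \<tau>). BM_norm \<tau> (g - f) < d'}"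
      let ?U = "{g \<in> topspace (BM_real s M). g \<in> ?W}"
      have op: "openin (BM_rho M \<tau>) ?W"
        by (subst (1) BM_rho_eq, rule openin_seminorm_ball) (use f\<tau> d' in auto)
      have "openin (BM_real s M) {g \<in> \<Inter>T\<in>?TT. topspace T. g \<in> ?W}"
        unfolding Beurling BM_real.simps lc_proj_limit_def initial_topology_def
        by (rule topology_generated_by_Basis, rule insertI2, rule CollectI, intro exI conjI, rule refl, rule TT, rule op)
      then have "openin (BM_real s M) ?U" unfolding V .
      moreover have "f \<in> ?U"
        using f f\<tau> d' by (simp add: seminorm_on_0[OF BM_norm_seminorm[OF \<tau>(1)] BM_rho_zero(1)[OF \<tau>(1)]])
      moreover have "\<bar>C\<bar> * BM_norm \<tau> (g - f) < d" if "g \<in> ?U" for g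
      proof -
        have "0 \<le> BM_norm \<tau> (g - f)"
          using that f\<tau> seminorm_onD(1)[OF BM_norm_seminorm[OF \<tau>(1)]] subspace_diff[OF subspace_BM_rho[OF \<tau>(1)]]
          by blast
        then have "\<bar>C\<bar> * BM_norm \<tau> (g - f) \<le> (\<bar>C\<bar> + 1) * BM_norm \<tau> (g - f)" by (intro mult_right_mono) auto
        also have "\<dots> < (\<bar>C\<bar> + 1) * d'" using that by (intro mult_strict_left_mono) auto
        also have "\<dots> = d" by (simp add: d'_def)
        finally show ?thesis .
      qed
      ultimately show "\<exists>U. openin (BM_real s M) U \<and> f \<in> U \<and> (\<forall>g\<in>U. \<bar>C\<bar> * BM_norm \<tau> (g - f) < d)" by blast
    qed
    then show ?thesis using sn by (simp add: cont_seminorms_def)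
  next
    case Roumieu
    let ?TT = "{BM_rho M (real n) | n. 1 \<le> n} :: ('a \<Rightarrow> real) topology set"
    have V: "(\<Union>T\<in>?TT. topspace T) = topspace (BM_real s M)" unfolding Roumieu by simp
    show ?thesis
      unfolding Roumieu BM_real.simps
    proof (rule lc_ind_limit_seminorm)
      fix T assume "T \<in> ?TT"
      then obtain m where m: "T = BM_rho M (real m)" "1 \<le> m" by blast
      then have m0: "real m > 0" by simp
      obtain C where "\<And>n. real m ^ length (vs n) \<le> C * \<sigma> n ^ length (vs n)"
        using \<sigma> m0 unfolding Roumieu test_weights_def for_rho_dual.simps by blast
      then have C: "real m ^ length (vs n) * weight_fact M (length (vs n))
          \<le> C * \<sigma> n ^ length (vs n) * weight_fact M (length (vs n))" for n
        by (rule mult_right_mono) (use weight_fact_pos[OF M] in \<open>simp add: less_imp_le\<close>)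
      \<comment> \<open>The sign of \<open>C\<close> can be read off at any index;
        \<open>undefined\<close> merely names one.\<close>
      have C0: "0 \<le> C"
      proof (rule ccontr)
        assume "\<not> 0 \<le> C"
        then have "C * (\<sigma> undefined ^ length (vs undefined) * weight_fact M (length (vs undefined))) \<le> 0"
          using pos[of undefined "length (vs undefined)"] by (intro mult_nonpos_nonneg) auto
        moreover have "real m ^ length (vs undefined) * weight_fact M (length (vs undefined)) > 0"
          using m0 weight_fact_pos[OF M] by simp
        ultimately show False using C[of undefined] by (simp add: mult.assoc)
      qed
      have sub: "topspace (BM_rho M (real m)) \<subseteq> (topspace (BM_real s M) :: ('a \<Rightarrow> real) set)" using m(2) unfolding V[symmetric] by blast
      have "(\<lambda>f. SUP n. \<bar>e n f\<bar>) \<in> cont_seminorms (BM_rho M (real m))"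
        by (rule continuous_map_dominated[OF locally_convex_BM_rho[OF m0] seminorm_on_subset[OF sn sub]
              cont_seminorms_mult[OF BM_norm_cont_seminorm[OF m0] C0] rho[OF _ m0 C]])
      then show "continuous_map T euclideanreal (\<lambda>f. SUP n. \<bar>e n f\<bar>)" by (simp add: m(1) cont_seminorms_def)
    next
      show "subspace (\<Union>T\<in>?TT. topspace T)" unfolding V by (rule subspace_BM_real)
      show "seminorm_on (\<Union>T\<in>?TT. topspace T) (\<lambda>f. SUP n. \<bar>e n f\<bar>)" unfolding V by (rule sn)
    qed
  qed
qed

end

section \<open>Bounded sets of ultradifferentiable test functions\<close>

text \<open>A uniform boundedness principle for \<open>\<ell>\<^sup>1\<close>, proved by a gliding hump: the weights \<open>\<gamma>\<^sub>k\<close> are chosen so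
  small that the later terms do not disturb the large value produced at step \<open>k\<close>.\<close>

lemma gliding_hump:
  fixes a :: "'i \<Rightarrow> 'j \<Rightarrow> real"
  assumes col: "\<And>j. \<exists>C. \<forall>i. \<bar>a i j\<bar> \<le> C"
    and sum: "\<And>\<nu> c. summable (\<lambda>k. \<bar>c k\<bar>) \<Longrightarrow> \<exists>C. \<forall>j. \<bar>\<Sum>k. c k * a (\<nu> k) j\<bar> \<le> C"
  shows "\<exists>C. \<forall>i j. \<bar>a i j\<bar> \<le> C"
proof (rule ccontr)
  assume "\<not> (\<exists>C. \<forall>i j. \<bar>a i j\<bar> \<le> C)"
  then have unb: "\<exists>i j. \<bar>a i j\<bar> > C" for C by (meson not_le)
  obtain A where A: "\<And>i j. \<bar>a i j\<bar> \<le> A j" using col by metis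
  have A0: "A j \<ge> 0" for j using A[of undefined j] by linarith
  have "\<exists>C. \<forall>j. \<bar>a i j\<bar> \<le> C" for i
  proof -
    \<comment> \<open>A unit vector as coefficient sequence shows that each row \<open>a i\<close>
      is bounded in \<open>j\<close>.\<close>
    let ?c = "\<lambda>k::nat. if k = 0 then 1 else 0 :: real"
    have "summable (\<lambda>k. \<bar>?c k\<bar>)" by (rule summable_finite[of "{0}"]) auto
    from sum[OF this, of "\<lambda>_. i"] obtain C where C: "\<And>j. \<bar>\<Sum>k. ?c k * a i j\<bar> \<le> C" by blast
    have "(\<Sum>k. ?c k * a i j) = a i j" for j using suminf_finite[of "{0}" "\<lambda>k. ?c k * a i j"] by simp
    then show ?thesis using C by auto
  qed
  then obtain B where B: "\<And>i j. \<bar>a i j\<bar> \<le> B i" by metis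
  \<comment> \<open>The power of 1/2 makes the coefficients summable. The divisor
    \<open>1 + S\<close>, with \<open>S\<close> the sum of the column bounds met so far, makes all
    later terms negligible in the columns already chosen.\<close>
  define g where "g k S = (1 / 2) ^ k / (1 + S)" for k and S :: real
  \<comment> \<open>The threshold is a budget: \<open>P\<close> pays for the earlier terms, 2 for
    the tail, which lies below a geometric series, and \<open>k\<close> is what must remain. Stating
    \<open>S \<ge> 0\<close> inside allows the choice to be made for all arguments.\<close>
  have ex: "\<exists>p. S \<ge> 0 \<longrightarrow> g k S * \<bar>a (fst p) (snd p)\<bar> > real k + 2 + P" for k S P
  proof (cases "S \<ge> 0")
    case True
    then have pos: "g k S > 0" by (simp add: g_def)
    obtain i j where "\<bar>a i j\<bar> > (real k + 2 + P) / g k S" using unb by blast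
    then have "g k S * \<bar>a i j\<bar> > real k + 2 + P" using pos by (simp add: pos_divide_less_eq mult.commute)
    then show ?thesis by (intro exI[of _ "(i, j)"]) simp
  qed auto
  define fp where "fp k S P = (SOME p. S \<ge> 0 \<longrightarrow> g k S * \<bar>a (fst p) (snd p)\<bar> > real k + 2 + P)" for k S P
  define fi fj where "fi k S P = fst (fp k S P)" and "fj k S P = snd (fp k S P)" for k S P
  have pick: "g k S * \<bar>a (fi k S P) (fj k S P)\<bar> > real k + 2 + P" if "S \<ge> 0" for k S P
    using someI_ex[OF ex[of S k P]] that unfolding fi_def fj_def fp_def by blast
  \<comment> \<open>The state \<open>(P, S)\<close> records the weighted row bounds already spent,
    which control the earlier terms in a new column, and the column bounds already met, which fix
    the next coefficient.\<close>
  define st where "st = rec_nat (0, 0) (\<lambda>k (P, S). (P + g k S * B (fi k S P), S + A (fj k S P)))"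
  define P where "P k = fst (st k)" for k
  define S where "S k = snd (st k)" for k
  define i where "i k = fi k (S k) (P k)" for k
  define j where "j k = fj k (S k) (P k)" for k
  define \<gamma> where "\<gamma> k = g k (S k)" for k
  have P: "P 0 = 0" "\<And>k. P (Suc k) = P k + \<gamma> k * B (i k)"
    and S: "S 0 = 0" "\<And>k. S (Suc k) = S k + A (j k)"
    by (simp_all add: P_def S_def st_def i_def j_def \<gamma>_def split: prod.split)
  have S0: "S k \<ge> 0" for k by (induction k) (use A0 in \<open>auto simp: S\<close>)
  have big: "\<gamma> k * \<bar>a (i k) (j k)\<bar> > real k + 2 + P k" for k
    using pick[OF S0[of k]] by (simp add: i_def j_def \<gamma>_def)
  have \<gamma>0: "\<gamma> k \<ge> 0" for k using S0[of k] by (simp add: \<gamma>_def g_def)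
  have P_sum: "P k = (\<Sum>l<k. \<gamma> l * B (i l))" for k by (induction k) (auto simp: P)
  have S_ge: "A (j n) \<le> S l" if "n < l" for n l
    using that
  proof (induction l)
    case (Suc l)
    show ?case
    proof (cases "n = l")
      case True
      then show ?thesis using S0[of l] S(2) by simp
    next
      case False
      then have "A (j n) \<le> S l" using Suc by simp
      then show ?thesis using A0[of "j l"] S(2)[of l] by simp
    qed
  qed simp
  have \<gamma>_le: "\<gamma> k * C \<le> (1 / 2) ^ k" if "C \<le> S k" for k C
  proof -
    have "C / (1 + S k) \<le> 1" using that S0[of k] by simp
    then have "(1 / 2) ^ k * (C / (1 + S k)) \<le> (1 / 2) ^ k * 1" by (intro mult_left_mono) auto
    then show ?thesis by (simp add: \<gamma>_def g_def)
  qed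
  have \<gamma>_pow: "\<gamma> k \<le> (1 / 2) ^ k" for k
  proof -
    have "(1 / 2) ^ k / (1 + S k) \<le> (1 / 2) ^ k / 1"
      by (rule divide_left_mono) (use S0[of k] in auto)
    then show ?thesis by (simp add: \<gamma>_def g_def)
  qed
  have geo: "summable (\<lambda>k. (1 / 2 :: real) ^ k)" by (rule summable_geometric) simp
  have "summable (\<lambda>k. \<bar>\<gamma> k\<bar>)"
    by (rule summable_comparison_test'[OF geo, of 0]) (use \<gamma>0 \<gamma>_pow in simp)
  then obtain C where C: "\<And>j. \<bar>\<Sum>k. \<gamma> k * a (i k) j\<bar> \<le> C" using sum[of \<gamma> i] by blast
  obtain n where n: "C < real n" using reals_Archimedean2 by blast
  let ?f = "\<lambda>k. \<gamma> k * a (i k) (j n)"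
  have abs_f: "\<bar>?f k\<bar> = \<gamma> k * \<bar>a (i k) (j n)\<bar>" for k using \<gamma>0[of k] by (simp add: abs_mult)
  have "summable ?f"
  proof (rule summable_comparison_test'[OF summable_mult[OF geo, of "A (j n)"], of 0])
    fix k
    have "\<gamma> k * \<bar>a (i k) (j n)\<bar> \<le> (1 / 2) ^ k * A (j n)"
      using \<gamma>_pow[of k] A[of "i k" "j n"] by (intro mult_mono) auto
    then show "norm (?f k) \<le> A (j n) * (1 / 2) ^ k" using abs_f[of k] by (simp add: mult.commute)
  qed
  then have split: "suminf ?f = (\<Sum>k. ?f (k + Suc n)) + (\<Sum>k<Suc n. ?f k)"
    by (rule suminf_split_initial_segment)
  have tail: "\<bar>\<Sum>k. ?f (k + Suc n)\<bar> \<le> 2"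
  proof -
    have le: "norm (?f (k + Suc n)) \<le> (1 / 2) ^ k" for k
    proof -
      have "\<gamma> (k + Suc n) * \<bar>a (i (k + Suc n)) (j n)\<bar> \<le> \<gamma> (k + Suc n) * A (j n)"
        using \<gamma>0 A by (intro mult_left_mono) auto
      also have "\<dots> \<le> (1 / 2) ^ (k + Suc n)" by (rule \<gamma>_le[OF S_ge]) simp
      also have "\<dots> \<le> (1 / 2) ^ k" by (rule power_decreasing) auto
      finally show ?thesis using abs_f[of "k + Suc n"] by simp
    qed
    have "norm (\<Sum>k. ?f (k + Suc n)) \<le> (\<Sum>k. (1 / 2 :: real) ^ k)"
      by (rule norm_suminf_le[OF le geo])
    also have "\<dots> = 2" by (subst suminf_geometric) auto
    finally show ?thesis by simp
  qed
  have head: "\<bar>\<Sum>k<n. ?f k\<bar> \<le> P n"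
    unfolding P_sum
  proof (rule order_trans[OF sum_abs sum_mono])
    fix k
    show "\<bar>?f k\<bar> \<le> \<gamma> k * B (i k)" unfolding abs_f using \<gamma>0 B by (intro mult_left_mono) auto
  qed
  have "suminf ?f = (\<Sum>k. ?f (k + Suc n)) + (\<Sum>k<n. ?f k) + ?f n" using split by simp
  then have "\<bar>?f n\<bar> \<le> C + 2 + P n" using C[of "j n"] tail head by linarith
  then show False using big[of n] n abs_f[of n] by linarith
qed

lemma comp_add_fun:
  assumes "linear_on_set V l" "\<And>x. f x \<in> V" "\<And>x. g x \<in> V"
  shows "l \<circ> (f + g) = (l \<circ> f) + (l \<circ> g)"
  by (rule ext) (simp add: linear_on_setD(1)[OF assms(1)] assms(2,3))

lemma comp_scale_fun:
  assumes "linear_on_set V l" "\<And>x. f x \<in> V"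
  shows "l \<circ> (c *\<^sub>R f) = c *\<^sub>R (l \<circ> f)"
  by (rule ext) (simp add: linear_on_setD(2)[OF assms(1)] assms(2))

section \<open>Carriers, functionals and bounded sets of \<open>DMspace\<close>\<close>

text \<open>The sequence \<open>a\<close> is chosen for each functional but shared by all of
  \<open>B\<close>. For singletons this is the condition of membership in the space with global
  bounds, so that one notion describes both carriers and bounded sets.\<close>

definition ultra_bounded ::
    "ultra_case \<Rightarrow> (nat \<Rightarrow> real) \<Rightarrow> 'v::real_vector topology \<Rightarrow> ('a::euclidean_space \<Rightarrow> 'v) set \<Rightarrow> bool" where
  "ultra_bounded s M T B \<longleftrightarrow> (\<forall>f\<in>B. smooth_into T f) \<and>
     (\<forall>l\<in>dual_space T. \<exists>a. ultra_seq s M a \<and> (\<forall>f\<in>B. dominated a (l \<circ> f)))"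

context
  fixes M :: "nat \<Rightarrow> real"
  assumes M: "weight_sequence M"
begin

text \<open>Global bounds restrict to compact sets; the carrier of \<open>CMK\<close> can therefore
  be described by the global bounds together with the support.\<close>

lemma BM_real_subset_CM_real:
  assumes "f \<in> topspace (BM_real s M)"
  shows "f \<in> CM_real s M"
proof -
  have sub: "weighted_derivs M \<rho> K f \<subseteq> weighted_derivs M \<rho> UNIV f" for \<rho> K
    unfolding weighted_derivs_def by blast
  have "for_rho s (\<lambda>\<rho>. smooth_into euclideanreal f \<and> (\<forall>K. bdd_above (weighted_derivs M \<rho> K f)))"
    using assms unfolding topspace_BM_real_for_rho[OF M]
    by (rule for_rho_mono) (auto simp: topspace_BM_rho[OF M] intro: bdd_above_mono[OF _ sub])
  then show ?thesis by (cases s) (auto intro: zero_less_one)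
qed

lemma topspace_CMK:
  "topspace (CMK s M K T) =
    {f. smooth_into T f \<and> (\<forall>l\<in>dual_space T. l \<circ> f \<in> topspace (BM_real s M)) \<and> (\<forall>x. x \<notin> K \<longrightarrow> f x = 0)}"
  unfolding CMK_def BM_def CM_def topspace_subtopology topspace_initial_topology
  using BM_real_subset_CM_real by blast

lemma topspace_CMK_ultra_bounded:
  "f \<in> topspace (CMK s M K T) \<longleftrightarrow> ultra_bounded s M T {f} \<and> (\<forall>x. x \<notin> K \<longrightarrow> f x = 0)"
  unfolding topspace_CMK ultra_bounded_def by (auto simp: topspace_BM_real[OF M])

lemma subspace_CMK:
  assumes T: "separated_lc T"
  shows "subspace (topspace (CMK s M K T))"
proof (rule subspaceI)
  show "0 \<in> topspace (CMK s M K T)"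
  proof -
    have "l \<circ> 0 = (0 :: 'b \<Rightarrow> real)" if "l \<in> dual_space T" for l
      using linear_on_set_0[OF dual_spaceD(1)[OF that] subspace_0[OF separated_lcD(2)[OF T]]]
      by (simp add: o_def zero_fun_def)
    moreover have "(0 :: 'b \<Rightarrow> real) \<in> topspace (BM_real s M)" by (rule subspace_0[OF subspace_BM_real[OF M]])
    moreover have "smooth_into T (0 :: 'b \<Rightarrow> 'a)" using smooth_into_zero(1)[OF T] by (simp add: zero_fun_def)
    ultimately show ?thesis by (simp add: topspace_CMK)
  qed
next
  fix f g :: "'b \<Rightarrow> 'a" assume f: "f \<in> topspace (CMK s M K T)" and g: "g \<in> topspace (CMK s M K T)"
  then have sm: "smooth_into T f" "smooth_into T g" by (auto simp: topspace_CMK)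
  have "l \<circ> (f + g) \<in> topspace (BM_real s M)" if l: "l \<in> dual_space T" for l
    unfolding comp_add_fun[OF dual_spaceD(1)[OF l] smooth_into_in_topspace[OF sm(1)] smooth_into_in_topspace[OF sm(2)]]
    using f g l by (intro subspace_add[OF subspace_BM_real[OF M]]) (auto simp: topspace_CMK)
  moreover have "smooth_into T (f + g)" using smooth_into_add(1)[OF T sm] by (simp add: plus_fun_def)
  ultimately show "f + g \<in> topspace (CMK s M K T)" using f g by (auto simp: topspace_CMK)
next
  fix c and f :: "'b \<Rightarrow> 'a" assume f: "f \<in> topspace (CMK s M K T)"
  then have sm: "smooth_into T f" by (auto simp: topspace_CMK)
  have "l \<circ> (c *\<^sub>R f) \<in> topspace (BM_real s M)" if l: "l \<in> dual_space T" for l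
    unfolding comp_scale_fun[OF dual_spaceD(1)[OF l] smooth_into_in_topspace[OF sm]]
    using f l by (intro subspace_scale[OF subspace_BM_real[OF M]]) (auto simp: topspace_CMK)
  moreover have "smooth_into T (c *\<^sub>R f)"
    using smooth_into_scale(1)[OF T sm, where c = c] by (simp add: scaleR_fun_def)
  ultimately show "c *\<^sub>R f \<in> topspace (CMK s M K T)" using f by (auto simp: topspace_CMK)
qed

lemma subspace_Union_CMK:
  assumes T: "separated_lc T"
  shows "subspace (\<Union>S\<in>{CMK s M K T | K. compact (K :: 'a::euclidean_space set)}. topspace S)"
  by (rule subspace_Union_compact[OF subspace_CMK[OF T]]) (auto simp: topspace_CMK)

lemma locally_convex_DMspace:
  assumes T: "separated_lc T"
  shows "locally_convex (DMspace s M T :: ('a::euclidean_space \<Rightarrow> 'v::real_vector) topology)"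
  unfolding DMspace_def by (rule locally_convex_lc_ind_limit[OF subspace_Union_CMK[OF T]])

lemma topspace_DMspace:
  "f \<in> topspace (DMspace s M T) \<longleftrightarrow> (\<exists>K. compact K \<and> f \<in> topspace (CMK s M K T))"
  unfolding DMspace_def by auto

lemma CMK_compose_continuous:
  assumes l: "l \<in> dual_space T" and q: "q \<in> cont_seminorms (BM_real s M)"
  shows "continuous_map (CMK s M K T) euclideanreal (\<lambda>f. q (l \<circ> f))"
proof -
  have "continuous_map (BM s M T) (BM_real s M) (\<lambda>f. l \<circ> f)"
    unfolding continuous_map_def
  proof (intro conjI allI impI)
    fix U assume U: "openin (BM_real s M) U"
    show "openin (BM s M T) {f \<in> topspace (BM s M T). l \<circ> f \<in> U}"
      unfolding BM_def topspace_initial_topology unfolding initial_topology_def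
      by (rule topology_generated_by_Basis, rule insertI2, rule CollectI, intro exI conjI, rule refl, rule l, rule U)
  qed (use l in \<open>auto simp: BM_def\<close>)
  then have "continuous_map (CMK s M K T) (BM_real s M) (\<lambda>f. l \<circ> f)"
    unfolding CMK_def by (rule continuous_map_from_subtopology)
  moreover have "continuous_map (BM_real s M) euclideanreal q" using q by (simp add: cont_seminorms_def)
  ultimately have "continuous_map (CMK s M K T) euclideanreal (q \<circ> (\<lambda>f. l \<circ> f))" by (rule continuous_map_compose)
  then show ?thesis by (simp only: o_def)
qed

lemma DMspace_cont_seminorm:
  fixes T :: "'v::real_vector topology"
  assumes T: "separated_lc T" and l: "l \<in> dual_space T" and q: "q \<in> cont_seminorms (BM_real s M)"
  shows "(\<lambda>f. q (l \<circ> f)) \<in> cont_seminorms (DMspace s M T :: ('a::euclidean_space \<Rightarrow> 'v) topology)"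
  unfolding DMspace_def
proof (rule lc_ind_limit_seminorm[OF subspace_Union_CMK[OF T]])
  let ?V = "\<Union>S\<in>{CMK s M K T | K. compact (K :: 'a set)}. topspace S"
  have fV: "f x \<in> topspace T" "l \<circ> f \<in> topspace (BM_real s M)" if "f \<in> ?V" for f x
    using that l by (auto simp: topspace_CMK intro: smooth_into_in_topspace)
  have "linear_on_set ?V (\<lambda>f. l \<circ> f)"
    unfolding linear_on_set_def
    by (intro conjI ballI allI comp_add_fun[OF dual_spaceD(1)[OF l] fV(1) fV(1)]
        comp_scale_fun[OF dual_spaceD(1)[OF l] fV(1)])
  then show "seminorm_on ?V (\<lambda>f. q (l \<circ> f))"
    by (rule seminorm_on_linear[where W = "topspace (BM_real s M)"]) (use q fV(2) in \<open>auto simp: cont_seminorms_def\<close>)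
  fix S assume "S \<in> {CMK s M K T | K. compact (K :: 'a set)}"
  then show "continuous_map S euclideanreal (\<lambda>f. q (l \<circ> f))" using CMK_compose_continuous[OF l q] by blast
qed

lemma BM_real_eval_cont_seminorm:
  "(\<lambda>f. \<bar>f x\<bar>) \<in> cont_seminorms (BM_real s M :: ('a::euclidean_space \<Rightarrow> real) topology)"
  using BM_real_test_seminorm(1)[OF M, where \<sigma> = "\<lambda>_. 1" and vs = "\<lambda>_. []" and x = "\<lambda>_ :: nat. x"]
  by (simp add: weight_fact_0[OF M] test_weights_const)

lemma DMspace_eval_dual:
  fixes T :: "'v::real_vector topology" and x :: "'a::euclidean_space"
  assumes T: "separated_lc T" and l: "l \<in> dual_space T"
  shows "(\<lambda>f. l (f x)) \<in> dual_space (DMspace s M T)"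
proof (rule dual_spaceI[OF locally_convex_DMspace[OF T] _ DMspace_cont_seminorm[OF T l BM_real_eval_cont_seminorm[of x]]])
  have "f x \<in> topspace T" if "f \<in> topspace (DMspace s M T)" for f :: "'a \<Rightarrow> 'v"
    using that by (auto simp: topspace_DMspace topspace_CMK intro: smooth_into_in_topspace)
  then show "linear_on_set (topspace (DMspace s M T)) (\<lambda>f. l (f x))"
    by (simp add: linear_on_set_def linear_on_setD[OF dual_spaceD(1)[OF l]])
qed simp

lemma separated_lc_DMspace:
  fixes T :: "'v::real_vector topology"
  assumes T: "separated_lc T"
  shows "separated_lc (DMspace s M T :: ('a::euclidean_space \<Rightarrow> 'v) topology)"
  unfolding separated_lc_def
proof (intro conjI ballI impI locally_convex_DMspace[OF T])
  fix f :: "'a \<Rightarrow> 'v" assume f: "f \<in> topspace (DMspace s M T)" "f \<noteq> 0"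
  then obtain x where x: "f x \<noteq> 0" by (auto simp: fun_eq_iff)
  have "f x \<in> topspace T"
    using f(1) by (auto simp: topspace_DMspace topspace_CMK intro: smooth_into_in_topspace)
  then obtain l where l: "l \<in> dual_space T" "l (f x) \<noteq> 0" using T x unfolding separated_lc_def by blast
  then show "\<exists>l\<in>dual_space (DMspace s M T). l f \<noteq> 0"
    using DMspace_eval_dual[OF T l(1), of x s] by (intro bexI[of _ "\<lambda>f. l (f x)"]) auto
qed

lemma limitin_CMK_null_sequence:
  fixes T :: "'v::real_vector topology" and b :: "nat \<Rightarrow> 'a::euclidean_space \<Rightarrow> 'v"
  assumes T: "separated_lc T" and B: "ultra_bounded s M T B" and b: "\<And>n. b n \<in> B"
    and K: "\<forall>f\<in>B. \<forall>x. x \<notin> K \<longrightarrow> f x = 0"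
  shows "limitin (CMK s M K T) (\<lambda>n. inverse (real (Suc n)) *\<^sub>R b n) 0 sequentially"
proof -
  have "b n \<in> topspace (CMK s M K T)" for n
    using B b K unfolding topspace_CMK_ultra_bounded ultra_bounded_def by blast
  then have mem: "inverse (real (Suc n)) *\<^sub>R b n \<in> topspace (CMK s M K T)" for n
    by (rule subspace_scale[OF subspace_CMK[OF T]])
  have z: "(0 :: 'a \<Rightarrow> 'v) \<in> topspace (CMK s M K T)" by (rule subspace_0[OF subspace_CMK[OF T]])
  have "limitin (BM s M T) (\<lambda>n. inverse (real (Suc n)) *\<^sub>R b n) 0 sequentially"
    unfolding BM_def
  proof (rule limitin_initial_topology)
    let ?V = "{f. smooth_into T f \<and> (\<forall>l\<in>dual_space T. l \<circ> f \<in> topspace (BM_real s M))}"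
    show "(0 :: 'a \<Rightarrow> 'v) \<in> ?V" using z by (simp add: topspace_CMK)
    show "\<forall>\<^sub>F n in sequentially. inverse (real (Suc n)) *\<^sub>R b n \<in> ?V"
      using mem by (intro always_eventually) (simp add: topspace_CMK)
    fix l assume l: "l \<in> dual_space T"
    obtain a where a: "ultra_seq s M a" "\<And>f. f \<in> B \<Longrightarrow> dominated a (l \<circ> f)"
      using B l unfolding ultra_bounded_def by blast
    have sm: "smooth_into T (b n)" for n using B b by (auto simp: ultra_bounded_def)
    have "l \<circ> 0 = (0 :: 'a \<Rightarrow> real)"
      using linear_on_set_0[OF dual_spaceD(1)[OF l] subspace_0[OF separated_lcD(2)[OF T]]]
      by (simp add: o_def zero_fun_def)
    then show "limitin (BM_real s M) (\<lambda>n. l \<circ> (inverse (real (Suc n)) *\<^sub>R b n)) (l \<circ> 0) sequentially"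
      unfolding comp_scale_fun[OF dual_spaceD(1)[OF l] smooth_into_in_topspace[OF sm]]
      using limitin_BM_real_null_sequence[OF M a(1) a(2)[OF b]] by simp
  qed
  then show ?thesis
    unfolding CMK_def limitin_subtopology
    using mem z by (auto simp: CMK_def intro!: always_eventually)
qed

text \<open>If the functions \<open>l \<circ> f\<close> have no common estimate, test weights arise;
  the corresponding seminorm of \<open>BM_real\<close>, composed with \<open>l\<close>, is
  continuous on the limit and unbounded on \<open>B\<close>. Conversely, a defining seminorm of the
  limit unbounded on \<open>B\<close> contradicts the convergence of suitable
  \<open>b n / (n + 1)\<close> to zero in the step \<open>K\<close>. That half argues with sequences
  because the steps carry initial topologies rather than seminorms.\<close>

lemma bounded_in_DMspace:
  fixes T :: "'v::real_vector topology" and B :: "('a::euclidean_space \<Rightarrow> 'v) set"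
  assumes T: "separated_lc T"
  shows "bounded_in (DMspace s M T) B \<longleftrightarrow>
    (\<exists>K. compact K \<and> (\<forall>f\<in>B. \<forall>x. x \<notin> K \<longrightarrow> f x = 0)) \<and> ultra_bounded s M T B" (is "?L \<longleftrightarrow> ?R")
proof
  assume L: ?L
  note b = L[unfolded bounded_in_locally_convex[OF locally_convex_DMspace[OF T]]]
  have supp: "\<exists>K. compact K \<and> (\<forall>f\<in>B. \<forall>x. x \<notin> K \<longrightarrow> f x = 0)"
  proof (rule bounded_in_common_support[OF subspace_Union_CMK[OF T] _ separated_lcD(2)[OF T] _ _ _ _ L[unfolded DMspace_def],
        where N = "(\<lambda>l v. \<bar>l v\<bar>) ` dual_space T"])
    show "f x = 0" if "f \<in> topspace (CMK s M K T)" "x \<notin> K" for f :: "'a \<Rightarrow> 'v" and x K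
      using that by (simp add: topspace_CMK)
    show "f x \<in> topspace T" if "f \<in> topspace (CMK s M K T)" for f :: "'a \<Rightarrow> 'v" and x K
      using that by (simp add: topspace_CMK smooth_into_in_topspace)
    show "seminorm_on (topspace T) q" if "q \<in> (\<lambda>l v. \<bar>l v\<bar>) ` dual_space T" for q
      using that dual_space_abs[of _ T] locally_convexD(3)[OF separated_lcD(1)[OF T]] by auto
    show "continuous_map (CMK s M K T) euclideanreal (\<lambda>f. q (f x))"
      if q: "q \<in> (\<lambda>l v. \<bar>l v\<bar>) ` dual_space T" for q and x :: 'a and K
    proof -
      obtain l where l: "l \<in> dual_space T" "q = (\<lambda>v. \<bar>l v\<bar>)" using q by blast
      show ?thesis
        using CMK_compose_continuous[OF l(1) BM_real_eval_cont_seminorm[of x s], of K] by (simp add: l(2))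
    qed
    show "\<exists>q\<in>(\<lambda>l v. \<bar>l v\<bar>) ` dual_space T. q v \<noteq> 0" if "v \<in> topspace T" "v \<noteq> 0" for v
      using T that unfolding separated_lc_def by auto
  qed
  have BT: "B \<subseteq> topspace (DMspace s M T)" using b by blast
  then have sm: "smooth_into T f" and BR: "l \<in> dual_space T \<Longrightarrow> l \<circ> f \<in> topspace (BM_real s M)" if "f \<in> B" for f l
    using that by (auto simp: topspace_DMspace topspace_CMK dest!: subsetD)
  have dom: "\<exists>a. ultra_seq s M a \<and> (\<forall>f\<in>B. dominated a (l \<circ> f))" if l: "l \<in> dual_space T" for l
  proof -
    let ?I = "{i :: ('a \<Rightarrow> 'v) \<times> 'a list \<times> 'a. fst i \<in> B \<and> unit_vectors (fst (snd i))}"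
    let ?\<phi> = "\<lambda>i :: ('a \<Rightarrow> 'v) \<times> 'a list \<times> 'a. \<bar>iter_deriv euclideanreal (l \<circ> fst i) (fst (snd i)) (snd (snd i))\<bar>"
    let ?\<kappa> = "\<lambda>i :: ('a \<Rightarrow> 'v) \<times> 'a list \<times> 'a. length (fst (snd i))"
    have "for_rho s (\<lambda>\<rho>. \<exists>C. \<forall>i\<in>?I. ?\<phi> i \<le> C * \<rho> ^ ?\<kappa> i * weight_fact M (?\<kappa> i))"
    proof (rule ccontr)
      assume "\<not> for_rho s (\<lambda>\<rho>. \<exists>C. \<forall>i\<in>?I. ?\<phi> i \<le> C * \<rho> ^ ?\<kappa> i * weight_fact M (?\<kappa> i))"
      from not_for_rho_test_seq[OF this] obtain \<sigma> \<iota> where \<sigma>: "test_seq s \<sigma>"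
        and \<iota>: "\<And>n. \<iota> n \<in> ?I" "\<And>n. ?\<phi> (\<iota> n) > real n * \<sigma> n ^ ?\<kappa> (\<iota> n) * weight_fact M (?\<kappa> (\<iota> n))" by blast
      define f vs x where "f n = fst (\<iota> n)" and "vs n = fst (snd (\<iota> n))" and "x n = snd (snd (\<iota> n))" for n
      have f: "f n \<in> B" and vs: "unit_vectors (vs n)"
        and gt: "\<bar>iter_deriv euclideanreal (l \<circ> f n) (vs n) (x n)\<bar>
          > real n * \<sigma> n ^ length (vs n) * weight_fact M (length (vs n))" for n
        using \<iota>(1)[of n] \<iota>(2)[of n] by (simp_all add: f_def vs_def x_def)
      define e where "e n g = iter_deriv euclideanreal g (vs n) (x n) / (\<sigma> n ^ length (vs n) * weight_fact M (length (vs n)))"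
        for n g
      have "(\<lambda>g. SUP n. \<bar>e n g\<bar>) \<in> cont_seminorms (BM_real s M)"
        unfolding e_def by (rule BM_real_test_seminorm(1)[OF M test_seq_weights[OF \<sigma>] vs])
      from bspec[OF conjunct2[OF b] DMspace_cont_seminorm[OF T l this]]
      obtain C where C: "\<And>g. g \<in> B \<Longrightarrow> (SUP n. \<bar>e n (l \<circ> g)\<bar>) \<le> C" by auto
      obtain n where n: "C < real n" using reals_Archimedean2 by blast
      have pos: "\<sigma> n ^ length (vs n) * weight_fact M (length (vs n)) > 0"
        using test_seq_pos[OF \<sigma>, of n] weight_fact_pos[OF M] by simp
      have "real n < \<bar>e n (l \<circ> f n)\<bar>"
        using gt[of n] pos by (simp add: e_def abs_divide pos_less_divide_eq mult.assoc)
      also have "\<dots> \<le> (SUP m. \<bar>e m (l \<circ> f n)\<bar>)"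
        unfolding e_def by (rule BM_real_test_seminorm(2)[OF M test_seq_weights[OF \<sigma>] vs BR[OF f l]])
      also have "\<dots> \<le> C" by (rule C[OF f])
      finally show False using n by simp
    qed
    then obtain a where a: "ultra_seq s M a" "\<And>i. i \<in> ?I \<Longrightarrow> ?\<phi> i \<le> a (?\<kappa> i)"
      unfolding ex_ultra_seq_iff[OF M, symmetric] by blast
    have "dominated a (l \<circ> f)" if f: "f \<in> B" for f
      unfolding dominated_real_iff
    proof (intro conjI allI impI smooth_into_dual(1)[OF T l sm[OF f]])
      fix vs :: "'a list" and x assume "unit_vectors vs"
      then show "\<bar>iter_deriv euclideanreal (l \<circ> f) vs x\<bar> \<le> a (length vs)"
        using a(2)[of "(f, vs, x)"] f by simp
    qed
    with a(1) show ?thesis by blast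
  qed
  show ?R unfolding ultra_bounded_def by (intro conjI ballI supp sm dom)
next
  assume R: ?R
  then obtain K where K: "compact K" "\<forall>f\<in>B. \<forall>x. x \<notin> K \<longrightarrow> f x = 0" by blast
  have ub: "ultra_bounded s M T B" using R by blast
  let ?TT = "{CMK s M K T | K. compact (K :: 'a set)}"
  have KT: "CMK s M K T \<in> ?TT" using K(1) by blast
  have BK: "B \<subseteq> topspace (CMK s M K T)"
    using ub K(2) unfolding topspace_CMK_ultra_bounded ultra_bounded_def subset_iff by blast
  show ?L
    unfolding DMspace_def lc_ind_limit_def
  proof (rule bounded_in_seminorm_topology[THEN iffD2, OF subspace_Union_CMK[OF T]])
    let ?P = "{p. seminorm_on (\<Union>S\<in>?TT. topspace S) p \<and> (\<forall>S\<in>?TT. continuous_map S euclideanreal p)}"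
    show "B \<subseteq> (\<Union>S\<in>?TT. topspace S) \<and> (\<forall>p\<in>?P. \<exists>C. \<forall>f\<in>B. p f \<le> C)"
    proof (intro conjI ballI)
      show "B \<subseteq> (\<Union>S\<in>?TT. topspace S)" using BK KT by blast
      fix p assume p: "p \<in> ?P"
      then have sn: "seminorm_on (topspace (CMK s M K T)) p" and c: "continuous_map (CMK s M K T) euclideanreal p"
        using KT seminorm_on_subset[of "\<Union>S\<in>?TT. topspace S" p "topspace (CMK s M K T)"] by blast+
      show "\<exists>C. \<forall>f\<in>B. p f \<le> C"
      proof (rule ccontr)
        assume "\<not> (\<exists>C. \<forall>f\<in>B. p f \<le> C)"
        then have "\<forall>n. \<exists>f. f \<in> B \<and> p f > real (Suc n)" by (meson not_le)
        then obtain b where b: "\<And>n. b n \<in> B" "\<And>n. p (b n) > real (Suc n)" by metis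
        have "(\<lambda>n. p (inverse (real (Suc n)) *\<^sub>R b n)) \<longlonglongrightarrow> p 0"
          using limitin_linear[OF c limitin_CMK_null_sequence[OF T ub b(1) K(2)]] by simp
        then have "(\<lambda>n. p (inverse (real (Suc n)) *\<^sub>R b n)) \<longlonglongrightarrow> 0"
          using seminorm_on_0[OF sn subspace_0[OF subspace_CMK[OF T]]] by simp
        then have "\<forall>\<^sub>F n in sequentially. p (inverse (real (Suc n)) *\<^sub>R b n) < 1"
          by (rule order_tendstoD(2)) simp
        then obtain n where n: "p (inverse (real (Suc n)) *\<^sub>R b n) < 1"
          using eventually_happens'[OF sequentially_bot] by blast
        have "p (inverse (real (Suc n)) *\<^sub>R b n) = inverse (real (Suc n)) * p (b n)"
          using seminorm_onD(3)[OF sn subsetD[OF BK b(1)], of "inverse (real (Suc n))" n] by simp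
        then have "p (b n) / real (Suc n) < 1" using n by (simp only: divide_inverse mult.commute)
        then have "p (b n) < real (Suc n)" by (simp add: pos_divide_less_eq)
        then show False using b(2)[of n] by simp
      qed
    qed
  qed auto
qed

end

section \<open>Currying is smooth\<close>

lemma cont_seminorm_euclidean_bound:
  fixes p :: "'c::euclidean_space \<Rightarrow> real"
  assumes "p \<in> cont_seminorms euclidean"
  shows "\<exists>c\<ge>0. \<forall>v. p v \<le> c * norm v"
proof -
  have sn: "seminorm_on UNIV p" using assms by (simp add: cont_seminorms_def)
  have sum_le: "p (\<Sum>b\<in>A. (v \<bullet> b) *\<^sub>R b) \<le> (\<Sum>b\<in>A. \<bar>v \<bullet> b\<bar> * p b)" if "finite A" for A and v :: 'c
    using that
  proof (induction A rule: finite_induct)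
    case empty
    then show ?case using seminorm_on_0[OF sn] by simp
  next
    case (insert b A)
    show ?case
      unfolding sum.insert[OF insert(1,2)]
      using seminorm_onD(2)[OF sn, of "(v \<bullet> b) *\<^sub>R b" "\<Sum>b\<in>A. (v \<bullet> b) *\<^sub>R b"]
        seminorm_onD(3)[OF sn, of b "v \<bullet> b"] insert.IH by simp
  qed
  have nn: "p b \<ge> 0" for b using seminorm_onD(1)[OF sn] by simp
  have "p v \<le> (\<Sum>b\<in>Basis. p b) * norm v" for v
  proof -
    have "p v \<le> (\<Sum>b\<in>Basis. \<bar>v \<bullet> b\<bar> * p b)"
      using sum_le[OF finite_Basis, of v] by (simp only: euclidean_representation)
    also have "\<dots> \<le> (\<Sum>b\<in>Basis. norm v * p b)"
      using nn by (intro sum_mono mult_right_mono Basis_le_norm) auto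
    finally show ?thesis by (simp only: sum_distrib_left[symmetric] mult.commute)
  qed
  then show ?thesis using nn by (intro exI[of _ "\<Sum>b\<in>Basis. p b"]) (simp add: sum_nonneg)
qed

lemma norm_scaleR_sgn: "norm u *\<^sub>R sgn u = (u :: 'a::real_normed_vector)"
  by (cases "u = 0") (simp_all add: sgn_div_norm)

lemma norm_sgn_le_1: "norm (sgn u :: 'a::real_normed_vector) \<le> 1"
  by (cases "u = 0") (simp_all add: norm_sgn)

text \<open>Directions of arbitrary length are replaced by their \<open>sgn\<close>, each
  contributing its norm; symmetry moves the new direction ahead of the unit vectors
  \<open>vs\<close>.\<close>

lemma dominated_iter_deriv:
  assumes "dominated a f"
  shows "dominated (\<lambda>k. prod_list (map norm us) * a (k + length us)) (iter_deriv euclidean f us)"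
proof (induction us)
  case Nil
  then show ?case using assms by simp
next
  case (Cons u us)
  let ?g = "iter_deriv euclidean f us"
  let ?c = "\<lambda>k. prod_list (map norm us) * a (k + length us)"
  have g: "smooth_into euclidean ?g" using dominatedD(1)[OF Cons] .
  have eq: "iter_deriv euclidean f (u # us) = iter_deriv euclidean ?g [u]" by simp
  show ?case
    unfolding dominated_def eq
  proof (intro conjI allI impI)
    show "smooth_into euclidean (iter_deriv euclidean ?g [u])" by (rule smooth_into_iter_deriv[OF g])
    fix vs :: "'a list" and x assume vs: "unit_vectors vs"
    have "iter_deriv euclidean (iter_deriv euclidean ?g [u]) vs x = iter_deriv euclidean ?g (u # vs) x"
      using iter_deriv_move[OF g, of vs u "[]"] by (simp only: iter_deriv_append[symmetric] append_Nil2 append_assoc append_Cons append_Nil)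
    also have "\<dots> = norm u *\<^sub>R iter_deriv euclidean ?g (sgn u # vs) x"
      using iter_deriv_scale_direction[OF g, of "norm u" "sgn u" vs x] by (simp only: norm_scaleR_sgn)
    also have "norm \<dots> \<le> norm u * ?c (Suc (length vs))"
      using dominatedD(2)[OF Cons, of "sgn u # vs" x] vs norm_sgn_le_1[of u]
      by (simp add: mult_left_mono del: iter_deriv.simps)
    finally show "norm (iter_deriv euclidean (iter_deriv euclidean ?g [u]) vs x)
        \<le> prod_list (map norm (u # us)) * a (length vs + length (u # us))"
      by (simp only: list.map prod_list.Cons length_Cons add_Suc_right add_Suc mult.assoc)
  qed
qed

lemma dominated_bound:
  assumes "dominated a f"
  shows "norm (iter_deriv euclidean f vs x) \<le> prod_list (map norm vs) * a (length vs)"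
  using dominatedD(2)[OF dominated_iter_deriv[OF assms, of vs], of "[]" x] by simp

lemma smooth_slice:
  fixes h :: "'a::euclidean_space \<times> 'b::euclidean_space \<Rightarrow> 'c::euclidean_space"
  assumes h: "smooth_into euclidean h"
  shows "smooth_into euclidean (\<lambda>y. h (x, y))"
    and "iter_deriv euclidean (\<lambda>y. h (x, y)) ws = (\<lambda>y. iter_deriv euclidean h (map (Pair 0) ws) (x, y))"
proof -
  let ?D = "\<lambda>ws y. iter_deriv euclidean h (map (Pair 0) ws) (x, y)"
  have cont: "continuous_map euclidean euclidean (?D ws)" for ws
    using continuous_on_compose2[OF iter_deriv_continuous[OF h], of UNIV "Pair x"] by (simp add: continuous_intros)
  have lim: "limitin euclidean (\<lambda>t. (?D ws (y + t *\<^sub>R w) - ?D ws y) /\<^sub>R t) (?D (w # ws) y) (at (0::real))" for ws w y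
    using iter_deriv_euclidean_tendsto[OF h, of "map (Pair 0) ws" "(x, y)" "(0, w)"]
    by (simp del: iter_deriv.simps)
  show "smooth_into euclidean (\<lambda>y. h (x, y))"
    by (rule smooth_intoI(1)[OF separated_lc_euclidean, of ?D]) (simp, rule cont, rule lim)
  show "iter_deriv euclidean (\<lambda>y. h (x, y)) ws = ?D ws"
    by (rule smooth_intoI(2)[OF separated_lc_euclidean, of ?D]) (simp, rule cont, rule lim)
qed

lemma smooth_into_diff_fun:
  assumes "separated_lc T" "smooth_into T f" "smooth_into T g"
  shows "smooth_into T (f - g)" "iter_deriv T (f - g) vs x = iter_deriv T f vs x - iter_deriv T g vs x"
proof -
  have eq: "f - g = f + (-1) *\<^sub>R g" by (simp add: fun_eq_iff)
  have g: "smooth_into T ((-1) *\<^sub>R g)"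
    using smooth_into_scale(1)[OF assms(1,3), where c = "-1"] by (simp only: scaleR_fun_def)
  show "smooth_into T (f - g)"
    using smooth_into_add(1)[OF assms(1,2) g] unfolding eq by (simp only: plus_fun_def)
  show "iter_deriv T (f - g) vs x = iter_deriv T f vs x - iter_deriv T g vs x"
    unfolding eq iter_deriv_add_fun[OF assms(1,2) g] iter_deriv_scale_fun[OF assms(1,3)] by simp
qed

lemma smooth_into_scale_fun:
  assumes "separated_lc T" "smooth_into T f"
  shows "smooth_into T (c *\<^sub>R f)"
  using smooth_into_scale(1)[OF assms, where c = c] by (simp only: scaleR_fun_def)

text \<open>Turns boundedness into convergence: the error is a null scalar times an element of
  \<open>B\<close>. All limits in the target space that currying requires come from here.\<close>

lemma limitin_of_bounded:
  assumes F: "locally_convex F" and B: "bounded_in F B" and d: "d \<in> topspace F"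
    and ev: "eventually (\<lambda>t. b t \<in> B \<and> u t = d + c t *\<^sub>R b t) G" and c: "(c \<longlongrightarrow> 0) G"
  shows "limitin F u d G"
  unfolding limitin_locally_convex[OF F]
proof (intro conjI ballI d)
  note V = locally_convexD(1)[OF F]
  have BV: "B \<subseteq> topspace F" and Bp: "\<And>p. p \<in> cont_seminorms F \<Longrightarrow> \<exists>C. \<forall>x\<in>B. p x \<le> C"
    using B by (auto simp: bounded_in_locally_convex[OF F])
  show "eventually (\<lambda>t. u t \<in> topspace F) G"
    using ev by (rule eventually_mono) (use BV V d in \<open>auto intro!: subspace_add subspace_scale\<close>)
  fix p assume p: "p \<in> cont_seminorms F"
  then obtain C where C: "\<And>x. x \<in> B \<Longrightarrow> p x \<le> C" using Bp by blast
  show "((\<lambda>t. p (u t - d)) \<longlongrightarrow> 0) G"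
  proof (rule Lim_null_comparison)
    show "((\<lambda>t. \<bar>c t\<bar> * C) \<longlongrightarrow> 0) G"
      using tendsto_mult_left_zero[OF tendsto_rabs_zero[OF c], of C] .
    show "eventually (\<lambda>t. norm (p (u t - d)) \<le> \<bar>c t\<bar> * C) G"
      using ev
    proof (rule eventually_mono)
      fix t assume t: "b t \<in> B \<and> u t = d + c t *\<^sub>R b t"
      then have bV: "b t \<in> topspace F" using BV by blast
      have "p (u t - d) = \<bar>c t\<bar> * p (b t)"
        using t seminorm_onD(3)[OF locally_convexD(3)[OF F p] bV] by simp
      moreover have "0 \<le> p (b t)" by (rule seminorm_onD(1)[OF locally_convexD(3)[OF F p] bV])
      moreover have "p (b t) \<le> C" using C t by blast
      ultimately show "norm (p (u t - d)) \<le> \<bar>c t\<bar> * C" by (simp add: mult_left_mono)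
    qed
  qed
qed

text \<open>Two derivatives of room in the class \<open>A\<close> suffice: difference quotients then converge at rate \<open>t\<close>
  times a bounded family, so that no knowledge of the topology of \<open>F\<close> beyond its bounded sets is needed.\<close>

locale curry_target =
  fixes A :: "(nat \<Rightarrow> real) \<Rightarrow> bool" and F :: "('b::euclidean_space \<Rightarrow> 'c::euclidean_space) topology"
  assumes sep: "separated_lc F"
    and bdd: "A a \<Longrightarrow> compact L \<Longrightarrow> (\<And>h. h \<in> B \<Longrightarrow> dominated a h) \<Longrightarrow>
      (\<And>h y. h \<in> B \<Longrightarrow> y \<notin> L \<Longrightarrow> h y = 0) \<Longrightarrow> bounded_in F B"
    and shift: "A a \<Longrightarrow> 0 \<le> c \<Longrightarrow> A (\<lambda>k. c * a (k + i))"
begin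

text \<open>Continuity costs one derivative: differences of slices divided by
  \<open>norm (z - x)\<close> form a bounded family. Differentiability costs two: by the Taylor
  estimate, difference quotient minus derivative is \<open>t\<close> times a member of a bounded
  family. The dominating sequences come from \<open>shift\<close>, the common support is the
  projection of \<open>K\<close>.\<close>

lemma curry_step:
  fixes h :: "'a::euclidean_space \<times> 'b \<Rightarrow> 'c"
  assumes A: "A a" and h: "dominated a h" and K: "compact K" "\<And>z. z \<notin> K \<Longrightarrow> h z = 0"
  shows "continuous_map euclidean F (\<lambda>x y. h (x, y))"
    and "limitin F (\<lambda>t. ((\<lambda>y. h (x + t *\<^sub>R v, y)) - (\<lambda>y. h (x, y))) /\<^sub>R t)
      (\<lambda>y. iter_deriv euclidean h [(v, 0)] (x, y)) (at (0::real))"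
proof -
  let ?s = "\<lambda>h x y. h (x, y) :: 'c"
  let ?L = "snd ` K"
  note lc = separated_lcD(1)[OF sep] and sE = separated_lc_euclidean[where 'a = 'c]
  note sm = dominatedD(1)[OF h]
  have L: "compact ?L" by (intro compact_continuous_image K continuous_intros)
  have off: "?s h x y = 0" if "y \<notin> ?L" for x y
    using K(2)[of "(x, y)"] that by (force simp: image_iff)
  have off': "iter_deriv euclidean h vs (x, y) = 0" if "y \<notin> ?L" for vs x y
  proof (rule iter_deriv_outside[OF sE compact_imp_closed[OF K(1)] K(2)])
    show "(x, y) \<notin> K" using that by (force simp: image_iff)
  qed
  have A1: "A (\<lambda>k. 1 * a (k + 0))" by (rule shift[OF A]) simp
  have unit_Pair: "unit_vectors (map (Pair (0::'a)) ws)" if "unit_vectors ws" for ws :: "'b list"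
    using that by (auto simp: unit_vectors_def norm_Pair)
  have slice_in: "?s g x \<in> topspace F"
    if "A b" "dominated b g" "\<And>y. y \<notin> ?L \<Longrightarrow> ?s g x y = 0" for b and g :: "'a \<times> 'b \<Rightarrow> 'c" and x
  proof -
    have "bounded_in F {?s g x}"
    proof (rule bdd[OF that(1) L])
      fix h' assume "h' \<in> {?s g x}"
      then have h': "h' = ?s g x" by simp
      show "dominated b h'"
        unfolding h' dominated_def smooth_slice(2)[OF dominatedD(1)[OF that(2)]]
        using dominatedD(2)[OF that(2) unit_Pair] smooth_slice(1)[OF dominatedD(1)[OF that(2)]] by simp
      show "h' y = 0" if "y \<notin> ?L" for y using that h' \<open>\<And>y. y \<notin> ?L \<Longrightarrow> ?s g x y = 0\<close> by simp
    qed
    then show ?thesis by (simp add: bounded_in_singleton[OF lc])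
  qed
  show "continuous_map euclidean F (\<lambda>x y. h (x, y))"
    unfolding continuous_map_euclidean_limitin
  proof
    fix x
    define b where "b z = (1 / norm (z - x)) *\<^sub>R (?s h z - ?s h x)" for z
    have sb: "smooth_into euclidean (b z)" for z
      unfolding b_def by (intro smooth_into_scale_fun smooth_into_diff_fun sE smooth_slice sm)
    have ib: "iter_deriv euclidean (b z) ws y = (1 / norm (z - x)) *\<^sub>R
        (iter_deriv euclidean h (map (Pair 0) ws) (z, y) - iter_deriv euclidean h (map (Pair 0) ws) (x, y))" for z ws y
      unfolding b_def
      by (subst iter_deriv_scale_fun[OF sE smooth_into_diff_fun(1)[OF sE smooth_slice(1)[OF sm] smooth_slice(1)[OF sm]]])
        (simp only: smooth_into_diff_fun(2)[OF sE smooth_slice(1)[OF sm] smooth_slice(1)[OF sm]] smooth_slice(2)[OF sm])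
    have "bounded_in F (b ` (- {x}))"
    proof (rule bdd[OF shift[OF A zero_le_one, of 1] L])
      fix g assume "g \<in> b ` (- {x})"
      then obtain z where z: "g = b z" "z \<noteq> x" by auto
      \<comment> \<open>\<open>z\<close> is reached from \<open>x\<close> along the unit vector
        \<open>u\<close> after the length \<open>norm (z - x)\<close>, so the estimate along a line
        applies.\<close>
      define u where "u = (1 / norm (z - x)) *\<^sub>R (z - x)"
      have u: "norm u \<le> 1" "z - x = norm (z - x) *\<^sub>R u" using z(2) by (simp_all add: u_def)
      have zy: "(z, y) = (x, y) + norm (z - x) *\<^sub>R (u, 0 :: 'b)" for y
        using u(2) by (simp add: algebra_simps)
      show "dominated (\<lambda>k. 1 * a (k + 1)) g"
        unfolding z(1) dominated_def
      proof (intro conjI allI impI sb)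
        fix ws :: "'b list" and y assume ws: "unit_vectors ws"
        let ?ws = "map (Pair (0::'a)) ws"
        have "norm (iter_deriv euclidean h ?ws (z, y) - iter_deriv euclidean h ?ws (x, y))
            \<le> \<bar>norm (z - x)\<bar> * a (length ws + 1)"
          unfolding zy
        proof (rule iter_deriv_diff_bound[OF sm])
          fix w
          show "norm (iter_deriv euclidean h ((u, 0) # ?ws) w) \<le> a (length ws + 1)"
            using dominatedD(2)[OF h, of "(u, 0) # ?ws" w] u(1) unit_Pair[OF ws] by (simp add: norm_Pair del: iter_deriv.simps)
        qed
        then show "norm (iter_deriv euclidean (b z) ws y) \<le> 1 * a (length ws + 1)"
          using z(2) unfolding ib by (simp add: pos_divide_le_eq mult.commute)
      qed
      show "g y = 0" if "y \<notin> ?L" for y using off[OF that] by (simp add: z(1) b_def)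
    qed
    then show "limitin F (?s h) (?s h x) (at x)"
    proof (rule limitin_of_bounded[OF lc, where c = "\<lambda>z. norm (z - x)" and b = b])
      show "?s h x \<in> topspace F" by (rule slice_in[OF A h off])
      have "b z \<in> b ` (- {x}) \<and> ?s h z = ?s h x + norm (z - x) *\<^sub>R b z" if "z \<noteq> x" for z
      proof
        show "b z \<in> b ` (- {x})" using that by blast
        show "?s h z = ?s h x + norm (z - x) *\<^sub>R b z" using that by (simp add: b_def fun_eq_iff)
      qed
      then show "\<forall>\<^sub>F z in at x. b z \<in> b ` (- {x}) \<and> ?s h z = ?s h x + norm (z - x) *\<^sub>R b z"
        by (rule eventually_mono[OF eventually_neq_at_within[of x]])
      show "((\<lambda>z. norm (z - x)) \<longlongrightarrow> 0) (at x)"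
        by (intro tendsto_norm_zero LIM_zero tendsto_ident_at)
    qed
  qed
  let ?h' = "iter_deriv euclidean h [(v, 0)]"
  note sm' = smooth_into_iter_deriv[OF sm, of "[(v, 0)]"]
  have h': "dominated (\<lambda>k. prod_list (map norm [(v, 0::'b)]) * a (k + length [(v, 0::'b)])) ?h'"
    by (rule dominated_iter_deriv[OF h])
  show "limitin F (\<lambda>t. (?s h (x + t *\<^sub>R v) - ?s h x) /\<^sub>R t) (?s ?h' x) (at (0::real))"
  proof -
    define b where "b t = inverse t *\<^sub>R (inverse t *\<^sub>R (?s h (x + t *\<^sub>R v) - ?s h x) - ?s ?h' x)" for t :: real
    note sd = smooth_into_diff_fun[OF sE smooth_slice(1)[OF sm] smooth_slice(1)[OF sm]]
    note ss = smooth_into_scale_fun[OF sE sd(1)]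
    note sd2 = smooth_into_diff_fun[OF sE ss smooth_slice(1)[OF sm']]
    have sb: "smooth_into euclidean (b t)" for t
      unfolding b_def by (rule smooth_into_scale_fun[OF sE sd2(1)])
    have ib: "iter_deriv euclidean (b t) ws y = inverse t *\<^sub>R (inverse t *\<^sub>R
        (iter_deriv euclidean h (map (Pair 0) ws) (x + t *\<^sub>R v, y) - iter_deriv euclidean h (map (Pair 0) ws) (x, y))
        - iter_deriv euclidean h ((v, 0) # map (Pair 0) ws) (x, y))" for t ws y
    proof -
      have "iter_deriv euclidean ?h' (map (Pair 0) ws) = iter_deriv euclidean h ((v, 0) # map (Pair 0) ws)"
        using iter_deriv_move[OF sm, of "map (Pair 0) ws" "(v, 0)" "[]"]
        by (simp only: iter_deriv_append[symmetric] append_Nil2)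
      then show ?thesis
        unfolding b_def iter_deriv_scale_fun[OF sE sd2(1)] sd2(2) iter_deriv_scale_fun[OF sE sd(1)] sd(2)
          smooth_slice(2)[OF sm] smooth_slice(2)[OF sm'] by simp
    qed
    have "bounded_in F (b ` (- {0}))"
    proof (rule bdd[OF shift[OF A zero_le_power2[of "norm v"], of 2] L])
      fix g assume "g \<in> b ` (- {0})"
      then obtain t where t: "g = b t" "t \<noteq> 0" by auto
      show "dominated (\<lambda>k. (norm v)\<^sup>2 * a (k + 2)) g"
        unfolding t(1) dominated_def
      proof (intro conjI allI impI sb)
        fix ws :: "'b list" and y assume ws: "unit_vectors ws"
        let ?ws = "map (Pair (0::'a)) ws"
        \<comment> \<open>Domination speaks of unit directions; rescaling both copies of
          \<open>(v, 0)\<close> produces the square of \<open>norm v\<close>.\<close>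
        let ?e = "(sgn v, 0 :: 'b)"
        let ?E = "iter_deriv euclidean h ?ws (x + t *\<^sub>R v, y) - iter_deriv euclidean h ?ws (x, y)
            - t *\<^sub>R iter_deriv euclidean h ((v, 0) # ?ws) (x, y)"
        have e: "(v, 0) = norm v *\<^sub>R ?e" by (simp add: norm_scaleR_sgn)
        have "norm (iter_deriv euclidean h ?ws ((x, y) + t *\<^sub>R (v, 0)) - iter_deriv euclidean h ?ws (x, y)
            - t *\<^sub>R iter_deriv euclidean h ((v, 0) # ?ws) (x, y)) \<le> t\<^sup>2 * ((norm v)\<^sup>2 * a (length ws + 2))"
        proof (rule iter_deriv_taylor_bound[OF sm])
          fix w
          have "iter_deriv euclidean h ((v, 0) # (v, 0) # ?ws) w
              = norm v *\<^sub>R iter_deriv euclidean h (?e # (norm v *\<^sub>R ?e) # ?ws) w"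
            unfolding e by (rule iter_deriv_scale_direction[OF sm])
          also have "\<dots> = norm v *\<^sub>R norm v *\<^sub>R iter_deriv euclidean h (?e # ?e # ?ws) w"
            by (simp only: iter_deriv_commute[OF sm, of ?e "norm v *\<^sub>R ?e"] iter_deriv_scale_direction[OF sm])
          also have "norm \<dots> \<le> (norm v)\<^sup>2 * a (length ws + 2)"
            using dominatedD(2)[OF h, of "?e # ?e # ?ws" w] norm_sgn_le_1[of v] unit_Pair[OF ws]
            by (simp add: norm_Pair power2_eq_square mult.assoc mult_left_mono del: iter_deriv.simps)
          finally show "norm (iter_deriv euclidean h ((v, 0) # (v, 0) # ?ws) w) \<le> (norm v)\<^sup>2 * a (length ws + 2)" .
        qed
        then have E: "norm ?E \<le> t\<^sup>2 * ((norm v)\<^sup>2 * a (length ws + 2))" by (simp del: iter_deriv.simps)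
        have "iter_deriv euclidean (b t) ws y = inverse (t\<^sup>2) *\<^sub>R ?E"
          unfolding ib using t(2) by (simp add: scaleR_diff_right power2_eq_square del: iter_deriv.simps)
        then have "norm (iter_deriv euclidean (b t) ws y) = norm ?E / t\<^sup>2"
          by (simp add: divide_inverse mult.commute del: iter_deriv.simps)
        then show "norm (iter_deriv euclidean (b t) ws y) \<le> (norm v)\<^sup>2 * a (length ws + 2)"
          using E t(2) by (simp add: pos_divide_le_eq mult.commute del: iter_deriv.simps)
      qed
      show "g y = 0" if "y \<notin> ?L" for y
        using off[OF that] off'[OF that, of "[(v, 0)]"] by (simp add: t(1) b_def)
    qed
    then show ?thesis
    proof (rule limitin_of_bounded[OF lc, where c = "\<lambda>t. t" and b = b])
      show "?s ?h' x \<in> topspace F"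
        by (rule slice_in[OF shift[OF A] h' off']) (simp_all add: prod_list_nonneg)
      have "b t \<in> b ` (- {0}) \<and> (?s h (x + t *\<^sub>R v) - ?s h x) /\<^sub>R t = ?s ?h' x + t *\<^sub>R b t" if "t \<noteq> 0" for t
      proof
        show "b t \<in> b ` (- {0})" using that by blast
        show "(?s h (x + t *\<^sub>R v) - ?s h x) /\<^sub>R t = ?s ?h' x + t *\<^sub>R b t"
          using that by (simp add: b_def fun_eq_iff del: iter_deriv.simps)
      qed
      then show "\<forall>\<^sub>F t in at 0. b t \<in> b ` (- {0}) \<and> (?s h (x + t *\<^sub>R v) - ?s h x) /\<^sub>R t = ?s ?h' x + t *\<^sub>R b t"
        by (rule eventually_mono[OF eventually_neq_at_within[of 0]])
    qed (rule tendsto_ident_at)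
  qed
qed

text \<open>Each derivative of \<open>h\<close> in first-variable directions is again dominated by a
  sequence of the class and vanishes off \<open>K\<close>. So \<open>curry_step\<close> applies to
  all of them and confirms the guessed family of derivatives.\<close>

lemma curry_smooth:
  fixes h :: "'a::euclidean_space \<times> 'b \<Rightarrow> 'c"
  assumes A: "A a" and h: "dominated a h" and K: "compact K" "\<And>z. z \<notin> K \<Longrightarrow> h z = 0"
  shows "smooth_into F (\<lambda>x y. h (x, y))"
    and "iter_deriv F (\<lambda>x y. h (x, y)) vs = (\<lambda>x y. iter_deriv euclidean h (map (\<lambda>v. (v, 0)) vs) (x, y))"
proof -
  let ?D = "\<lambda>vs x y. iter_deriv euclidean h (map (\<lambda>v. (v, 0)) vs) (x, y)"
  have A': "A (\<lambda>k. prod_list (map norm us) * a (k + length us))" for us :: "('a \<times> 'b) list"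
    by (rule shift[OF A]) (auto intro!: prod_list_nonneg)
  have off: "iter_deriv euclidean h us z = 0" if "z \<notin> K" for us z
    by (rule iter_deriv_outside[OF separated_lc_euclidean compact_imp_closed[OF K(1)] K(2) that])
  note step = curry_step[OF A' dominated_iter_deriv[OF h] K(1) off]
  have lim: "limitin F (\<lambda>t. (?D vs (x + t *\<^sub>R v) - ?D vs x) /\<^sub>R t) (?D (v # vs) x) (at (0::real))" for vs x v
  proof -
    let ?us = "map (\<lambda>v. (v, 0)) vs"
    show ?thesis
      using curry_step(2)[OF A'[of ?us] dominated_iter_deriv[OF h, of ?us] K(1) off[of _ ?us], of x v] by simp
  qed
  show "smooth_into F (\<lambda>x y. h (x, y))"
    by (rule smooth_intoI(1)[OF sep, of ?D]) (simp, rule step(1), assumption, rule lim)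
  show "iter_deriv F (\<lambda>x y. h (x, y)) vs = ?D vs"
    by (rule smooth_intoI(2)[OF sep, of ?D]) (simp, rule step(1), assumption, rule lim)
qed

end

section \<open>Currying preserves boundedness\<close>

lemma bounded_in_bound:
  assumes "locally_convex T" "bounded_in T B" "p \<in> cont_seminorms T"
  shows "\<exists>C. \<forall>x\<in>B. p x \<le> C"
  using assms(2,3) unfolding bounded_in_locally_convex[OF assms(1)] by simp

lemma dominated_slice:
  fixes h :: "'a::euclidean_space \<times> 'b::euclidean_space \<Rightarrow> 'c::euclidean_space"
  assumes "dominated a h"
  shows "dominated a (\<lambda>y. h (x, y))"
  unfolding dominated_def smooth_slice(2)[OF dominatedD(1)[OF assms]]
proof (intro conjI allI impI smooth_slice(1)[OF dominatedD(1)[OF assms]])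
  fix ws :: "'b list" and y assume ws: "unit_vectors ws"
  then have "unit_vectors (map (Pair (0::'a)) ws)" by (auto simp: unit_vectors_def norm_Pair)
  from dominatedD(2)[OF assms this] show "norm (iter_deriv euclidean h (map (Pair 0) ws) (x, y)) \<le> a (length ws)"
    by simp
qed

lemma dominated_scale:
  assumes "dominated a f"
  shows "dominated (\<lambda>k. \<bar>c\<bar> * a k) (c *\<^sub>R f)"
  unfolding dominated_def
  using smooth_into_scale_fun[OF separated_lc_euclidean dominatedD(1)[OF assms]]
    iter_deriv_scale_fun[OF separated_lc_euclidean dominatedD(1)[OF assms]] dominatedD(2)[OF assms]
  by (simp add: mult_left_mono)

lemma dominated_dual:
  fixes f :: "'a::euclidean_space \<Rightarrow> 'b::euclidean_space"
  assumes l: "l \<in> dual_space euclidean"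
  shows "\<exists>c\<ge>0. \<forall>a f. dominated a (f :: 'a \<Rightarrow> 'b) \<longrightarrow> dominated (\<lambda>k. c * a k) (l \<circ> f)"
proof -
  obtain c where c: "c \<ge> 0" "\<And>v. \<bar>l v\<bar> \<le> c * norm v"
    using cont_seminorm_euclidean_bound[OF dual_space_abs[OF l]] by blast
  have "dominated (\<lambda>k. c * a k) (l \<circ> f)" if f: "dominated a f" for a and f :: "'a \<Rightarrow> 'b"
    unfolding dominated_real_iff
  proof (intro conjI allI impI smooth_into_dual(1)[OF separated_lc_euclidean l dominatedD(1)[OF f]])
    fix vs :: "'a list" and x assume "unit_vectors vs"
    then have "c * norm (iter_deriv euclidean f vs x) \<le> c * a (length vs)"
      using dominatedD(2)[OF f] c(1) by (intro mult_left_mono) auto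
    then show "\<bar>iter_deriv euclideanreal (l \<circ> f) vs x\<bar> \<le> c * a (length vs)"
      unfolding smooth_into_dual(2)[OF separated_lc_euclidean l dominatedD(1)[OF f]] using c(2) order_trans by blast
  qed
  with c(1) show ?thesis by blast
qed

lemma bounded_in_Dspace_dominated:
  fixes B :: "('a::euclidean_space \<Rightarrow> 'b::euclidean_space) set"
  shows "bounded_in (Dspace euclidean) B \<longleftrightarrow>
    (\<exists>K. compact K \<and> (\<forall>f\<in>B. \<forall>x. x \<notin> K \<longrightarrow> f x = 0)) \<and> (\<exists>a. \<forall>f\<in>B. dominated a f)" (is "?L \<longleftrightarrow> ?R")
proof
  assume ?L
  note L = this[unfolded bounded_in_Dspace[OF separated_lc_euclidean]]
  obtain K where K: "compact K" "B \<subseteq> CinfK_carrier K euclidean" using L by blast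
  have sm: "smooth_into euclidean f" if "f \<in> B" for f using that K(2) by (auto simp: CinfK_carrier_def)
  have bd: "\<exists>C. \<forall>f\<in>B. \<forall>x\<in>UNIV. norm (iter_deriv euclidean f vs x) \<le> C" for vs
    using bspec[OF conjunct2[OF L] norm_cont_seminorms] by simp
  have "\<exists>a. \<forall>k. \<forall>f\<in>B. \<forall>x\<in>UNIV. \<forall>vs. length vs = k \<and> (\<forall>v\<in>set vs. norm v \<le> 1) \<longrightarrow>
      norm (iter_deriv euclidean f vs x) \<le> a k"
    by (rule choice, rule allI, rule iter_deriv_multilinear_bound[OF sm bd])
  then have "\<exists>a. \<forall>f\<in>B. dominated a f"
    unfolding dominated_def unit_vectors_def using sm by blast
  moreover have "\<forall>f\<in>B. \<forall>x. x \<notin> K \<longrightarrow> f x = 0" using K(2) by (auto simp: CinfK_carrier_def)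
  ultimately show ?R using K(1) by blast
next
  assume R: ?R
  then obtain K a where K: "compact K" "\<And>f x. f \<in> B \<Longrightarrow> x \<notin> K \<Longrightarrow> f x = 0" and a: "\<And>f. f \<in> B \<Longrightarrow> dominated a f"
    by blast
  show ?L
    unfolding bounded_in_Dspace[OF separated_lc_euclidean]
  proof (intro conjI ballI allI exI[of _ K] K(1))
    show "B \<subseteq> CinfK_carrier K euclidean"
      using K(2) dominatedD(1)[OF a] by (auto simp: CinfK_carrier_def)
    fix p :: "'b \<Rightarrow> real" and vs :: "'a list" assume "p \<in> cont_seminorms euclidean"
    then obtain c where c: "c \<ge> 0" "\<And>v. p v \<le> c * norm v" using cont_seminorm_euclidean_bound by blast
    have "p (iter_deriv euclidean f vs x) \<le> c * (prod_list (map norm vs) * a (length vs))" if "f \<in> B" for f x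
      using c(2) mult_left_mono[OF dominated_bound[OF a[OF that], of vs x] c(1)] by (rule order_trans)
    then show "\<exists>C. \<forall>f\<in>B. \<forall>x. p (iter_deriv euclidean f vs x) \<le> C" by blast
  qed
qed

lemma curry_target_Dspace:
  "curry_target (\<lambda>_. True) (Dspace euclidean :: ('b::euclidean_space \<Rightarrow> 'c::euclidean_space) topology)"
proof
  show "separated_lc (Dspace euclidean :: ('b \<Rightarrow> 'c) topology)"
    by (rule separated_lc_Dspace[OF separated_lc_euclidean])
  show "bounded_in (Dspace euclidean) B"
    if "compact L" "\<And>h. h \<in> B \<Longrightarrow> dominated a h" "\<And>h y. h \<in> B \<Longrightarrow> y \<notin> L \<Longrightarrow> h y = 0"
    for a L and B :: "('b \<Rightarrow> 'c) set"
    unfolding bounded_in_Dspace_dominated using that by blast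
qed simp

text \<open>For fixed directions \<open>vs\<close>, the slices of the corresponding derivatives of
  all members of \<open>B\<close>, taken at all \<open>x\<close>, form one bounded set of the
  target. Each seminorm of the target is bounded on it, which is the uniform estimate
  required.\<close>

lemma curry_bounded_Dspace:
  fixes B :: "('a::euclidean_space \<times> 'b::euclidean_space \<Rightarrow> 'c::euclidean_space) set"
  assumes "bounded_in (Dspace euclidean) B"
  shows "bounded_in (Dspace (Dspace euclidean)) ((\<lambda>f x y. f (x, y)) ` B)"
proof -
  interpret curry_target "\<lambda>_. True" "Dspace euclidean :: ('b \<Rightarrow> 'c) topology" by (rule curry_target_Dspace)
  obtain K a where K: "compact K" "\<And>f z. f \<in> B \<Longrightarrow> z \<notin> K \<Longrightarrow> f z = 0" and a: "\<And>f. f \<in> B \<Longrightarrow> dominated a f"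
    using assms unfolding bounded_in_Dspace_dominated by blast
  have L: "compact (snd ` K)" "compact (fst ` K)" by (intro compact_continuous_image K continuous_intros)+
  have smooth: "smooth_into (Dspace euclidean) (\<lambda>x y. f (x, y))"
      "iter_deriv (Dspace euclidean) (\<lambda>x y. f (x, y)) vs x = (\<lambda>y. iter_deriv euclidean f (map (\<lambda>v. (v, 0)) vs) (x, y))"
    if f: "f \<in> B" for f vs x
    by (rule curry_smooth(1)[OF TrueI a[OF f] K(1) K(2)[OF f]], assumption)
      (subst curry_smooth(2)[OF TrueI a[OF f] K(1) K(2)[OF f]], auto)
  have off: "iter_deriv euclidean f us z = 0" if "f \<in> B" "z \<notin> K" for f us z
    by (rule iter_deriv_outside[OF separated_lc_euclidean compact_imp_closed[OF K(1)] K(2)[OF that(1)] that(2)])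
  show ?thesis
    unfolding bounded_in_Dspace[OF sep]
  proof (intro conjI ballI allI exI[of _ "fst ` K"] L(2))
    show "(\<lambda>f x y. f (x, y)) ` B \<subseteq> CinfK_carrier (fst ` K) (Dspace euclidean)"
      using smooth(1) K(2) by (force simp: CinfK_carrier_def fun_eq_iff image_iff)
    fix p vs assume p: "p \<in> cont_seminorms (Dspace euclidean :: ('b \<Rightarrow> 'c) topology)"
    let ?us = "map (\<lambda>v. (v, 0)) vs :: ('a \<times> 'b) list"
    let ?R = "{\<lambda>y. iter_deriv euclidean f ?us (x, y) | f x. f \<in> B}"
    have "bounded_in (Dspace euclidean) {\<lambda>y. iter_deriv euclidean f ?us (x, y) | f x. f \<in> B}"
    proof (rule bdd[OF TrueI L(1)])
      fix h assume "h \<in> {\<lambda>y. iter_deriv euclidean f ?us (x, y) | f x. f \<in> B}"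
      then obtain f x where h: "h = (\<lambda>y. iter_deriv euclidean f ?us (x, y))" "f \<in> B" by blast
      show "dominated (\<lambda>k. prod_list (map norm ?us) * a (k + length ?us)) h"
        unfolding h(1) by (intro dominated_slice dominated_iter_deriv a h(2))
      show "h y = 0" if "y \<notin> snd ` K" for y
        unfolding h(1) by (rule off[OF h(2)]) (use that in \<open>force simp: image_iff\<close>)
    qed
    from bounded_in_bound[OF separated_lcD(1)[OF sep] this p]
    obtain C where C: "\<forall>h\<in>?R. p h \<le> C" ..
    have "p (iter_deriv (Dspace euclidean) (\<lambda>x y. f (x, y)) vs x) \<le> C" if f: "f \<in> B" for f x
      unfolding smooth(2)[OF f] by (rule bspec[OF C]) (use f in blast)
    then show "\<exists>C. \<forall>g\<in>(\<lambda>f x y. f (x, y)) ` B. \<forall>x. p (iter_deriv (Dspace euclidean) g vs x) \<le> C" by auto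
  qed
qed

section \<open>Currying ultradifferentiable functions\<close>

text \<open>For Euclidean values the finitely many coordinate functionals decide, and their
  sequences can be added; this removes the dependence of \<open>a\<close> on the functional.\<close>

lemma ultra_bounded_euclidean:
  fixes B :: "('a::euclidean_space \<Rightarrow> 'b::euclidean_space) set"
  assumes M: "weight_sequence M"
  shows "ultra_bounded s M euclidean B \<longleftrightarrow> (\<exists>a. ultra_seq s M a \<and> (\<forall>f\<in>B. dominated a f))" (is "?L \<longleftrightarrow> ?R")
proof
  assume L: ?L
  then have sm: "smooth_into euclidean f" if "f \<in> B" for f using that by (simp add: ultra_bounded_def)
  have "\<forall>b. \<exists>a. ultra_seq s M a \<and> (\<forall>f\<in>B. dominated a ((\<lambda>y. y \<bullet> b) \<circ> f))"
    using L dual_space_euclidean_inner unfolding ultra_bounded_def by blast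
  then obtain a where a: "\<And>b. ultra_seq s M (a b)" "\<And>b f. f \<in> B \<Longrightarrow> dominated (a b) ((\<lambda>y. y \<bullet> b) \<circ> f)" by metis
  have "dominated (\<lambda>k. \<Sum>b\<in>Basis. a b k) f" if f: "f \<in> B" for f
    unfolding dominated_def
  proof (intro conjI allI impI sm[OF f])
    fix vs :: "'a list" and x assume vs: "unit_vectors vs"
    have "norm (iter_deriv euclidean f vs x) \<le> (\<Sum>b\<in>Basis. \<bar>iter_deriv euclidean f vs x \<bullet> b\<bar>)" by (rule norm_le_l1)
    also have "\<dots> \<le> (\<Sum>b\<in>Basis. a b (length vs))"
      using dominatedD(2)[OF a(2)[OF f] vs, of _ x] iter_deriv_inner(2)[OF sm[OF f], of _ vs x]
      by (intro sum_mono) (simp add: o_def)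
    finally show "norm (iter_deriv euclidean f vs x) \<le> (\<Sum>b\<in>Basis. a b (length vs))" .
  qed
  moreover have "ultra_seq s M (\<lambda>k. \<Sum>b\<in>(Basis :: 'b set). a b k)"
    by (rule ultra_seq_sum[OF M finite_Basis a(1)])
  ultimately show ?R by blast
next
  assume ?R
  then obtain a where a: "ultra_seq s M a" "\<And>f. f \<in> B \<Longrightarrow> dominated a f" by blast
  show ?L
    unfolding ultra_bounded_def
  proof (intro conjI ballI dominatedD(1)[OF a(2)])
    fix l :: "'b \<Rightarrow> real" assume l: "l \<in> dual_space euclidean"
    obtain c where c: "c \<ge> 0" "\<And>a f. dominated a (f :: 'a \<Rightarrow> 'b) \<Longrightarrow> dominated (\<lambda>k. c * a k) (l \<circ> f)"
      using dominated_dual[OF l] by blast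
    show "\<exists>a. ultra_seq s M a \<and> (\<forall>f\<in>B. dominated a (l \<circ> f))"
      using ultra_seq_scale[OF M a(1) c(1)] c(2)[OF a(2)] by blast
  qed
qed

lemma bounded_in_DMspace_dominated:
  fixes B :: "('a::euclidean_space \<Rightarrow> 'b::euclidean_space) set"
  assumes M: "weight_sequence M"
  shows "bounded_in (DMspace s M euclidean) B \<longleftrightarrow>
    (\<exists>K. compact K \<and> (\<forall>f\<in>B. \<forall>x. x \<notin> K \<longrightarrow> f x = 0)) \<and> (\<exists>a. ultra_seq s M a \<and> (\<forall>f\<in>B. dominated a f))"
  unfolding bounded_in_DMspace[OF M separated_lc_euclidean] ultra_bounded_euclidean[OF M] ..

lemma curry_target_DMspace:
  assumes M: "weight_sequence M" and mg: "moderate_growth M"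
  shows "curry_target (ultra_seq s M) (DMspace s M euclidean :: ('b::euclidean_space \<Rightarrow> 'c::euclidean_space) topology)"
proof
  show "separated_lc (DMspace s M euclidean :: ('b \<Rightarrow> 'c) topology)"
    by (rule separated_lc_DMspace[OF M separated_lc_euclidean])
  show "bounded_in (DMspace s M euclidean) B"
    if "ultra_seq s M a" "compact L" "\<And>h. h \<in> B \<Longrightarrow> dominated a h" "\<And>h y. h \<in> B \<Longrightarrow> y \<notin> L \<Longrightarrow> h y = 0"
    for a L and B :: "('b \<Rightarrow> 'c) set"
    unfolding bounded_in_DMspace_dominated[OF M] using that by blast
  show "ultra_seq s M (\<lambda>k. c * a (k + i))" if "ultra_seq s M a" "0 \<le> c" for a c i
    by (rule ultra_seq_scale[OF M ultra_seq_shift[OF M mg that(1)] that(2)])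
qed

text \<open>For an admissible \<rho>, slices of first-variable derivatives of order \<open>k\<close>
  are divided by \<open>\<rho> ^ k * weight_fact M k\<close>. By \<open>ultra_seq_split\<close> all
  of them are dominated by the same \<open>b\<close> and so form one bounded set of the target. A
  functional \<open>l\<close> is bounded there, and multiplying back is the growth estimate at this
  \<rho> for \<open>l\<close> composed with the curried functions.\<close>

lemma curry_bounded_DMspace:
  fixes B :: "('a::euclidean_space \<times> 'b::euclidean_space \<Rightarrow> 'c::euclidean_space) set"
  assumes M: "weight_sequence M" and mg: "moderate_growth M" and B: "bounded_in (DMspace s M euclidean) B"
  shows "bounded_in (DMspace s M (DMspace s M euclidean)) ((\<lambda>f x y. f (x, y)) ` B)"
proof -
  let ?F = "DMspace s M euclidean :: ('b \<Rightarrow> 'c) topology"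
  interpret curry_target "ultra_seq s M" ?F by (rule curry_target_DMspace[OF M mg])
  obtain K a where K: "compact K" "\<And>f z. f \<in> B \<Longrightarrow> z \<notin> K \<Longrightarrow> f z = 0"
    and us: "ultra_seq s M a" and a: "\<And>f. f \<in> B \<Longrightarrow> dominated a f"
    using B unfolding bounded_in_DMspace_dominated[OF M] by blast
  have L: "compact (snd ` K)" "compact (fst ` K)" by (intro compact_continuous_image K continuous_intros)+
  have smooth: "smooth_into ?F (\<lambda>x y. f (x, y))"
      "iter_deriv ?F (\<lambda>x y. f (x, y)) vs x = (\<lambda>y. iter_deriv euclidean f (map (\<lambda>v. (v, 0)) vs) (x, y))"
    if f: "f \<in> B" for f vs x
    by (rule curry_smooth(1)[OF us a[OF f] K(1) K(2)[OF f]], assumption)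
      (subst curry_smooth(2)[OF us a[OF f] K(1) K(2)[OF f]], auto)
  have off: "iter_deriv euclidean f us z = 0" if "f \<in> B" "z \<notin> K" for f us z
    by (rule iter_deriv_outside[OF separated_lc_euclidean compact_imp_closed[OF K(1)] K(2)[OF that(1)] that(2)])
  have "ultra_bounded s M ?F ((\<lambda>f x y. f (x, y)) ` B)"
    unfolding ultra_bounded_def
  proof (intro conjI ballI)
    fix l assume l: "l \<in> dual_space ?F"
    let ?B = "(\<lambda>g. l \<circ> g) ` ((\<lambda>f x y. f (x, y)) ` B)"
    have smB: "smooth_into euclidean g" if "g \<in> ?B" for g
      using that smooth_into_dual(1)[OF sep l smooth(1)] by auto
    have "for_rho s (\<lambda>\<rho>. \<exists>C. \<forall>g\<in>?B. \<forall>vs x. unit_vectors vs \<longrightarrow>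
      norm (iter_deriv euclidean g vs x) \<le> C * \<rho> ^ length vs * weight_fact M (length vs))"
      using ultra_seq_split[OF M mg us]
    proof (rule for_rho_mono)
      fix \<rho> :: real assume \<rho>: "\<rho> > 0"
        and "\<exists>b. ultra_seq s M b \<and> (\<forall>j k. a (j + k) \<le> b j * (\<rho> ^ k * weight_fact M k))"
      then obtain b where b: "ultra_seq s M b" "\<And>j k. a (j + k) \<le> b j * (\<rho> ^ k * weight_fact M k)" by blast
      have pos: "\<rho> ^ k * weight_fact M k > 0" for k using \<rho> weight_fact_pos[OF M] by simp
      let ?h = "\<lambda>f vs x y. iter_deriv euclidean f (map (\<lambda>v. (v, 0)) vs) (x, y) :: 'c"
      let ?c = "\<lambda>vs :: 'a list. inverse (\<rho> ^ length vs * weight_fact M (length vs))"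
      let ?R = "{?c vs *\<^sub>R ?h f vs x | f vs x. f \<in> B \<and> unit_vectors vs}"
      have "bounded_in ?F ?R"
      proof (rule bdd[OF b(1) L(1)])
        fix h assume "h \<in> ?R"
        then obtain f vs x where h: "h = ?c vs *\<^sub>R ?h f vs x" "f \<in> B" "unit_vectors vs" by blast
        let ?us = "map (\<lambda>v. (v, 0)) vs :: ('a \<times> 'b) list"
        have uus: "unit_vectors ?us" using h(3) by (auto simp: unit_vectors_def norm_Pair)
        have "dominated (\<lambda>k. a (k + length vs)) (iter_deriv euclidean f ?us)"
          unfolding dominated_def iter_deriv_append[symmetric]
          using smooth_into_iter_deriv[OF dominatedD(1)[OF a[OF h(2)]]] uus
            dominatedD(2)[OF a[OF h(2)], of "_ @ ?us"] by simp
        from dominated_scale[OF dominated_slice[OF this, of x], of "?c vs"]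
        have "dominated (\<lambda>k. \<bar>?c vs\<bar> * a (k + length vs)) h" unfolding h(1) .
        then show "dominated b h"
        proof (rule dominated_mono)
          fix k
          have "a (k + length vs) / (\<rho> ^ length vs * weight_fact M (length vs)) \<le> b k"
            using b(2)[of k "length vs"] pos by (simp only: pos_divide_le_eq)
          then show "\<bar>?c vs\<bar> * a (k + length vs) \<le> b k"
            using pos[of "length vs"] by (simp only: abs_of_pos positive_imp_inverse_positive divide_inverse mult.commute)
        qed
        show "h y = 0" if "y \<notin> snd ` K" for y
        proof -
          have "?h f vs x y = 0" by (rule off[OF h(2)]) (use that in \<open>force simp: image_iff\<close>)
          then show ?thesis by (simp add: h(1))
        qed
      qed
      from bounded_in_bound[OF separated_lcD(1)[OF sep] this dual_space_abs[OF l]]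
      obtain C where C: "\<forall>h\<in>?R. \<bar>l h\<bar> \<le> C" ..
      have "norm (iter_deriv euclidean g vs x) \<le> C * \<rho> ^ length vs * weight_fact M (length vs)"
        if g: "g \<in> ?B" and vs: "unit_vectors vs" for g vs x
      proof -
        obtain f where f: "g = l \<circ> (\<lambda>x y. f (x, y))" "f \<in> B" using g by auto
        have mem: "?c vs *\<^sub>R ?h f vs x \<in> ?R" using f(2) vs by blast
        have hF: "?h f vs x \<in> topspace ?F"
          using smooth_intoD(3)[OF smooth(1)[OF f(2)], of vs x] unfolding smooth(2)[OF f(2)] .
        have "?c vs * \<bar>l (?h f vs x)\<bar> \<le> C"
          using bspec[OF C mem]
          by (simp only: linear_on_setD(2)[OF dual_spaceD(1)[OF l] hF] real_scaleR_def abs_mult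
              abs_of_pos[OF positive_imp_inverse_positive[OF pos]])
        then have "\<bar>l (?h f vs x)\<bar> / (\<rho> ^ length vs * weight_fact M (length vs)) \<le> C"
          by (simp only: divide_inverse mult.commute)
        then have "\<bar>l (?h f vs x)\<bar> \<le> C * (\<rho> ^ length vs * weight_fact M (length vs))"
          using pos[of "length vs"] by (simp only: pos_divide_le_eq)
        moreover have "iter_deriv euclidean g vs x = l (?h f vs x)"
          unfolding f(1) smooth_into_dual(2)[OF sep l smooth(1)[OF f(2)]] smooth(2)[OF f(2)] ..
        ultimately show ?thesis by (simp add: mult.assoc)
      qed
      then show "\<exists>C. \<forall>g\<in>?B. \<forall>vs x. unit_vectors vs \<longrightarrow>
          norm (iter_deriv euclidean g vs x) \<le> C * \<rho> ^ length vs * weight_fact M (length vs)" by blast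
    qed
    then have "\<exists>a. ultra_seq s M a \<and> (\<forall>g\<in>?B. dominated a g)"
      using ultra_dominated_iff[OF M smB, where s = s] by blast
    then show "\<exists>a. ultra_seq s M a \<and> (\<forall>g\<in>(\<lambda>f x y. f (x, y)) ` B. dominated a (l \<circ> g))" by blast
  qed (use smooth(1) in auto)
  moreover have "\<forall>g\<in>(\<lambda>f x y. f (x, y)) ` B. \<forall>x. x \<notin> fst ` K \<longrightarrow> g x = 0"
    using K(2) by (force simp: fun_eq_iff image_iff)
  ultimately show ?thesis
    unfolding bounded_in_DMspace[OF M sep] using L(2) by blast
qed

section \<open>Uncurrying smooth maps\<close>

text \<open>As (v, w) = (v, 0) + (0, w), linearity splits the derivative, and symmetry carries each
  summand into the block of its own variable.\<close>

lemma iter_deriv_Pair_split: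
  fixes h :: "'a::euclidean_space \<times> 'b::euclidean_space \<Rightarrow> 'c::euclidean_space"
  assumes h: "smooth_into euclidean h"
  shows "iter_deriv euclidean h (us @ (v, w) # map (Pair 0) ws @ map (\<lambda>v. (v, 0)) vs) z
    = iter_deriv euclidean h (us @ map (Pair 0) ws @ map (\<lambda>v. (v, 0)) (v # vs)) z
    + iter_deriv euclidean h (us @ map (Pair 0) (w # ws) @ map (\<lambda>v. (v, 0)) vs) z"
proof -
  let ?W = "map (Pair 0) ws :: ('a \<times> 'b) list" and ?V = "map (\<lambda>v. (v, 0)) vs :: ('a \<times> 'b) list"
  have "iter_deriv euclidean h (us @ (v, w) # ?W @ ?V) z = iter_deriv euclidean h (((v, 0) + (0, w)) # us @ ?W @ ?V) z"
    unfolding iter_deriv_move[OF h] by simp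
  also have "\<dots> = iter_deriv euclidean h ((v, 0) # us @ ?W @ ?V) z + iter_deriv euclidean h ((0, w) # us @ ?W @ ?V) z"
    by (rule iter_deriv_add_direction[OF h])
  also have "iter_deriv euclidean h ((v, 0) # us @ ?W @ ?V) = iter_deriv euclidean h ((us @ ?W) @ (v, 0) # ?V)"
    unfolding iter_deriv_move[OF h] by (simp only: append_assoc)
  also have "iter_deriv euclidean h ((0, w) # us @ ?W @ ?V) = iter_deriv euclidean h (us @ (0, w) # ?W @ ?V)"
    unfolding iter_deriv_move[OF h] ..
  finally show ?thesis by (simp only: append_assoc list.map append_Cons)
qed

text \<open>Splitting each of \<open>k\<close> directions into its two components yields
  \<open>2 ^ k\<close> mixed derivatives. Induction from the right end takes the direction adjacent
  to the sorted blocks, which then absorb it.\<close>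

lemma mixed_derivs_bound:
  fixes h :: "'a::euclidean_space \<times> 'b::euclidean_space \<Rightarrow> 'c::euclidean_space"
  assumes h: "smooth_into euclidean h"
    and c: "\<And>ws vs z. unit_vectors ws \<Longrightarrow> unit_vectors vs \<Longrightarrow>
      norm (iter_deriv euclidean h (map (Pair 0) ws @ map (\<lambda>v. (v, 0)) vs) z) \<le> c (length ws + length vs)"
  shows "dominated (\<lambda>k. 2 ^ k * c k) h"
proof -
  have "norm (iter_deriv euclidean h (us @ map (Pair 0) ws @ map (\<lambda>v. (v, 0)) vs) z)
      \<le> 2 ^ length us * c (length us + length ws + length vs)"
    if "unit_vectors us" "unit_vectors ws" "unit_vectors vs" for us ws vs z
    using that
  proof (induction us arbitrary: ws vs rule: rev_induct)
    case Nil
    then show ?case using c by simp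
  next
    case (snoc u us)
    obtain v w where u: "u = (v, w)" by force
    have unit: "unit_vectors us" "norm v \<le> 1" "norm w \<le> 1"
      using snoc.prems(1) norm_fst_le[of v w] norm_snd_le[of w v] by (auto simp: u)
    let ?C = "2 ^ length us * c (Suc (length us + length ws + length vs))"
    have "norm (iter_deriv euclidean h (us @ map (Pair 0) ws @ map (\<lambda>v. (v, 0)) (v # vs)) z) \<le> ?C"
      using snoc.IH[of ws "v # vs"] snoc.prems unit by (simp del: iter_deriv.simps)
    moreover have "norm (iter_deriv euclidean h (us @ map (Pair 0) (w # ws) @ map (\<lambda>v. (v, 0)) vs) z) \<le> ?C"
      using snoc.IH[of "w # ws" vs] snoc.prems unit by (simp del: iter_deriv.simps)
    ultimately have "norm (iter_deriv euclidean h (us @ (v, w) # map (Pair 0) ws @ map (\<lambda>v. (v, 0)) vs) z) \<le> ?C + ?C"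
      unfolding iter_deriv_Pair_split[OF h] by (rule norm_triangle_le[OF add_mono])
    then show ?case by (simp add: u del: iter_deriv.simps)
  qed
  from this[of _ "[]" "[]"] show ?thesis using h by (simp add: dominated_def)
qed

text \<open>The same splitting for bounds that may depend on the individual directions; uniformity
  over unit vectors is recovered from multilinearity.\<close>

lemma mixed_derivs_ex_bound:
  fixes A :: "('a::euclidean_space \<times> 'b::euclidean_space \<Rightarrow> 'c::euclidean_space) set"
  assumes A: "\<And>h. h \<in> A \<Longrightarrow> smooth_into euclidean h"
    and C: "\<And>ws vs. \<exists>C. \<forall>h\<in>A. \<forall>z. norm (iter_deriv euclidean h (map (Pair 0) ws @ map (\<lambda>v. (v, 0)) vs) z) \<le> C"
  shows "\<exists>a. \<forall>h\<in>A. dominated a h"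
proof -
  have "\<exists>C. \<forall>h\<in>A. \<forall>z. norm (iter_deriv euclidean h (us @ map (Pair 0) ws @ map (\<lambda>v. (v, 0)) vs) z) \<le> C"
    for us ws vs
  proof (induction us arbitrary: ws vs rule: rev_induct)
    case Nil
    then show ?case using C by simp
  next
    case (snoc u us)
    obtain v w where u: "u = (v, w)" by force
    obtain C1 where C1: "\<And>h z. h \<in> A \<Longrightarrow> norm (iter_deriv euclidean h (us @ map (Pair 0) ws @ map (\<lambda>v. (v, 0)) (v # vs)) z) \<le> C1"
      using snoc.IH[of ws "v # vs"] by blast
    obtain C2 where C2: "\<And>h z. h \<in> A \<Longrightarrow> norm (iter_deriv euclidean h (us @ map (Pair 0) (w # ws) @ map (\<lambda>v. (v, 0)) vs) z) \<le> C2"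
      using snoc.IH[of "w # ws" vs] by blast
    have "norm (iter_deriv euclidean h (us @ (v, w) # map (Pair 0) ws @ map (\<lambda>v. (v, 0)) vs) z) \<le> C1 + C2"
      if "h \<in> A" for h z
      unfolding iter_deriv_Pair_split[OF A[OF that]] by (rule norm_triangle_le[OF add_mono[OF C1[OF that] C2[OF that]]])
    then show ?case
      unfolding u append_assoc append_Cons append_Nil by (intro exI[of _ "C1 + C2"] ballI allI)
  qed
  from this[of _ "[]" "[]"] have bd: "\<exists>C. \<forall>h\<in>A. \<forall>z\<in>UNIV. norm (iter_deriv euclidean h us z) \<le> C" for us
    by simp
  have "\<exists>a. \<forall>k. \<forall>h\<in>A. \<forall>z\<in>UNIV. \<forall>us. length us = k \<and> (\<forall>u\<in>set us. norm u \<le> 1) \<longrightarrow>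
      norm (iter_deriv euclidean h us z) \<le> a k"
    by (rule choice, rule allI, rule iter_deriv_multilinear_bound[OF A bd])
  then show ?thesis
    unfolding dominated_def unit_vectors_def using A by blast
qed

text \<open>What uncurrying asks of the inner space: every derivative is dominated by a continuous
  seminorm uniformly in the point \<open>y\<close>, so that convergence in \<open>F\<close> implies
  uniform convergence of derivatives.\<close>

locale uncurry_source =
  fixes F :: "('b::euclidean_space \<Rightarrow> 'c::euclidean_space) topology"
  assumes sep: "separated_lc F"
    and smooth: "h \<in> topspace F \<Longrightarrow> smooth_into euclidean h"
    and control: "\<exists>p\<in>cont_seminorms F. \<forall>h\<in>topspace F. \<forall>y. norm (iter_deriv euclidean h ws y) \<le> p h"
begin

definition mixed_deriv :: "('a::euclidean_space \<Rightarrow> 'b \<Rightarrow> 'c) \<Rightarrow> 'a list \<Rightarrow> 'b list \<Rightarrow> 'a \<times> 'b \<Rightarrow> 'c" where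
  "mixed_deriv g vs ws z = iter_deriv euclidean (iter_deriv F g vs (fst z)) ws (snd z)"

text \<open>Moving the first variable changes the derivative by at most \<open>p\<close> of a
  difference in \<open>F\<close>, uniformly in the second variable; with the first variable fixed, a
  derivative of a smooth function remains.\<close>

lemma mixed_deriv_continuous:
  fixes g :: "'a::euclidean_space \<Rightarrow> 'b \<Rightarrow> 'c"
  assumes g: "smooth_into F g"
  shows "continuous_on UNIV (mixed_deriv g vs ws)"
proof -
  let ?G = "iter_deriv F g vs"
  note lc = separated_lcD(1)[OF sep] and V = separated_lcD(2)[OF sep] and sE = separated_lc_euclidean[where 'a = 'c]
  note GV = smooth_intoD(3)[OF g, of vs]
  obtain p where p: "p \<in> cont_seminorms F" "\<And>h y. h \<in> topspace F \<Longrightarrow> norm (iter_deriv euclidean h ws y) \<le> p h"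
    using control by blast
  have "isCont (mixed_deriv g vs ws) z" for z
  proof -
    have "limitin F ?G (?G (fst z)) (at (fst z))"
      using smooth_intoD(1)[OF g, of vs] by (simp add: continuous_map_euclidean_limitin)
    then have "((\<lambda>x. p (?G x - ?G (fst z))) \<longlongrightarrow> 0) (at (fst z))"
      using p(1) by (simp add: limitin_locally_convex[OF lc])
    moreover have p0: "p 0 = 0" by (rule seminorm_on_0[OF locally_convexD(3)[OF lc p(1)] subspace_0[OF V]])
    ultimately have "isCont (\<lambda>x. p (?G x - ?G (fst z))) (fst z)" by (simp add: isCont_def)
    then have "isCont (\<lambda>z'. p (?G (fst z') - ?G (fst z))) z"
      using isCont_o2[of z fst "\<lambda>x. p (?G x - ?G (fst z))"] by (simp add: isCont_fst)
    then have t1: "((\<lambda>z'. p (?G (fst z') - ?G (fst z))) \<longlongrightarrow> 0) (at z)" by (simp add: isCont_def p0)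
    have "isCont (\<lambda>z'. iter_deriv euclidean (?G (fst z)) ws (snd z')) z"
      using iter_deriv_continuous[OF smooth[OF GV], of "fst z" ws]
        isCont_o2[of z snd "iter_deriv euclidean (?G (fst z)) ws"]
      by (simp add: continuous_on_eq_continuous_at isCont_snd)
    then have t2: "((\<lambda>z'. norm (iter_deriv euclidean (?G (fst z)) ws (snd z') - mixed_deriv g vs ws z)) \<longlongrightarrow> 0) (at z)"
      unfolding mixed_deriv_def by (intro tendsto_norm_zero LIM_zero) (simp add: isCont_def)
    have le: "norm (mixed_deriv g vs ws z' - mixed_deriv g vs ws z) \<le> p (?G (fst z') - ?G (fst z)) +
        norm (iter_deriv euclidean (?G (fst z)) ws (snd z') - mixed_deriv g vs ws z)" for z'
    proof -
      have "mixed_deriv g vs ws z' - mixed_deriv g vs ws z = iter_deriv euclidean (?G (fst z') - ?G (fst z)) ws (snd z')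
          + (iter_deriv euclidean (?G (fst z)) ws (snd z') - mixed_deriv g vs ws z)"
        unfolding smooth_into_diff_fun(2)[OF sE smooth[OF GV] smooth[OF GV]] by (simp add: mixed_deriv_def)
      then show ?thesis
        using norm_triangle_le[OF add_mono[OF p(2)[OF subspace_diff[OF V GV GV]] order_refl]] by metis
    qed
    have "((\<lambda>z'. mixed_deriv g vs ws z' - mixed_deriv g vs ws z) \<longlongrightarrow> 0) (at z)"
      by (rule Lim_null_comparison[OF always_eventually[OF allI[OF le]]])
        (use tendsto_add[OF t1 t2] in simp)
    then show ?thesis unfolding isCont_def by (rule LIM_zero_cancel)
  qed
  then show ?thesis by (simp add: continuous_at_imp_continuous_on)
qed

text \<open>The increment is taken in the first variable at the displaced point
  \<open>y + t w\<close> and in the second variable at \<open>x\<close>. Because \<open>p\<close>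
  controls all points at once, the point \<open>y + t w\<close> may vary with \<open>t\<close> in
  the first part.\<close>

lemma mixed_deriv_limit:
  fixes g :: "'a::euclidean_space \<Rightarrow> 'b \<Rightarrow> 'c"
  assumes g: "smooth_into F g"
  shows "((\<lambda>t. (mixed_deriv g vs ws (z + t *\<^sub>R (v, w)) - mixed_deriv g vs ws z) /\<^sub>R t)
    \<longlongrightarrow> mixed_deriv g (v # vs) ws z + mixed_deriv g vs (w # ws) z) (at (0::real))"
proof -
  obtain x y where z: "z = (x, y)" by force
  let ?G = "iter_deriv F g vs"
  let ?d = "iter_deriv F g (v # vs) x"
  let ?q = "\<lambda>t. (?G (x + t *\<^sub>R v) - ?G x) /\<^sub>R t"
  let ?E = "\<lambda>h. iter_deriv euclidean h ws"
  note lc = separated_lcD(1)[OF sep] and V = separated_lcD(2)[OF sep] and sE = separated_lc_euclidean[where 'a = 'c]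
  note GV = smooth_intoD(3)[OF g]
  have qV: "?q t \<in> topspace F" for t by (intro subspace_scale[OF V] subspace_diff[OF V] GV)
  obtain p where p: "p \<in> cont_seminorms F" "\<And>h y. h \<in> topspace F \<Longrightarrow> norm (?E h y) \<le> p h"
    using control by blast
  have n1: "((\<lambda>t. p (?q t - ?d)) \<longlongrightarrow> 0) (at 0)"
    using smooth_intoD(2)[OF g sep, of vs x v] p(1) unfolding limitin_locally_convex[OF lc] by blast
  have n2: "norm (?E (?q t) (y + t *\<^sub>R w) - ?E ?d (y + t *\<^sub>R w)) \<le> p (?q t - ?d)" for t
    using p(2)[OF subspace_diff[OF V qV[of t] GV[of "v # vs" x]], of "y + t *\<^sub>R w"] unfolding smooth_into_diff_fun(2)[OF sE smooth[OF qV] smooth[OF GV]] .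
  have l1: "((\<lambda>t. ?E (?q t) (y + t *\<^sub>R w) - ?E ?d (y + t *\<^sub>R w)) \<longlongrightarrow> 0) (at 0)"
    by (rule Lim_null_comparison[OF always_eventually[OF allI[OF n2]] n1])
  have "((\<lambda>t. y + t *\<^sub>R w) \<longlongrightarrow> y + 0 *\<^sub>R w) (at (0::real))" by (intro tendsto_intros)
  then have l2: "((\<lambda>t. ?E ?d (y + t *\<^sub>R w)) \<longlongrightarrow> ?E ?d (y + 0 *\<^sub>R w)) (at 0)"
    by (rule continuous_on_tendsto_compose[OF iter_deriv_continuous[OF smooth[OF GV]]]) auto
  have l3: "((\<lambda>t. (?E (?G x) (y + t *\<^sub>R w) - ?E (?G x) y) /\<^sub>R t) \<longlongrightarrow> iter_deriv euclidean (?G x) (w # ws) y) (at 0)"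
    by (rule iter_deriv_euclidean_tendsto[OF smooth[OF GV]])
  have eq: "(mixed_deriv g vs ws (z + t *\<^sub>R (v, w)) - mixed_deriv g vs ws z) /\<^sub>R t
      = (?E (?q t) (y + t *\<^sub>R w) - ?E ?d (y + t *\<^sub>R w)) + ?E ?d (y + t *\<^sub>R w)
      + (?E (?G x) (y + t *\<^sub>R w) - ?E (?G x) y) /\<^sub>R t" for t
  proof -
    have "?E (?q t) (y + t *\<^sub>R w) = (?E (?G (x + t *\<^sub>R v)) (y + t *\<^sub>R w) - ?E (?G x) (y + t *\<^sub>R w)) /\<^sub>R t"
      unfolding iter_deriv_scale_fun[OF sE smooth_into_diff_fun(1)[OF sE smooth[OF GV] smooth[OF GV]]]
        smooth_into_diff_fun(2)[OF sE smooth[OF GV] smooth[OF GV]] ..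
    then show ?thesis by (simp add: z mixed_deriv_def scaleR_diff_right)
  qed
  show ?thesis
    unfolding eq using tendsto_add[OF tendsto_add[OF l1 l2] l3] by (simp add: z mixed_deriv_def del: iter_deriv.simps)
qed

text \<open>A directional derivative of a mixed derivative is a sum of two mixed derivatives, so
  their finite sums are closed under differentiation. Lists of pairs encode these sums for the
  coinductive criterion.\<close>

lemma uncurry_smooth:
  fixes g :: "'a::euclidean_space \<Rightarrow> 'b \<Rightarrow> 'c"
  assumes g: "smooth_into F g"
  shows "smooth_into euclidean (\<lambda>z. g (fst z) (snd z))"
proof -
  define s where "s L z = (\<Sum>(vs, ws)\<leftarrow>L. mixed_deriv g vs ws z)" for L z
  have s_simps: "s [] z = 0" "s (p # L) z = mixed_deriv g (fst p) (snd p) z + s L z" for p L z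
    by (simp_all add: s_def case_prod_beta)
  show ?thesis
  proof (rule smooth_into_coinduct[OF separated_lc_euclidean, where S = "range s"])
    have "s [([], [])] = (\<lambda>z. g (fst z) (snd z))" by (simp add: fun_eq_iff s_def mixed_deriv_def)
    then show "(\<lambda>z. g (fst z) (snd z)) \<in> range s" by (metis rangeI)
  next
    fix f assume "f \<in> range s"
    then obtain L where L: "f = s L" by blast
    have "continuous_on UNIV (s L)"
      by (induction L) (auto simp: s_simps intro!: continuous_intros mixed_deriv_continuous[OF g])
    then show "continuous_map euclidean euclidean f" by (simp add: L)
    fix u :: "'a \<times> 'b"
    obtain v w where u: "u = (v, w)" by force
    have "\<exists>L'. \<forall>z. ((\<lambda>t. (s L (z + t *\<^sub>R u) - s L z) /\<^sub>R t) \<longlongrightarrow> s L' z) (at 0)"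
    proof (induction L)
      case Nil
      show ?case by (intro exI[of _ "[]"]) (simp add: s_simps)
    next
      case (Cons p L)
      then obtain L' where L': "\<And>z. ((\<lambda>t. (s L (z + t *\<^sub>R u) - s L z) /\<^sub>R t) \<longlongrightarrow> s L' z) (at 0)" by blast
      obtain vs ws where p: "p = (vs, ws)" by force
      have "((\<lambda>t. (s (p # L) (z + t *\<^sub>R u) - s (p # L) z) /\<^sub>R t) \<longlongrightarrow> s ((v # vs, ws) # (vs, w # ws) # L') z) (at 0)" for z
        using tendsto_add[OF mixed_deriv_limit[OF g, of vs ws z v w] L'[of z]]
        by (simp add: s_simps p u add_diff_add scaleR_add_right add.assoc)
      then show ?case by blast
    qed
    then show "\<exists>f'\<in>range s. \<forall>z. limitin euclidean (\<lambda>t. (f (z + t *\<^sub>R u) - f z) /\<^sub>R t) (f' z) (at 0)"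
      unfolding L by auto
  qed
qed

text \<open>A direction \<open>(v, 0)\<close> extends \<open>vs\<close>, because the second summand
  in \<open>mixed_deriv_limit\<close> vanishes for \<open>w = 0\<close>. The second-variable
  directions are then read off a slice.\<close>

lemma iter_deriv_uncurry:
  fixes g :: "'a::euclidean_space \<Rightarrow> 'b \<Rightarrow> 'c"
  assumes g: "smooth_into F g"
  shows "iter_deriv euclidean (\<lambda>z. g (fst z) (snd z)) (map (Pair 0) ws @ map (\<lambda>v. (v, 0)) vs) z = mixed_deriv g vs ws z"
proof -
  let ?h = "\<lambda>z. g (fst z) (snd z)"
  let ?V = "map (\<lambda>v. (v, 0)) :: 'a list \<Rightarrow> ('a \<times> 'b) list"
  have 1: "iter_deriv euclidean ?h (?V vs) = mixed_deriv g vs []" for vs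
  proof (induction vs)
    case Nil
    show ?case by (simp add: mixed_deriv_def fun_eq_iff)
  next
    case (Cons v vs)
    show ?case
    proof
      fix z
      have "mixed_deriv g vs [0] z = 0"
        using iter_deriv_scale_direction[OF smooth[OF smooth_intoD(3)[OF g, of vs "fst z"]], of 0 0 "[]" "snd z"]
        by (simp add: mixed_deriv_def del: iter_deriv.simps)
      then have "limitin euclidean (\<lambda>t. (mixed_deriv g vs [] (z + t *\<^sub>R (v, 0)) - mixed_deriv g vs [] z) /\<^sub>R t)
          (mixed_deriv g (v # vs) [] z) (at (0::real))"
        using mixed_deriv_limit[OF g, of vs "[]" z v 0] by simp
      from dir_deriv_eqI[OF separated_lc_euclidean this]
      show "iter_deriv euclidean ?h (?V (v # vs)) z = mixed_deriv g (v # vs) [] z"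
        by (simp add: Cons.IH)
    qed
  qed
  have sm: "smooth_into euclidean (mixed_deriv g vs [])"
    using smooth_into_iter_deriv[OF uncurry_smooth[OF g], of "?V vs"] unfolding 1 .
  have eq: "(\<lambda>y. mixed_deriv g vs [] (fst z, y)) = iter_deriv F g vs (fst z)" by (simp add: mixed_deriv_def)
  have "iter_deriv euclidean (iter_deriv F g vs (fst z)) ws (snd z) = iter_deriv euclidean (mixed_deriv g vs []) (map (Pair 0) ws) z"
    using fun_cong[OF smooth_slice(2)[OF sm, of "fst z" ws], of "snd z"] unfolding eq by simp
  then show ?thesis unfolding iter_deriv_append 1 by (simp add: mixed_deriv_def)
qed

end

section \<open>Uncurrying test functions\<close>

lemma uncurry_source_Dspace:
  "uncurry_source (Dspace euclidean :: ('b::euclidean_space \<Rightarrow> 'c::euclidean_space) topology)"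
proof
  show "separated_lc (Dspace euclidean :: ('b \<Rightarrow> 'c) topology)"
    by (rule separated_lc_Dspace[OF separated_lc_euclidean])
  show "smooth_into euclidean h" if "h \<in> topspace (Dspace euclidean)" for h :: "'b \<Rightarrow> 'c"
    using that by (auto simp: topspace_Dspace CinfK_carrier_def)
  show "\<exists>p\<in>cont_seminorms (Dspace euclidean). \<forall>h\<in>topspace (Dspace euclidean). \<forall>y.
      norm (iter_deriv euclidean h ws y :: 'c) \<le> p h" for ws :: "'b list"
    using Dspace_cont_seminorm[OF separated_lc_euclidean norm_cont_seminorms, of ws]
      Dspace_seminorm_le_SUP[OF separated_lc_euclidean norm_cont_seminorms, of _ ws]
    by (intro bexI[of _ "\<lambda>h. SUP y. norm (iter_deriv euclidean h ws y)"]) auto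
qed

text \<open>The values of all members of \<open>B\<close> form a bounded set of the inner space; its
  common support \<open>L\<close> is the second factor of the support. The derivative bounds come
  from \<open>control\<close>, because its seminorms are bounded along the derivatives of
  \<open>B\<close>.\<close>

lemma uncurry_bounded_Dspace:
  fixes B :: "('a::euclidean_space \<Rightarrow> 'b::euclidean_space \<Rightarrow> 'c::euclidean_space) set"
  assumes "bounded_in (Dspace (Dspace euclidean)) B"
  shows "bounded_in (Dspace euclidean) ((\<lambda>g z. g (fst z) (snd z)) ` B)"
proof -
  let ?F = "Dspace euclidean :: ('b \<Rightarrow> 'c) topology"
  interpret uncurry_source ?F by (rule uncurry_source_Dspace)
  note b = assms[unfolded bounded_in_Dspace[OF sep]]
  obtain K where K: "compact K" "B \<subseteq> CinfK_carrier K ?F" using b by blast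
  have sm: "smooth_into ?F g" and off: "x \<notin> K \<Longrightarrow> g x = 0" if "g \<in> B" for g x
    using that K(2) by (auto simp: CinfK_carrier_def)
  have "bounded_in ?F {g x | g x. g \<in> B}"
    unfolding bounded_in_locally_convex[OF separated_lcD(1)[OF sep]]
  proof (intro conjI ballI)
    show "{g x | g x. g \<in> B} \<subseteq> topspace ?F" using smooth_into_in_topspace[OF sm] by blast
    fix p assume "p \<in> cont_seminorms ?F"
    then obtain C where "\<forall>g\<in>B. \<forall>x. p (iter_deriv ?F g [] x) \<le> C" using b by blast
    then show "\<exists>C. \<forall>h\<in>{g x | g x. g \<in> B}. p h \<le> C" by auto
  qed
  from conjunct1[OF this[unfolded bounded_in_Dspace_dominated]]
  obtain L where L1: "compact L" "\<forall>h\<in>{g x | g x. g \<in> B}. \<forall>y. y \<notin> L \<longrightarrow> h y = 0" by (elim exE conjE)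
  have L: "g x y = 0" if "g \<in> B" "y \<notin> L" for g x y using L1(2) that by auto
  have "\<exists>a. \<forall>h\<in>(\<lambda>g z. g (fst z) (snd z)) ` B. dominated a h"
  proof (rule mixed_derivs_ex_bound)
    fix ws :: "'b list" and vs :: "'a list"
    obtain p where p: "p \<in> cont_seminorms ?F" "\<And>h y. h \<in> topspace ?F \<Longrightarrow> norm (iter_deriv euclidean h ws y) \<le> p h"
      using control[of ws] by blast
    obtain C where C: "\<And>g x. g \<in> B \<Longrightarrow> p (iter_deriv ?F g vs x) \<le> C" using b p(1) by blast
    have "norm (mixed_deriv g vs ws z) \<le> C" if "g \<in> B" for g z
      unfolding mixed_deriv_def using p(2)[OF smooth_intoD(3)[OF sm[OF that]]] C[OF that] by (rule order_trans)
    then show "\<exists>C. \<forall>h\<in>(\<lambda>g z. g (fst z) (snd z)) ` B. \<forall>z.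
        norm (iter_deriv euclidean h (map (Pair 0) ws @ map (\<lambda>v. (v, 0)) vs) z) \<le> C"
      using iter_deriv_uncurry[OF sm] by (intro exI[of _ C]) simp
  qed (use uncurry_smooth[OF sm] in auto)
  moreover have "\<forall>h\<in>(\<lambda>g z. g (fst z) (snd z)) ` B. \<forall>z. z \<notin> K \<times> L \<longrightarrow> h z = 0"
    using off L by (auto simp: mem_Times_iff)
  ultimately show ?thesis
    unfolding bounded_in_Dspace_dominated using compact_Times[OF K(1) L1(1)] by blast
qed

section \<open>Uncurrying ultradifferentiable maps\<close>

text \<open>Weak boundedness against all functionals \<open>\<Sum>\<^sub>k c\<^sub>k e\<^sub>\<nu>\<^sub>(\<^sub>k\<^sub>)\<close> with \<open>c \<in> \<ell>\<^sup>1\<close> implies uniform boundedness; this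
  replaces Mackey's theorem, and with it the Hahn--Banach theorem.\<close>

lemma weakly_bounded_imp_bounded:
  fixes F :: "'v::real_vector topology" and e :: "nat \<Rightarrow> 'v \<Rightarrow> real"
  assumes F: "locally_convex F" and lin: "\<And>n. linear_on_set (topspace F) (e n)"
    and p: "p \<in> cont_seminorms F" "\<And>n h. h \<in> topspace F \<Longrightarrow> \<bar>e n h\<bar> \<le> p h"
    and h: "\<And>m. h m \<in> topspace F" and weak: "\<And>l. l \<in> dual_space F \<Longrightarrow> \<exists>C. \<forall>m. \<bar>l (h m)\<bar> \<le> (C :: real)"
  shows "\<exists>C. \<forall>n m. \<bar>e n (h m)\<bar> \<le> C"
proof (rule gliding_hump)
  fix m
  show "\<exists>C. \<forall>n. \<bar>e n (h m)\<bar> \<le> C" using p(2)[OF h] by blast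
next
  fix \<nu> :: "nat \<Rightarrow> nat" and c :: "nat \<Rightarrow> real" assume c: "summable (\<lambda>k. \<bar>c k\<bar>)"
  \<comment> \<open>On \<open>topspace F\<close> the series converges absolutely and is at most the
    sum of all \<open>\<bar>c k\<bar>\<close> times \<open>p\<close>, which makes \<open>?l\<close>
    a continuous functional.\<close>
  let ?l = "\<lambda>x. \<Sum>k. c k * e (\<nu> k) x"
  have le: "\<bar>c k * e (\<nu> k) x\<bar> \<le> p x * \<bar>c k\<bar>" if "x \<in> topspace F" for x k
    using mult_right_mono[OF p(2)[OF that, of "\<nu> k"], of "\<bar>c k\<bar>"] by (simp add: abs_mult mult.commute)
  have abs_sum: "summable (\<lambda>k. \<bar>c k * e (\<nu> k) x\<bar>)" if x: "x \<in> topspace F" for x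
    by (rule summable_comparison_test'[OF summable_mult[OF c, of "p x"], of 0]) (use le[OF x] in simp)
  have sums: "summable (\<lambda>k. c k * e (\<nu> k) x)" if "x \<in> topspace F" for x
    by (rule summable_rabs_cancel[OF abs_sum[OF that]])
  have "?l \<in> dual_space F"
  proof (rule dual_spaceI[OF F _ cont_seminorms_mult[OF p(1), of "\<Sum>k. \<bar>c k\<bar>"]])
    show "linear_on_set (topspace F) ?l"
      unfolding linear_on_set_def
    proof (intro conjI ballI allI)
      fix x y assume xy: "x \<in> topspace F" "y \<in> topspace F"
      show "?l (x + y) = ?l x + ?l y"
        using suminf_add[OF sums[OF xy(1)] sums[OF xy(2)]]
        by (simp add: linear_on_setD(1)[OF lin xy] distrib_left)
    next
      fix r x assume x: "x \<in> topspace F"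
      show "?l (r *\<^sub>R x) = r *\<^sub>R ?l x"
        using suminf_mult[OF sums[OF x], of r] by (simp add: linear_on_setD(2)[OF lin x] mult.left_commute)
    qed
    show "0 \<le> (\<Sum>k. \<bar>c k\<bar>)" by (rule suminf_nonneg[OF c]) simp
    fix x assume x: "x \<in> topspace F"
    have "\<bar>?l x\<bar> \<le> (\<Sum>k. \<bar>c k * e (\<nu> k) x\<bar>)" by (rule summable_rabs[OF abs_sum[OF x]])
    also have "\<dots> \<le> (\<Sum>k. p x * \<bar>c k\<bar>)" by (rule suminf_le[OF le[OF x] abs_sum[OF x] summable_mult[OF c]])
    also have "\<dots> = (\<Sum>k. \<bar>c k\<bar>) * p x" using suminf_mult[OF c, of "p x"] by (simp only: mult.commute)
    finally show "\<bar>?l x\<bar> \<le> (\<Sum>k. \<bar>c k\<bar>) * p x" .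
  qed
  from weak[OF this] show "\<exists>C. \<forall>m. \<bar>\<Sum>k. c k * e (\<nu> k) (h m)\<bar> \<le> C" .
qed

lemma iter_deriv_sgn:
  fixes f :: "'a::euclidean_space \<Rightarrow> 'b::euclidean_space"
  assumes f: "smooth_into euclidean f"
  shows "iter_deriv euclidean f vs = prod_list (map norm vs) *\<^sub>R iter_deriv euclidean f (map sgn vs)"
proof (induction vs)
  case (Cons v vs)
  show ?case
  proof
    fix x
    let ?g = "iter_deriv euclidean f (map sgn vs)"
    have "iter_deriv euclidean f (v # vs) x = norm v *\<^sub>R iter_deriv euclidean f (sgn v # vs) x"
      using iter_deriv_scale_direction[OF f, of "norm v" "sgn v" vs x] by (simp only: norm_scaleR_sgn)
    also have "iter_deriv euclidean f (sgn v # vs) x = iter_deriv euclidean (prod_list (map norm vs) *\<^sub>R ?g) [sgn v] x"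
      by (simp only: iter_deriv.simps Cons.IH)
    also have "\<dots> = prod_list (map norm vs) *\<^sub>R iter_deriv euclidean ?g [sgn v] x"
      by (rule iter_deriv_scale_fun[OF separated_lc_euclidean smooth_into_iter_deriv[OF f]])
    finally show "iter_deriv euclidean f (v # vs) x
        = (prod_list (map norm (v # vs)) *\<^sub>R iter_deriv euclidean f (map sgn (v # vs))) x" by simp
  qed
qed simp

text \<open>Vector values are handled by summing the scalar test seminorms over the coordinates,
  since the topology is given through functionals of the values.\<close>

lemma DMspace_test_seminorm:
  fixes y :: "'i \<Rightarrow> 'b::euclidean_space"
  assumes M: "weight_sequence M" and \<sigma>: "test_weights s \<sigma> (\<lambda>n. length (ws n))" and ws: "\<And>n. unit_vectors (ws n)"
  shows "\<exists>p\<in>cont_seminorms (DMspace s M euclidean). \<forall>h\<in>topspace (DMspace s M euclidean). \<forall>n.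
    norm (iter_deriv euclidean h (ws n) (y n) :: 'c::euclidean_space)
      \<le> p h * (\<sigma> n ^ length (ws n) * weight_fact M (length (ws n)))"
proof -
  let ?D = "\<lambda>n. \<sigma> n ^ length (ws n) * weight_fact M (length (ws n))"
  let ?q = "\<lambda>f. SUP n. \<bar>iter_deriv euclideanreal f (ws n) (y n) / ?D n\<bar>"
  let ?p = "\<lambda>h. \<Sum>b\<in>Basis. ?q ((\<lambda>v :: 'c. v \<bullet> b) \<circ> h)"
  have q: "?q \<in> cont_seminorms (BM_real s M)" by (rule BM_real_test_seminorm(1)[OF M \<sigma> ws])
  have p: "?p \<in> cont_seminorms (DMspace s M euclidean)"
    by (rule cont_seminorms_sum[OF finite_Basis DMspace_cont_seminorm[OF M separated_lc_euclidean dual_space_euclidean_inner q]])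
  have D: "?D n > 0" for n using test_weights_pos[OF \<sigma>] weight_fact_pos[OF M] by simp
  have "norm (iter_deriv euclidean h (ws n) (y n)) \<le> ?p h * ?D n" if h: "h \<in> topspace (DMspace s M euclidean)" for h n
  proof -
    have sm: "smooth_into euclidean h" and hb: "(\<lambda>v. v \<bullet> b) \<circ> h \<in> topspace (BM_real s M)" for b
      using h dual_space_euclidean_inner[of b] by (auto simp: topspace_DMspace[OF M] topspace_CMK[OF M])
    have "norm (iter_deriv euclidean h (ws n) (y n)) \<le> (\<Sum>b\<in>Basis. \<bar>iter_deriv euclidean h (ws n) (y n) \<bullet> b\<bar>)"
      by (rule norm_le_l1)
    also have "\<dots> \<le> (\<Sum>b\<in>Basis. ?q ((\<lambda>v. v \<bullet> b) \<circ> h) * ?D n)"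
    proof (rule sum_mono)
      fix b :: 'c
      have "\<bar>iter_deriv euclideanreal ((\<lambda>v. v \<bullet> b) \<circ> h) (ws n) (y n) / ?D n\<bar> \<le> ?q ((\<lambda>v. v \<bullet> b) \<circ> h)"
        by (rule BM_real_test_seminorm(2)[OF M \<sigma> ws hb])
      moreover have "iter_deriv euclideanreal ((\<lambda>v. v \<bullet> b) \<circ> h) (ws n) (y n) = iter_deriv euclidean h (ws n) (y n) \<bullet> b"
        using iter_deriv_inner(2)[OF sm, of b "ws n" "y n"] by (simp only: o_def)
      ultimately have "\<bar>iter_deriv euclidean h (ws n) (y n) \<bullet> b\<bar> / ?D n \<le> ?q ((\<lambda>v. v \<bullet> b) \<circ> h)"
        by (simp only: abs_divide abs_of_pos[OF D])
      then show "\<bar>iter_deriv euclidean h (ws n) (y n) \<bullet> b\<bar> \<le> ?q ((\<lambda>v. v \<bullet> b) \<circ> h) * ?D n"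
        by (simp only: pos_divide_le_eq[OF D])
    qed
    finally show ?thesis by (simp only: sum_distrib_right)
  qed
  then show ?thesis by (intro bexI[OF _ p] ballI allI)
qed

lemma uncurry_source_DMspace:
  assumes M: "weight_sequence M"
  shows "uncurry_source (DMspace s M euclidean :: ('b::euclidean_space \<Rightarrow> 'c::euclidean_space) topology)"
proof
  let ?F = "DMspace s M euclidean :: ('b \<Rightarrow> 'c) topology"
  show "separated_lc ?F" by (rule separated_lc_DMspace[OF M separated_lc_euclidean])
  show sm: "smooth_into euclidean h" if "h \<in> topspace ?F" for h
    using that by (auto simp: topspace_DMspace[OF M] topspace_CMK[OF M])
  show "\<exists>p\<in>cont_seminorms ?F. \<forall>h\<in>topspace ?F. \<forall>y. norm (iter_deriv euclidean h ws y) \<le> p h" for ws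
  proof -
    let ?us = "map sgn ws"
    let ?P = "prod_list (map norm ws)" and ?w = "weight_fact M (length ws)"
    have us: "unit_vectors ?us" by (auto simp: unit_vectors_def norm_sgn_le_1)
    have P: "?P \<ge> 0" by (rule prod_list_nonneg) auto
    \<comment> \<open>The index of the test seminorm is the point \<open>y\<close> itself; as the
      order is fixed, the weight 1 is admissible and the bound is uniform in
      \<open>y\<close>.\<close>
    obtain p where p: "p \<in> cont_seminorms ?F"
      "\<And>h y. h \<in> topspace ?F \<Longrightarrow> norm (iter_deriv euclidean h ?us y) \<le> p h * ?w"
      using DMspace_test_seminorm[OF M test_weights_const us, where y = "\<lambda>y. y" and s = s and 'c = 'c] by auto
    have "norm (iter_deriv euclidean h ws y) \<le> (?P * ?w) * p h" if h: "h \<in> topspace ?F" for h y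
      using mult_left_mono[OF p(2)[OF h, of y] P] P
      by (subst iter_deriv_sgn[OF sm[OF h]]) (simp add: mult_ac)
    then show ?thesis
      using cont_seminorms_mult[OF p(1), of "?P * ?w"] P weight_fact_pos[OF M, of "length ws"]
      by (intro bexI[of _ "\<lambda>h. (?P * ?w) * p h"]) (auto simp: less_imp_le)
  qed
qed

text \<open>A family violating the estimate yields point evaluations of derivatives \<open>e\<^sub>n\<close> and a weakly bounded sequence
  \<open>h\<^sub>m\<close> in the space with \<open>e\<^sub>n(h\<^sub>n)\<close> unbounded. Log-convexity enters by splitting \<open>(j + k)! M\<^sub>j\<^sub>+\<^sub>k\<close>.\<close>

lemma mixed_deriv_ultra_bound:
  fixes B :: "('a::euclidean_space \<Rightarrow> 'b::euclidean_space \<Rightarrow> 'c::euclidean_space) set"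
  assumes M: "weight_sequence M" and lcv: "weakly_log_convex M"
    and B: "ultra_bounded s M (DMspace s M euclidean) B"
  shows "\<exists>a. ultra_seq s M a \<and> (\<forall>g\<in>B. \<forall>vs ws z. unit_vectors vs \<longrightarrow> unit_vectors ws \<longrightarrow>
    norm (iter_deriv euclidean (iter_deriv (DMspace s M euclidean) g vs (fst z)) ws (snd z)) \<le> a (length ws + length vs))"
proof -
  let ?F = "DMspace s M euclidean :: ('b \<Rightarrow> 'c) topology"
  interpret uncurry_source ?F by (rule uncurry_source_DMspace[OF M])
  have sm: "smooth_into ?F g" if "g \<in> B" for g using B that by (simp add: ultra_bounded_def)
  let ?I = "{i :: ('a \<Rightarrow> 'b \<Rightarrow> 'c) \<times> 'a list \<times> 'b list \<times> 'a \<times> 'b.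
    fst i \<in> B \<and> unit_vectors (fst (snd i)) \<and> unit_vectors (fst (snd (snd i)))}"
  let ?\<phi> = "\<lambda>i. norm (mixed_deriv (fst i) (fst (snd i)) (fst (snd (snd i))) (snd (snd (snd i))))"
  let ?\<kappa> = "\<lambda>i :: ('a \<Rightarrow> 'b \<Rightarrow> 'c) \<times> 'a list \<times> 'b list \<times> 'a \<times> 'b. length (fst (snd (snd i))) + length (fst (snd i))"
  have "for_rho s (\<lambda>\<rho>. \<exists>C. \<forall>i\<in>?I. ?\<phi> i \<le> C * \<rho> ^ ?\<kappa> i * weight_fact M (?\<kappa> i))"
  proof (rule ccontr)
    assume "\<not> for_rho s (\<lambda>\<rho>. \<exists>C. \<forall>i\<in>?I. ?\<phi> i \<le> C * \<rho> ^ ?\<kappa> i * weight_fact M (?\<kappa> i))"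
    from not_for_rho_test_seq[OF this] obtain \<sigma> \<iota> where \<sigma>: "test_seq s \<sigma>"
      and \<iota>: "\<And>n. \<iota> n \<in> ?I" "\<And>n. ?\<phi> (\<iota> n) > real n * \<sigma> n ^ ?\<kappa> (\<iota> n) * weight_fact M (?\<kappa> (\<iota> n))" by blast
    define g vs ws x y where "g n = fst (\<iota> n)" and "vs n = fst (snd (\<iota> n))" and "ws n = fst (snd (snd (\<iota> n)))"
      and "x n = fst (snd (snd (snd (\<iota> n))))" and "y n = snd (snd (snd (snd (\<iota> n))))" for n
    have g: "g n \<in> B" and vs: "unit_vectors (vs n)" and ws: "unit_vectors (ws n)" for n
      using \<iota>(1)[of n] by (simp_all add: g_def vs_def ws_def)
    let ?G = "\<lambda>n. iter_deriv ?F (g n) (vs n) (x n)"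
    let ?z = "\<lambda>n. iter_deriv euclidean (?G n) (ws n) (y n)"
    let ?w = "weight_fact M"
    let ?D = "\<lambda>n. \<sigma> n ^ length (ws n) * ?w (length (ws n))" and ?E = "\<lambda>n. \<sigma> n ^ length (vs n) * ?w (length (vs n))"
    have GF: "?G n \<in> topspace ?F" for n by (rule smooth_intoD(3)[OF sm[OF g]])
    have D: "?D n > 0" and E: "?E n > 0" for n using test_seq_pos[OF \<sigma>] weight_fact_pos[OF M] by simp_all
    \<comment> \<open>Supermultiplicativity distributes the violated estimate over the variables:
      \<open>?D\<close> belongs to the second, \<open>?E\<close> to the first.\<close>
    have big: "norm (?z n) \<ge> real n * (?D n * ?E n)" for n
    proof -
      have "real n * (?D n * ?E n) = (real n * \<sigma> n ^ (length (ws n) + length (vs n))) * (?w (length (ws n)) * ?w (length (vs n)))"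
        by (simp add: power_add mult_ac)
      also have "\<dots> \<le> (real n * \<sigma> n ^ (length (ws n) + length (vs n))) * ?w (length (ws n) + length (vs n))"
        using test_seq_pos[OF \<sigma>, of n] by (intro mult_left_mono weight_fact_supermult[OF M lcv]) simp
      also have "\<dots> < norm (?z n)"
        using \<iota>(2)[of n] by (simp add: mixed_deriv_def g_def vs_def ws_def x_def y_def)
      finally show ?thesis by simp
    qed
    obtain p where p: "p \<in> cont_seminorms ?F"
      "\<And>h n. h \<in> topspace ?F \<Longrightarrow> norm (iter_deriv euclidean h (ws n) (y n)) \<le> p h * ?D n"
      using DMspace_test_seminorm[where ws = ws and y = y and 'c = 'c, OF M test_seq_weights[OF \<sigma>] ws] by blast
    \<comment> \<open>Pairing with \<open>sgn (?z n)\<close> makes this scalar evaluation recover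
      the full norm on the diagonal.\<close>
    define e where "e n h = (iter_deriv euclidean h (ws n) (y n) \<bullet> sgn (?z n)) / ?D n" for n and h :: "'b \<Rightarrow> 'c"
    have lin: "linear_on_set (topspace ?F) (e n)" for n
      unfolding linear_on_set_def e_def
      by (simp add: iter_deriv_add_fun[OF separated_lc_euclidean smooth smooth]
          iter_deriv_scale_fun[OF separated_lc_euclidean smooth] inner_add_left add_divide_distrib)
    \<comment> \<open>The vectors \<open>?G m\<close>, divided by \<open>?E m\<close>, are weakly
      bounded because the weights are admissible for the growth estimate of each
      \<open>l \<circ> g\<close>. The functionals \<open>e n\<close> lie below the common seminorm
      \<open>p\<close>.\<close>
    have "\<exists>C. \<forall>n m. \<bar>e n (inverse (?E m) *\<^sub>R ?G m)\<bar> \<le> C"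
    proof (rule weakly_bounded_imp_bounded[OF separated_lcD(1)[OF sep] lin p(1)])
      fix n h assume h: "h \<in> topspace ?F"
      have "\<bar>iter_deriv euclidean h (ws n) (y n) \<bullet> sgn (?z n)\<bar> \<le> norm (iter_deriv euclidean h (ws n) (y n)) * norm (sgn (?z n))"
        by (rule Cauchy_Schwarz_ineq2)
      also have "\<dots> \<le> norm (iter_deriv euclidean h (ws n) (y n)) * 1" by (intro mult_left_mono norm_sgn_le_1) simp
      also have "\<dots> \<le> p h * ?D n" using p(2)[OF h, of n] by simp
      finally show "\<bar>e n h\<bar> \<le> p h" using D[of n] by (simp only: e_def abs_divide abs_of_pos[OF D] pos_divide_le_eq[OF D])
    next
      fix m show "inverse (?E m) *\<^sub>R ?G m \<in> topspace ?F" by (rule subspace_scale[OF separated_lcD(2)[OF sep] GF])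
    next
      fix l assume l: "l \<in> dual_space ?F"
      obtain a where a: "ultra_seq s M a" "\<And>g. g \<in> B \<Longrightarrow> dominated a (l \<circ> g)"
        using B l unfolding ultra_bounded_def by blast
      obtain C where C: "\<And>n. a (length (vs n)) \<le> C * \<sigma> n ^ length (vs n) * ?w (length (vs n))"
        using ultra_seq_test_weights[OF M a(1) test_seq_weights[OF \<sigma>, of "\<lambda>n. length (vs n)"]] by blast
      have "\<bar>l (inverse (?E m) *\<^sub>R ?G m)\<bar> \<le> C" for m
      proof -
        have "\<bar>l (?G m)\<bar> \<le> a (length (vs m))"
          using dominatedD(2)[OF a(2)[OF g] vs, of m m "x m"]
          unfolding smooth_into_dual(2)[OF sep l sm[OF g]] by simp
        also have "\<dots> \<le> C * ?E m" using C[of m] by (simp only: mult.assoc)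
        finally have "\<bar>l (?G m)\<bar> / ?E m \<le> C" by (simp only: pos_divide_le_eq[OF E])
        moreover have "\<bar>l (inverse (?E m) *\<^sub>R ?G m)\<bar> = inverse (?E m) * \<bar>l (?G m)\<bar>"
          by (simp only: linear_on_setD(2)[OF dual_spaceD(1)[OF l] GF] real_scaleR_def abs_mult
              abs_of_pos[OF positive_imp_inverse_positive[OF E]])
        ultimately show ?thesis by (simp only: divide_inverse mult.commute)
      qed
      then show "\<exists>C. \<forall>m. \<bar>l (inverse (?E m) *\<^sub>R ?G m)\<bar> \<le> C" by blast
    qed
    then obtain C where C: "\<And>n m. \<bar>e n (inverse (?E m) *\<^sub>R ?G m)\<bar> \<le> C" by blast
    obtain n where n: "C < real n" using reals_Archimedean2 by blast
    have "?z n \<bullet> sgn (?z n) = norm (?z n)"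
      by (cases "?z n = 0") (simp_all add: sgn_div_norm dot_square_norm power2_eq_square)
    then have "e n (inverse (?E n) *\<^sub>R ?G n) = inverse (?E n) * (norm (?z n) / ?D n)"
      unfolding linear_on_setD(2)[OF lin GF] by (simp only: e_def real_scaleR_def)
    also have "\<dots> = norm (?z n) / (?D n * ?E n)" by (simp add: divide_inverse mult_ac)
    also have "\<dots> \<ge> real n" using big[of n] D[of n] E[of n] by (simp add: pos_le_divide_eq)
    finally have "real n \<le> C" using C[of n n] by linarith
    then show False using n by simp
  qed
  then obtain a where a: "ultra_seq s M a" "\<And>i. i \<in> ?I \<Longrightarrow> ?\<phi> i \<le> a (?\<kappa> i)"
    unfolding ex_ultra_seq_iff[OF M, symmetric] by blast
  have "norm (mixed_deriv g vs ws z) \<le> a (length ws + length vs)"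
    if "g \<in> B" "unit_vectors vs" "unit_vectors ws" for g vs ws z
    using a(2)[of "(g, vs, ws, z)"] that by simp
  with a(1) show ?thesis unfolding mixed_deriv_def by blast
qed

text \<open>Testing one functional at a time does not directly exclude supports that escape in the
  second variable. Evaluations at escaping points \<open>y n\<close>, weighted so that the
  \<open>n\<close>-th takes the value \<open>n\<close> on \<open>g n (x n)\<close>, lie below one
  escaping seminorm, while the values \<open>g m (x m)\<close> are weakly bounded;
  \<open>weakly_bounded_imp_bounded\<close> makes this contradictory.\<close>

lemma ultra_bounded_common_support:
  fixes B :: "('a::euclidean_space \<Rightarrow> 'b::euclidean_space \<Rightarrow> 'c::euclidean_space) set"
  assumes M: "weight_sequence M" and B: "ultra_bounded s M (DMspace s M euclidean) B"
  shows "\<exists>L. compact L \<and> (\<forall>g\<in>B. \<forall>x y. y \<notin> L \<longrightarrow> g x y = 0)"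
proof (rule ccontr)
  let ?F = "DMspace s M euclidean :: ('b \<Rightarrow> 'c) topology"
  assume neg: "\<not> (\<exists>L. compact L \<and> (\<forall>g\<in>B. \<forall>x y. y \<notin> L \<longrightarrow> g x y = 0))"
  have "\<exists>g x y. g \<in> B \<and> norm y > real n \<and> g x y \<noteq> 0" for n
  proof -
    obtain g x y where "g \<in> B" "y \<notin> cball 0 (real n)" "g x y \<noteq> 0"
      using neg compact_cball[of "0 :: 'b" "real n"] by blast
    then show ?thesis by (intro exI[of _ g] exI[of _ x] exI[of _ y]) simp
  qed
  then obtain g x y where g: "\<And>n. g n \<in> B" and y: "\<And>n. norm (y n) > real n" and ne: "\<And>n. g n (x n) (y n) \<noteq> 0"
    by metis
  note lc = separated_lcD(1)[OF separated_lc_DMspace[OF M separated_lc_euclidean]]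
  let ?v = "\<lambda>n. g n (x n) (y n)"
  define w where "w n = real n / (?v n \<bullet> ?v n)" for n
  have w: "w n \<ge> 0" for n by (simp add: w_def)
  let ?Q = "\<lambda>n u. \<bar>u \<bullet> ?v n\<bar>"
  have "\<exists>p\<in>cont_seminorms (lc_ind_limit {CMK s M K (euclidean :: 'c topology) | K. compact (K :: 'b set)}).
      \<forall>h\<in>topspace (lc_ind_limit {CMK s M K (euclidean :: 'c topology) | K. compact (K :: 'b set)}).
      \<forall>n. w n * ?Q n (h (y n)) \<le> p h"
  proof (rule escaping_seminorm[OF subspace_Union_CMK[OF M separated_lc_euclidean] _ subspace_UNIV _ _ _ y w])
    show "seminorm_on UNIV (?Q n)" for n
      using dual_space_abs[OF dual_space_euclidean_inner[of "?v n"]] by (simp add: cont_seminorms_def)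
    show "continuous_map (CMK s M K (euclidean :: 'c topology)) euclideanreal (\<lambda>f. ?Q n (f x))" for n and x :: 'b and K
      using CMK_compose_continuous[OF M dual_space_euclidean_inner[of "?v n"] BM_real_eval_cont_seminorm[OF M]]
      by (simp add: o_def)
  qed (auto simp: topspace_CMK[OF M])
  then obtain p where p: "p \<in> cont_seminorms ?F" "\<And>h n. h \<in> topspace ?F \<Longrightarrow> w n * ?Q n (h (y n)) \<le> p h"
    unfolding DMspace_def[symmetric] by blast
  define e where "e n h = w n * (h (y n) \<bullet> ?v n)" for n and h :: "'b \<Rightarrow> 'c"
  have "\<exists>C. \<forall>n m. \<bar>e n (g m (x m))\<bar> \<le> C"
  proof (rule weakly_bounded_imp_bounded[OF lc _ p(1)])
    show "linear_on_set (topspace ?F) (e n)" for n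
      by (simp add: linear_on_set_def e_def inner_add_left distrib_left)
    show "\<bar>e n h\<bar> \<le> p h" if "h \<in> topspace ?F" for n h
      using p(2)[OF that, of n] w[of n] by (simp add: e_def abs_mult)
    have sm: "smooth_into ?F (g m)" for m using B g by (simp add: ultra_bounded_def)
    show "g m (x m) \<in> topspace ?F" for m by (rule smooth_into_in_topspace[OF sm])
    fix l assume l: "l \<in> dual_space ?F"
    obtain a where "\<And>g. g \<in> B \<Longrightarrow> dominated a (l \<circ> g)"
      using B l unfolding ultra_bounded_def by blast
    then have "\<bar>l (g m (x m))\<bar> \<le> a 0" for m
      using dominatedD(2)[of a "l \<circ> g m" "[]" "x m"] g by simp
    then show "\<exists>C. \<forall>m. \<bar>l (g m (x m))\<bar> \<le> C" by blast
  qed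
  then obtain C where C: "\<And>n m. \<bar>e n (g m (x m))\<bar> \<le> C" by blast
  obtain n where n: "C < real n" using reals_Archimedean2 by blast
  have "e n (g n (x n)) = real n" using ne[of n] by (simp add: e_def w_def)
  then show False using C[of n n] n by simp
qed

lemma uncurry_bounded_DMspace:
  fixes B :: "('a::euclidean_space \<Rightarrow> 'b::euclidean_space \<Rightarrow> 'c::euclidean_space) set"
  assumes M: "weight_sequence M" and lcv: "weakly_log_convex M"
    and B: "bounded_in (DMspace s M (DMspace s M euclidean)) B"
  shows "bounded_in (DMspace s M euclidean) ((\<lambda>g z. g (fst z) (snd z)) ` B)"
proof -
  let ?F = "DMspace s M euclidean :: ('b \<Rightarrow> 'c) topology"
  interpret uncurry_source ?F by (rule uncurry_source_DMspace[OF M])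
  note b = B[unfolded bounded_in_DMspace[OF M sep]]
  obtain K where K: "compact K" "\<forall>g\<in>B. \<forall>x. x \<notin> K \<longrightarrow> g x = 0" using b by blast
  have ub: "ultra_bounded s M ?F B" using b by blast
  have sm: "smooth_into ?F g" if "g \<in> B" for g using ub that by (simp add: ultra_bounded_def)
  obtain L where L: "compact L" "\<forall>g\<in>B. \<forall>x y. y \<notin> L \<longrightarrow> g x y = 0"
    using ultra_bounded_common_support[OF M ub] by blast
  obtain a where a: "ultra_seq s M a" and le: "\<And>g vs ws z. g \<in> B \<Longrightarrow> unit_vectors vs \<Longrightarrow> unit_vectors ws \<Longrightarrow>
      norm (mixed_deriv g vs ws z) \<le> a (length ws + length vs)"
    using mixed_deriv_ultra_bound[OF M lcv ub] unfolding mixed_deriv_def by blast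
  \<comment> \<open>The factor \<open>2 ^ k\<close> from splitting product directions only doubles
    \<rho>, so the sequence stays in the class.\<close>
  have "dominated (\<lambda>k. 2 ^ k * a k) (\<lambda>z. g (fst z) (snd z))" if g: "g \<in> B" for g
    by (rule mixed_derivs_bound[OF uncurry_smooth[OF sm[OF g]]])
      (simp only: iter_deriv_uncurry[OF sm[OF g]] le[OF g])
  then have "\<exists>a. ultra_seq s M a \<and> (\<forall>h\<in>(\<lambda>g z. g (fst z) (snd z)) ` B. dominated a h)"
    using ultra_seq_power_2[OF M a] by blast
  moreover have "\<forall>h\<in>(\<lambda>g z. g (fst z) (snd z)) ` B. \<forall>z. z \<notin> K \<times> L \<longrightarrow> h z = 0"
    using K(2) L(2) by (auto simp: mem_Times_iff)
  ultimately show ?thesis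
    unfolding bounded_in_DMspace_dominated[OF M] using compact_Times[OF K(1) L(1)] by blast
qed

section \<open>From bounded sets to bornological isomorphisms\<close>

lemma bornological_isoI:
  assumes S: "locally_convex S" and T: "locally_convex T" and lin: "linear_on_set (topspace S) \<Phi>"
    and inv: "\<And>x. \<Psi> (\<Phi> x) = x" "\<And>y. \<Phi> (\<Psi> y) = y"
    and \<Phi>: "\<And>B. bounded_in S B \<Longrightarrow> bounded_in T (\<Phi> ` B)"
    and \<Psi>: "\<And>B. bounded_in T B \<Longrightarrow> bounded_in S (\<Psi> ` B)"
  shows "bornological_iso S T \<Phi>"
proof -
  have \<Phi>T: "\<Phi> x \<in> topspace T" if "x \<in> topspace S" for x
    using \<Phi>[of "{x}"] that by (simp add: bounded_in_singleton[OF S] bounded_in_singleton[OF T])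
  have \<Psi>S: "\<Psi> y \<in> topspace S" if "y \<in> topspace T" for y
    using \<Psi>[of "{y}"] that by (simp add: bounded_in_singleton[OF S] bounded_in_singleton[OF T])
  have bij: "bij_betw \<Phi> (topspace S) (topspace T)"
    by (rule bij_betw_byWitness[of _ \<Psi>]) (use inv \<Phi>T \<Psi>S in auto)
  have "inv_into (topspace S) \<Phi> y = \<Psi> y" if "y \<in> topspace T" for y
    by (rule inv_into_f_eq) (use bij \<Psi>S[OF that] inv(2) in \<open>auto simp: bij_betw_def\<close>)
  then have "inv_into (topspace S) \<Phi> ` B = \<Psi> ` B" if "bounded_in T B" for B
    using that by (intro image_cong) (auto simp: bounded_in_def)
  then show ?thesis
    unfolding bornological_iso_def using lin bij \<Phi> \<Psi> by simp
qed

theorem theorem5p5: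
  fixes M :: "nat \<Rightarrow> real"
  assumes "weight_sequence M" and "weakly_log_convex M" and "moderate_growth M"
  shows
    "bornological_iso
       (Dspace euclidean :: ((real^'l) \<times> (real^'m) \<Rightarrow> real^'n) topology)
       (Dspace (Dspace euclidean) :: (real^'l \<Rightarrow> real^'m \<Rightarrow> real^'n) topology)
       (\<lambda>f x y. f (x, y)) \<and>
     (\<forall>s. bornological_iso
       (DMspace s M euclidean :: ((real^'l) \<times> (real^'m) \<Rightarrow> real^'n) topology)
       (DMspace s M (DMspace s M euclidean) :: (real^'l \<Rightarrow> real^'m \<Rightarrow> real^'n) topology)
       (\<lambda>f x y. f (x, y)))"
proof (intro conjI allI)
  note E = separated_lc_euclidean[where 'a = "real^'n"]
  have lin: "linear_on_set V (\<lambda>f x y. f (x, y))" for V :: "((real^'l) \<times> (real^'m) \<Rightarrow> real^'n) set"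
    by (simp add: linear_on_set_def fun_eq_iff)
  show "bornological_iso
       (Dspace euclidean :: ((real^'l) \<times> (real^'m) \<Rightarrow> real^'n) topology)
       (Dspace (Dspace euclidean) :: (real^'l \<Rightarrow> real^'m \<Rightarrow> real^'n) topology)
       (\<lambda>f x y. f (x, y))"
    by (rule bornological_isoI[where \<Psi> = "\<lambda>g z. g (fst z) (snd z)", OF locally_convex_Dspace[OF E]
          locally_convex_Dspace[OF separated_lc_Dspace[OF E]] lin _ _ curry_bounded_Dspace uncurry_bounded_Dspace])
      simp_all
  show "bornological_iso
       (DMspace s M euclidean :: ((real^'l) \<times> (real^'m) \<Rightarrow> real^'n) topology)
       (DMspace s M (DMspace s M euclidean) :: (real^'l \<Rightarrow> real^'m \<Rightarrow> real^'n) topology)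
       (\<lambda>f x y. f (x, y))" for s
    by (rule bornological_isoI[where \<Psi> = "\<lambda>g z. g (fst z) (snd z)", OF locally_convex_DMspace[OF assms(1) E]
          locally_convex_DMspace[OF assms(1) separated_lc_DMspace[OF assms(1) E]] lin _ _
          curry_bounded_DMspace[OF assms(1,3)] uncurry_bounded_DMspace[OF assms(1,2)]])
      simp_all
qed

end
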